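(* Let $X$ be a compact Hausdorff space, $\Delta_1\subset X$ clopen, $\alpha:\Delta_1\to X$ continuous with open image $\Delta_{-1}$, $\mathcal{A}=C(X)$, and let $\delta:\mathcal{A}\to\mathcal{A}$ be the endomorphism $\delta(a)=a\circ\alpha$ on $\Delta_1$, $\delta(a)=0$ off $\Delta_1$. Suppose that $\alpha$ has no periodic points. Then the map $$V\longmapsto\langle C_{X\setminus V}(X)\rangle$$ is a lattice anti-isomorphism from $clos_\alpha(X)$ onto the lattice of ideals in $C^*(\mathcal{A},\delta)$. Moreover, for $\widetilde V\in clos_{\widetilde\alpha}(\widetilde X)$ such that $\Phi(\widetilde V)=V$ the following relations hold: $$\langle C_{X\setminus V}(X)\rangle=\langle C_{\widetilde X\setminus\widetilde V}(\widetilde X)\rangle,\qquad \langle C_{X\setminus V}(X)\rangle\cap\mathcal{B}=C_{\widetilde X\setminus\widetilde V}(\widetilde X),\qquad \langle C_{X\setminus V}(X)\rangle\cap\mathcal{A}=C_{X\setminus V}(X).$$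
   Context: $\mathbb{N}=\{0,1,2,\dots\}$. For $n\ge1$, $\Delta_n$ is the domain of $\alpha^n$ and $\Delta_{-n}=\alpha^n(\Delta_n)$; $\Delta_0=X$. For a subset $K$ of a space $Y$, $C_K(Y)$ denotes the continuous functions on $Y$ vanishing outside $K$. A periodic point is a point $x\in\Delta_n$ with $\alpha^n(x)=x$ for some $n\ge1$. Invariant sets: $V\subset X$ is $\alpha$-invariant if $\alpha^n(V\cap\Delta_n)=V\cap\Delta_{-n}$ for all $n=0,1,2,\dots$. $clos_\alpha(X)$ is the lattice of closed $\alpha$-invariant subsets of $X$, ordered by inclusion. Likewise $clos_{\widetilde\alpha}(\widetilde X)$ for the system $(\widetilde X,\widetilde\alpha)$ below. Reversible extension: adjoin to $X$ an isolated point $0$. Let $\widetilde X=\bigcup_{N\ge0}X_N\cup X_\infty\subset\prod_{n=0}^\infty(X\cup\{0\})$ with the topology induced from the product topology, where $X_N=\{(x_0,\dots,x_N,0,0,\dots):x_n\in\Delta_n,\ x_N\notin\Delta_{-1},\ \alpha(x_n)=x_{n-1}\text{ for }1\le n\le N\}$ and $X_\infty=\{(x_0,x_1,\dots):x_n\in\Delta_n,\ \alpha(x_n)=x_{n-1}\text{ for }n\ge1\}$. Let $\Phi:\widetilde X\to X$, $\Phi(x_0,x_1,\dots)=x_0$, $\widetilde\Delta_{\pm1}=\Phi^{-1}(\Delta_{\pm1})$, and $\widetilde\alpha:\widetilde\Delta_1\to\widetilde\Delta_{-1}$, $\widetilde\alpha(x_0,x_1,\dots)=(\alpha(x_0),x_0,x_1,\dots)$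 (a homeomorphism between clopen subsets of the compact space $\widetilde X$). Covariance algebra: $\mathcal{B}=C(\widetilde X)$, and $\widetilde\delta:C_{\widetilde\Delta_{-1}}(\widetilde X)\to C_{\widetilde\Delta_1}(\widetilde X)$, $\widetilde\delta(b)=b\circ\widetilde\alpha$ on $\widetilde\Delta_1$ and $0$ elsewhere, is a partial automorphism of $\mathcal{B}$. Let $D_n$ be the domain of $\widetilde\delta^{-n}$ ($n\in\mathbb{Z}$, $D_0=\mathcal{B}$), and let $L=\{a\in l^1(\mathbb{Z},\mathcal{B}):a(n)\in D_n\}$ with $(a*b)(n)=\sum_k\widetilde\delta^k(\widetilde\delta^{-k}(a(k))b(n-k))$, $(a^* )(n)=\widetilde\delta^n(a(-n)^* )$, $\|a\|=\sum_n\|a(n)\|$. $C^*(\mathcal{A},\delta)=\mathcal{B}\rtimes_{\widetilde\delta}\mathbb{Z}$ is the universal enveloping $C^*$-algebra of $L$. $\mathcal{B}$ is regarded as a subalgebra of $C^*(\mathcal{A},\delta)$ (functions supported at $n=0$), and $\mathcal{A}$ as a subalgebra of $\mathcal{B}$ via $a\mapsto a\circ\Phi$. For $K\subset\mathcal{B}$, $\langle K\rangle$ is the (closed two-sided) ideal of $C^*(\mathcal{A},\delta)$ generated by $K$.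
   Formalization: α-invariance of V is required only for n = 0, 1, i.e. α(V∩Δ_1) = V∩Δ_{-1}, instead of for all n; with all n the claim fails for some non-injective α (e.g. w→z→y, u→y: 4 ideals but 3 invariant sets), while for injective α both notions agree. *)

theory Defs
  imports "HOL-Analysis.Analysis" "HOL-Algebra.Ideal" "HOL-Algebra.Module" "HOL-Algebra.Lattice"
begin

section \<open>Partial maps and invariant sets\<close>

text \<open>A partial map of a set \<open>S\<close> is a total function \<open>f\<close> together with a domain \<open>D \<subseteq> S\<close>;
  values of \<open>f\<close> off \<open>D\<close> play no role. For \<open>S = X\<close>, \<open>f = \<alpha>\<close>, \<open>D = \<Delta>\<^sub>1\<close>, the two sets below
  are \<open>\<Delta>\<^sub>n\<close> and \<open>\<Delta>\<^sub>-\<^sub>n\<close>.\<close>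

definition pow_dom :: "'a set \<Rightarrow> 'a set \<Rightarrow> ('a \<Rightarrow> 'a) \<Rightarrow> nat \<Rightarrow> 'a set" where
  "pow_dom S D f n = {x \<in> S. \<forall>k<n. (f ^^ k) x \<in> D}"

definition pow_ran :: "'a set \<Rightarrow> 'a set \<Rightarrow> ('a \<Rightarrow> 'a) \<Rightarrow> nat \<Rightarrow> 'a set" where
  "pow_ran S D f n = (f ^^ n) ` pow_dom S D f n"

text \<open>Invariance is the condition \<open>\<alpha>\<^sup>n(V \<inter> \<Delta>\<^sub>n) = V \<inter> \<Delta>\<^sub>-\<^sub>n\<close> for \<open>n = 0, 1\<close>. The
  source asks for it for every \<open>n\<close>, and this is a correction. If \<open>\<alpha>\<close> is
  injective there is no difference; otherwise the clauses with \<open>n \<ge> 2\<close>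
  are strictly stronger, and with them the correspondence between invariant sets and ideals fails.
  Example: \<open>X = {w, z, u, y}\<close> discrete, \<open>\<Delta>\<^sub>1 = {w, z, u}\<close>, \<open>\<alpha> w = z\<close>, \<open>\<alpha> z = y\<close>,
  \<open>\<alpha> u = y\<close>. The reversible extension consists of two orbits, of lengths 3 and 2, so the algebra is
  the sum of the 3 by 3 and the 2 by 2 matrices and has four ideals. The sets satisfying the
  condition for \<open>n = 0, 1\<close> are \<open>{}\<close>, \<open>{u, y}\<close>, \<open>{w, z, y}\<close> and \<open>X\<close>; for \<open>n = 2\<close> the set
  \<open>{u, y}\<close> violates it, because \<open>\<Delta>\<^sub>2 = {w}\<close> and \<open>\<Delta>\<^sub>-\<^sub>2 = {y}\<close>.\<close>

definition invariant_sets :: "'a set \<Rightarrow> 'a set \<Rightarrow> ('a \<Rightarrow> 'a) \<Rightarrow> 'a set set" where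
  "invariant_sets S D f =
     {V. V \<subseteq> S \<and> (\<forall>n\<le>1. (f ^^ n) ` (V \<inter> pow_dom S D f n) = V \<inter> pow_ran S D f n)}"

definition clos_inv :: "'a topology \<Rightarrow> 'a set \<Rightarrow> ('a \<Rightarrow> 'a) \<Rightarrow> 'a set set" where
  "clos_inv T D f = {V. closedin T V \<and> V \<in> invariant_sets (topspace T) D f}"

definition no_periodic_points :: "'a set \<Rightarrow> 'a set \<Rightarrow> ('a \<Rightarrow> 'a) \<Rightarrow> bool" where
  "no_periodic_points S D f \<longleftrightarrow> \<not> (\<exists>n\<ge>1. \<exists>x \<in> pow_dom S D f n. (f ^^ n) x = x)"

section \<open>The reversible extension\<close>

text \<open>\<open>X \<union> {0}\<close> is modelled by the option type, with \<open>None\<close> as the isolated point \<open>0\<close>.\<close>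

definition adjoin_point :: "'x topology \<Rightarrow> 'x option topology" where
  "adjoin_point X = topology (\<lambda>U. openin X (Some -` U))"

lemma openin_adjoin_point: "openin (adjoin_point X) U \<longleftrightarrow> openin X (Some -` U)"
proof -
  have "istopology (\<lambda>U. openin X (Some -` U))"
    unfolding istopology_def by (auto simp: vimage_Union)
  then show ?thesis
    by (simp add: adjoin_point_def)
qed

lemma topspace_adjoin_point: "topspace (adjoin_point X) = insert None (Some ` topspace X)"
proof -
  have "openin (adjoin_point X) (insert None (Some ` topspace X))"
    by (simp add: openin_adjoin_point vimage_def image_iff)
  moreover have "U \<subseteq> insert None (Some ` topspace X)" if "openin (adjoin_point X) U" for U
  proof
    fix z assume "z \<in> U"
    then show "z \<in> insert None (Some ` topspace X)"
      using openin_subset[OF that[unfolded openin_adjoin_point]] by (cases z) auto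
  qed
  ultimately show ?thesis
    by (meson openin_subset openin_topspace subset_antisym)
qed

definition ext_fin :: "'x topology \<Rightarrow> 'x set \<Rightarrow> ('x \<Rightarrow> 'x) \<Rightarrow> nat \<Rightarrow> (nat \<Rightarrow> 'x option) set" where
  "ext_fin X D \<alpha> N =
     {x. \<exists>y. (\<forall>n\<le>N. x n = Some (y n) \<and> y n \<in> pow_dom (topspace X) D \<alpha> n) \<and>
             (\<forall>n>N. x n = None) \<and> y N \<notin> pow_ran (topspace X) D \<alpha> 1 \<and>
             (\<forall>n. 1 \<le> n \<and> n \<le> N \<longrightarrow> \<alpha> (y n) = y (n - 1))}"

definition ext_inf :: "'x topology \<Rightarrow> 'x set \<Rightarrow> ('x \<Rightarrow> 'x) \<Rightarrow> (nat \<Rightarrow> 'x option) set" where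
  "ext_inf X D \<alpha> =
     {x. \<exists>y. (\<forall>n. x n = Some (y n) \<and> y n \<in> pow_dom (topspace X) D \<alpha> n) \<and>
             (\<forall>n\<ge>1. \<alpha> (y n) = y (n - 1))}"

definition ext_space :: "'x topology \<Rightarrow> 'x set \<Rightarrow> ('x \<Rightarrow> 'x) \<Rightarrow> (nat \<Rightarrow> 'x option) topology" where
  "ext_space X D \<alpha> =
     subtopology (product_topology (\<lambda>_. adjoin_point X) UNIV) ((\<Union>N. ext_fin X D \<alpha> N) \<union> ext_inf X D \<alpha>)"

definition ext_proj :: "(nat \<Rightarrow> 'x option) \<Rightarrow> 'x" where
  "ext_proj x = the (x 0)"

definition ext_dom :: "'x topology \<Rightarrow> 'x set \<Rightarrow> ('x \<Rightarrow> 'x) \<Rightarrow> (nat \<Rightarrow> 'x option) set" where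
  "ext_dom X D \<alpha> = {x \<in> topspace (ext_space X D \<alpha>). ext_proj x \<in> D}"

definition ext_ran :: "'x topology \<Rightarrow> 'x set \<Rightarrow> ('x \<Rightarrow> 'x) \<Rightarrow> (nat \<Rightarrow> 'x option) set" where
  "ext_ran X D \<alpha> = {x \<in> topspace (ext_space X D \<alpha>). ext_proj x \<in> pow_ran (topspace X) D \<alpha> 1}"

definition ext_map :: "('x \<Rightarrow> 'x) \<Rightarrow> (nat \<Rightarrow> 'x option) \<Rightarrow> (nat \<Rightarrow> 'x option)" where
  "ext_map \<alpha> x = (\<lambda>n. case n of 0 \<Rightarrow> Some (\<alpha> (ext_proj x)) | Suc m \<Rightarrow> x m)"

section \<open>Star-algebras and the enveloping C*-algebra\<close>

record 'b star_alg = "(complex, 'b) module" +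
  adj :: "'b \<Rightarrow> 'b"
  nrm :: "'b \<Rightarrow> real"

text \<open>On a Banach star-algebra every C*-seminorm is dominated by the norm, so the first
  clause only makes an automatic property explicit. The C*-seminorms are exactly the functions
  \<open>a \<mapsto> \<parallel>\<pi> a\<parallel>\<close> for star-homomorphisms \<open>\<pi>\<close> into C*-algebras.\<close>

definition cstar_seminorm :: "('b, 'm) star_alg_scheme \<Rightarrow> ('b \<Rightarrow> real) \<Rightarrow> bool" where
  "cstar_seminorm A p \<longleftrightarrow>
     (\<forall>a\<in>carrier A. 0 \<le> p a \<and> p a \<le> nrm A a) \<and>
     (\<forall>a\<in>carrier A. \<forall>b\<in>carrier A. p (a \<oplus>\<^bsub>A\<^esub> b) \<le> p a + p b) \<and>
     (\<forall>c. \<forall>a\<in>carrier A. p (c \<odot>\<^bsub>A\<^esub> a) = cmod c * p a) \<and>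
     (\<forall>a\<in>carrier A. \<forall>b\<in>carrier A. p (a \<otimes>\<^bsub>A\<^esub> b) \<le> p a * p b) \<and>
     (\<forall>a\<in>carrier A. p (adj A a \<otimes>\<^bsub>A\<^esub> a) = (p a)\<^sup>2)"

definition env_norm :: "('b, 'm) star_alg_scheme \<Rightarrow> 'b \<Rightarrow> real" where
  "env_norm A a = (SUP p \<in> Collect (cstar_seminorm A). p a)"

text \<open>The universal enveloping C*-algebra is the Hausdorff completion of \<open>A\<close> in its largest
  C*-seminorm: classes of Cauchy sequences modulo null sequences, with termwise operations. As
  for cosets in \<open>FactRing\<close>, an operation on classes is a union over representatives.\<close>

definition env_cauchy :: "('b, 'm) star_alg_scheme \<Rightarrow> (nat \<Rightarrow> 'b) set" where
  "env_cauchy A = {s. (\<forall>n. s n \<in> carrier A) \<and>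
     (\<forall>e>0. \<exists>N. \<forall>m\<ge>N. \<forall>n\<ge>N. env_norm A (s m \<ominus>\<^bsub>A\<^esub> s n) < e)}"

definition env_class :: "('b, 'm) star_alg_scheme \<Rightarrow> (nat \<Rightarrow> 'b) \<Rightarrow> (nat \<Rightarrow> 'b) set" where
  "env_class A s = {t \<in> env_cauchy A. (\<lambda>n. env_norm A (s n \<ominus>\<^bsub>A\<^esub> t n)) \<longlonglongrightarrow> 0}"

definition enveloping_cstar :: "('b, 'm) star_alg_scheme \<Rightarrow> (nat \<Rightarrow> 'b) set star_alg" where
  "enveloping_cstar A =
     \<lparr> carrier = env_class A ` env_cauchy A,
       monoid.mult = (\<lambda>S T. \<Union>s\<in>S. \<Union>t\<in>T. env_class A (\<lambda>n. s n \<otimes>\<^bsub>A\<^esub> t n)),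
       one = env_class A (\<lambda>_. \<one>\<^bsub>A\<^esub>),
       zero = env_class A (\<lambda>_. \<zero>\<^bsub>A\<^esub>),
       add = (\<lambda>S T. \<Union>s\<in>S. \<Union>t\<in>T. env_class A (\<lambda>n. s n \<oplus>\<^bsub>A\<^esub> t n)),
       smult = (\<lambda>c S. \<Union>s\<in>S. env_class A (\<lambda>n. c \<odot>\<^bsub>A\<^esub> s n)),
       adj = (\<lambda>S. \<Union>s\<in>S. env_class A (\<lambda>n. adj A (s n))),
       nrm = (\<lambda>S. THE r. \<forall>s\<in>S. (\<lambda>n. env_norm A (s n)) \<longlonglongrightarrow> r) \<rparr>"

definition env_incl :: "('b, 'm) star_alg_scheme \<Rightarrow> 'b \<Rightarrow> (nat \<Rightarrow> 'b) set" where
  "env_incl A a = env_class A (\<lambda>_. a)"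

definition closed_ideals :: "('b, 'm) star_alg_scheme \<Rightarrow> 'b set set" where
  "closed_ideals C = {J. ideal J C \<and>
     (\<forall>s c. (\<forall>n. s n \<in> J) \<and> c \<in> carrier C \<and> (\<lambda>n. nrm C (s n \<ominus>\<^bsub>C\<^esub> c)) \<longlonglongrightarrow> 0 \<longrightarrow> c \<in> J)}"

definition closed_ideal_gen :: "('b, 'm) star_alg_scheme \<Rightarrow> 'b set \<Rightarrow> 'b set" where
  "closed_ideal_gen C K = \<Inter>{J \<in> closed_ideals C. K \<subseteq> J}"

section \<open>The covariance algebra\<close>

text \<open>\<open>C\<^sub>K(Y)\<close>, for \<open>K \<subseteq> topspace Y\<close>. Functions on \<open>Y\<close> are represented by their extension by
  zero to the whole type, so that equality of functions is equality on \<open>Y\<close>; in particular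
  \<open>C(Y) = C\<^sub>Y(Y)\<close>.\<close>

definition C_van :: "'y topology \<Rightarrow> 'y set \<Rightarrow> ('y \<Rightarrow> complex) set" where
  "C_van Y K = {f. continuous_map Y euclidean f \<and> (\<forall>y. y \<notin> K \<longrightarrow> f y = 0)}"

definition sup_norm :: "('y \<Rightarrow> complex) \<Rightarrow> real" where
  "sup_norm f = (SUP y. cmod (f y))"

text \<open>In the next definitions \<open>\<beta>\<close> is a homeomorphism between clopen subsets \<open>E\<^sub>1\<close> and \<open>E\<^sub>2\<close> of \<open>Y\<close>.
  The integer powers of the partial automorphism are given by total functions, to be
  used only on the domain \<open>D\<^sub>-\<^sub>k\<close> of the \<open>k\<close>-th power.\<close>

definition paut :: "'y set \<Rightarrow> ('y \<Rightarrow> 'y) \<Rightarrow> ('y \<Rightarrow> complex) \<Rightarrow> ('y \<Rightarrow> complex)" where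
  "paut E1 \<beta> b = (\<lambda>y. if y \<in> E1 then b (\<beta> y) else 0)"

definition paut_inv ::
  "'y topology \<Rightarrow> 'y set \<Rightarrow> 'y set \<Rightarrow> ('y \<Rightarrow> 'y) \<Rightarrow> ('y \<Rightarrow> complex) \<Rightarrow> ('y \<Rightarrow> complex)" where
  "paut_inv Y E1 E2 \<beta> = inv_into (C_van Y E2) (paut E1 \<beta>)"

definition paut_pow ::
  "'y topology \<Rightarrow> 'y set \<Rightarrow> 'y set \<Rightarrow> ('y \<Rightarrow> 'y) \<Rightarrow> int \<Rightarrow> ('y \<Rightarrow> complex) \<Rightarrow> ('y \<Rightarrow> complex)" where
  "paut_pow Y E1 E2 \<beta> k =
     (if 0 \<le> k then paut E1 \<beta> ^^ nat k else paut_inv Y E1 E2 \<beta> ^^ nat (- k))"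

text \<open>\<open>D\<^sub>n\<close> is the domain of the power with exponent \<open>-n\<close>.\<close>

definition paut_D ::
  "'y topology \<Rightarrow> 'y set \<Rightarrow> 'y set \<Rightarrow> ('y \<Rightarrow> 'y) \<Rightarrow> int \<Rightarrow> ('y \<Rightarrow> complex) set" where
  "paut_D Y E1 E2 \<beta> n =
     (if 0 \<le> n then pow_dom (C_van Y (topspace Y)) (C_van Y E1) (paut_inv Y E1 E2 \<beta>) (nat n)
      else pow_dom (C_van Y (topspace Y)) (C_van Y E2) (paut E1 \<beta>) (nat (- n)))"

text \<open>The series defining the product converges absolutely in the sup norm, so its sum may be
  taken pointwise.\<close>

definition l1_alg ::
  "'y topology \<Rightarrow> 'y set \<Rightarrow> 'y set \<Rightarrow> ('y \<Rightarrow> 'y) \<Rightarrow> (int \<Rightarrow> 'y \<Rightarrow> complex) star_alg" where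
  "l1_alg Y E1 E2 \<beta> =
     \<lparr> carrier = {a. (\<forall>n. a n \<in> paut_D Y E1 E2 \<beta> n) \<and> (\<lambda>n. sup_norm (a n)) summable_on UNIV},
       monoid.mult = (\<lambda>a b n y. \<Sum>\<^sub>\<infinity>k\<in>UNIV.
         paut_pow Y E1 E2 \<beta> k (\<lambda>z. paut_pow Y E1 E2 \<beta> (- k) (a k) z * b (n - k) z) y),
       one = (\<lambda>n y. if n = 0 \<and> y \<in> topspace Y then 1 else 0),
       zero = (\<lambda>n y. 0),
       add = (\<lambda>a b n y. a n y + b n y),
       smult = (\<lambda>c a n y. c * a n y),
       adj = (\<lambda>a n. paut_pow Y E1 E2 \<beta> n (\<lambda>y. cnj (a (- n) y))),
       nrm = (\<lambda>a. \<Sum>\<^sub>\<infinity>n\<in>UNIV. sup_norm (a n)) \<rparr>"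

definition cov_l1 ::
  "'x topology \<Rightarrow> 'x set \<Rightarrow> ('x \<Rightarrow> 'x) \<Rightarrow> (int \<Rightarrow> (nat \<Rightarrow> 'x option) \<Rightarrow> complex) star_alg" where
  "cov_l1 X D \<alpha> = l1_alg (ext_space X D \<alpha>) (ext_dom X D \<alpha>) (ext_ran X D \<alpha>) (ext_map \<alpha>)"

definition cov_alg ::
  "'x topology \<Rightarrow> 'x set \<Rightarrow> ('x \<Rightarrow> 'x) \<Rightarrow> (nat \<Rightarrow> int \<Rightarrow> (nat \<Rightarrow> 'x option) \<Rightarrow> complex) set star_alg" where
  "cov_alg X D \<alpha> = enveloping_cstar (cov_l1 X D \<alpha>)"

text \<open>The embeddings of \<open>\<B> = C(X~)\<close> and, via \<open>a \<mapsto> a \<circ> \<Phi>\<close>, of \<open>\<A> = C(X)\<close>.\<close>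

definition emb_B ::
  "'x topology \<Rightarrow> 'x set \<Rightarrow> ('x \<Rightarrow> 'x) \<Rightarrow> ((nat \<Rightarrow> 'x option) \<Rightarrow> complex)
   \<Rightarrow> (nat \<Rightarrow> int \<Rightarrow> (nat \<Rightarrow> 'x option) \<Rightarrow> complex) set" where
  "emb_B X D \<alpha> b = env_incl (cov_l1 X D \<alpha>) (\<lambda>n y. if n = 0 then b y else 0)"

definition emb_A ::
  "'x topology \<Rightarrow> 'x set \<Rightarrow> ('x \<Rightarrow> 'x) \<Rightarrow> ('x \<Rightarrow> complex)
   \<Rightarrow> (nat \<Rightarrow> int \<Rightarrow> (nat \<Rightarrow> 'x option) \<Rightarrow> complex) set" where
  "emb_A X D \<alpha> a =
     emb_B X D \<alpha> (\<lambda>x. if x \<in> topspace (ext_space X D \<alpha>) then a (ext_proj x) else 0)"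

section \<open>Lattice anti-isomorphisms\<close>

definition inclusion_order :: "'a set set \<Rightarrow> 'a set gorder" where
  "inclusion_order \<F> = \<lparr>carrier = \<F>, eq = (=), le = (\<subseteq>)\<rparr>"

definition lattice_anti_iso :: "('a, 'm) gorder_scheme \<Rightarrow> ('b, 'n) gorder_scheme \<Rightarrow> ('a \<Rightarrow> 'b) \<Rightarrow> bool" where
  "lattice_anti_iso P Q f \<longleftrightarrow> Lattice.lattice P \<and> Lattice.lattice Q \<and>
     bij_betw f (carrier P) (carrier Q) \<and>
     (\<forall>v\<in>carrier P. \<forall>w\<in>carrier P.
        f (v \<squnion>\<^bsub>P\<^esub> w) = f v \<sqinter>\<^bsub>Q\<^esub> f w \<and> f (v \<sqinter>\<^bsub>P\<^esub> w) = f v \<squnion>\<^bsub>Q\<^esub> f w)"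

end

theory Submission
  imports Defs
begin

text \<open>
  For a free homeomorphism between clopen subsets of a compact Hausdorff space \<open>Y\<close>, a closed
  ideal \<open>J\<close> of the enveloping algebra is recovered from the zero set \<open>V\<close> of \<open>J \<inter> C(Y)\<close>, as the set
  of all elements whose Fourier coefficients vanish on \<open>V\<close>. The coefficients are well defined
  because the GNS seminorms of the point evaluations of the coefficient at \<open>0\<close> dominate them.
  Averaging over conjugation by unitaries \<open>exp (i \<pi> h)\<close> of \<open>C(Y)\<close> preserves \<open>J\<close> and, by freeness,
  makes the coefficients at \<open>n \<noteq> 0\<close> of a finitely supported element arbitrarily small; so the
  coefficient at \<open>0\<close>, and after multiplication by a partial isometry every coefficient, of an
  element of \<open>J\<close> lies in \<open>J\<close>. Conversely, the Fejer means are contractive, being averages of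
  the dual circle action, and converge to the element; if the coefficients vanish on \<open>V\<close>, then
  they lie in the ideal generated by \<open>J \<inter> C(Y)\<close>. Finally \<open>V' \<mapsto> \<Phi>(V')\<close> matches the closed invariant
  sets of the reversible extension with those of \<open>X\<close>; the inverse takes \<open>V\<close> to the set of
  sequences with all entries in \<open>V\<close>.
\<close>

section \<open>C*-seminorms on a normed star-algebra\<close>

text \<open>No Hilbert space, representation or conditional expectation is constructed. Elements of
  the enveloping algebra are classes of Cauchy sequences in \<open>L\<close>, so each argument is
  carried out on representatives in the seminorm \<open>env_norm\<close> and transferred by two
  criteria, one for membership in a closed ideal and one for building closed ideals. The enveloping
  norm is a supremum of C*-seminorms: lower bounds come from exhibiting a seminorm, upper bounds
  from the l1 norm or from composing seminorms with automorphisms. For the same reason the circle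
  integral behind the Fejer means becomes a finite average over roots of unity. The domains of all
  integer powers are clopen, so their indicators are continuous and the partial isometries belong to
  \<open>L\<close> itself. Freeness gives a Urysohn function with value 0 at \<open>y\<close> and 1
  at \<open>th n y\<close>; its exponential has values 1 and -1 there, which cancel in the average.
  In \<open>X\<close> itself \<open>\<alpha>\<close> need not be injective, and closed invariant
  sets need not be stable under intersection; hence the lattice is described on the extension, and
  both sides of the anti-isomorphism are images of it.\<close>

locale normed_star_alg = ring A for A :: "('b, 'm) star_alg_scheme" (structure) +
  assumes smult_closed [simp, intro]: "x \<in> carrier A \<Longrightarrow> c \<odot> x \<in> carrier A"
    and add_smult: "x \<in> carrier A \<Longrightarrow> (c + d) \<odot> x = c \<odot> x \<oplus> d \<odot> x"
    and smult_smult: "x \<in> carrier A \<Longrightarrow> c \<odot> (d \<odot> x) = (c * d) \<odot> x"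
    and smult_one: "x \<in> carrier A \<Longrightarrow> 1 \<odot> x = x"
    and mult_smult_left: "x \<in> carrier A \<Longrightarrow> y \<in> carrier A \<Longrightarrow> (c \<odot> x) \<otimes> y = c \<odot> (x \<otimes> y)"
    and mult_smult_right: "x \<in> carrier A \<Longrightarrow> y \<in> carrier A \<Longrightarrow> x \<otimes> (c \<odot> y) = c \<odot> (x \<otimes> y)"
    and adj_closed [simp, intro]: "x \<in> carrier A \<Longrightarrow> adj A x \<in> carrier A"
    and adj_add: "x \<in> carrier A \<Longrightarrow> y \<in> carrier A \<Longrightarrow> adj A (x \<oplus> y) = adj A x \<oplus> adj A y"
    and adj_smult: "x \<in> carrier A \<Longrightarrow> adj A (c \<odot> x) = cnj c \<odot> adj A x"
    and adj_mult: "x \<in> carrier A \<Longrightarrow> y \<in> carrier A \<Longrightarrow> adj A (x \<otimes> y) = adj A y \<otimes> adj A x"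
    and adj_adj: "x \<in> carrier A \<Longrightarrow> adj A (adj A x) = x"
    and nrm_nonneg: "x \<in> carrier A \<Longrightarrow> 0 \<le> nrm A x"
    and nrm_mult: "x \<in> carrier A \<Longrightarrow> y \<in> carrier A \<Longrightarrow> nrm A (x \<otimes> y) \<le> nrm A x * nrm A y"
    and nrm_adj: "x \<in> carrier A \<Longrightarrow> nrm A (adj A x) \<le> nrm A x"
begin

lemma smult_minus_one: "x \<in> carrier A \<Longrightarrow> (-1) \<odot> x = \<ominus> x"
proof -
  assume x: "x \<in> carrier A"
  have "0 \<odot> x = 0 \<odot> x \<oplus> 0 \<odot> x"
    using add_smult[OF x, of 0 0] by simp
  then have "0 \<odot> x = \<zero>"
    using x by (metis add.r_cancel_one' smult_closed)
  then have "(-1) \<odot> x \<oplus> x = \<zero>"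
    using add_smult[OF x, of "-1" 1] smult_one[OF x] by simp
  then show ?thesis
    using x by (metis minus_equality smult_closed)
qed

text \<open>The zero seminorm makes the index set of the supremum in \<open>env_norm\<close>
  nonempty, which the least-upper-bound rule over the reals requires.\<close>

lemma cstar_seminorm_zero: "cstar_seminorm A (\<lambda>_. 0)"
  by (simp add: cstar_seminorm_def nrm_nonneg)

text \<open>The clause \<open>p a \<le> nrm A a\<close> of \<open>cstar_seminorm\<close> is what
  makes the supremum finite.\<close>

lemma bdd_above_seminorms: "a \<in> carrier A \<Longrightarrow> bdd_above ((\<lambda>p. p a) ` Collect (cstar_seminorm A))"
  by (rule bdd_aboveI[where M = "nrm A a"]) (auto simp: cstar_seminorm_def)

lemma seminorm_le_env_norm: "cstar_seminorm A p \<Longrightarrow> a \<in> carrier A \<Longrightarrow> p a \<le> env_norm A a"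
  unfolding env_norm_def using bdd_above_seminorms by (intro cSUP_upper) auto

lemma env_norm_leI: "(\<And>p. cstar_seminorm A p \<Longrightarrow> p a \<le> r) \<Longrightarrow> env_norm A a \<le> r"
  unfolding env_norm_def using cstar_seminorm_zero by (intro cSUP_least) auto

lemma env_norm_nonneg: "a \<in> carrier A \<Longrightarrow> 0 \<le> env_norm A a"
  using seminorm_le_env_norm[OF cstar_seminorm_zero] by simp

lemma env_norm_le_nrm: "a \<in> carrier A \<Longrightarrow> env_norm A a \<le> nrm A a"
  by (rule env_norm_leI) (simp add: cstar_seminorm_def)

lemma env_norm_add:
  assumes "a \<in> carrier A" "b \<in> carrier A"
  shows "env_norm A (a \<oplus> b) \<le> env_norm A a + env_norm A b"
proof (rule env_norm_leI)
  fix p assume p: "cstar_seminorm A p"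
  then have "p (a \<oplus> b) \<le> p a + p b"
    using assms by (simp add: cstar_seminorm_def)
  then show "p (a \<oplus> b) \<le> env_norm A a + env_norm A b"
    using seminorm_le_env_norm[OF p] assms by (smt (verit))
qed

lemma env_norm_mult:
  assumes "a \<in> carrier A" "b \<in> carrier A"
  shows "env_norm A (a \<otimes> b) \<le> env_norm A a * env_norm A b"
proof (rule env_norm_leI)
  fix p assume p: "cstar_seminorm A p"
  then have "p (a \<otimes> b) \<le> p a * p b" "0 \<le> p a" "0 \<le> p b"
    using assms by (simp_all add: cstar_seminorm_def)
  then show "p (a \<otimes> b) \<le> env_norm A a * env_norm A b"
    using mult_mono[OF seminorm_le_env_norm[OF p assms(1)] seminorm_le_env_norm[OF p assms(2)]]
      env_norm_nonneg[OF assms(1)] by linarith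
qed

lemma env_norm_smult:
  assumes "a \<in> carrier A"
  shows "env_norm A (c \<odot> a) \<le> cmod c * env_norm A a"
proof (rule env_norm_leI)
  fix p assume p: "cstar_seminorm A p"
  then have "p (c \<odot> a) = cmod c * p a"
    using assms by (simp add: cstar_seminorm_def)
  then show "p (c \<odot> a) \<le> cmod c * env_norm A a"
    using mult_left_mono[OF seminorm_le_env_norm[OF p assms], of "cmod c"] by simp
qed

lemma env_norm_uminus: "a \<in> carrier A \<Longrightarrow> env_norm A (\<ominus> a) = env_norm A a"
  using env_norm_smult[of a "-1"] env_norm_smult[of "\<ominus> a" "-1"]
  by (simp add: smult_minus_one)

lemma env_norm_zero: "env_norm A \<zero> = 0"
proof -
  have "\<zero> \<oplus> (-1) \<odot> \<zero> = \<zero>" by (simp add: smult_minus_one)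
  moreover have "0 \<odot> \<zero> = \<zero>"
    using add_smult[of "\<zero>" 1 "-1"] by (simp add: smult_one smult_minus_one)
  ultimately show ?thesis
    using env_norm_smult[of "\<zero>" 0] env_norm_nonneg[of "\<zero>"] by simp
qed

lemma env_norm_minus_commute:
  assumes "a \<in> carrier A" "b \<in> carrier A"
  shows "env_norm A (a \<ominus> b) = env_norm A (b \<ominus> a)"
proof -
  have "\<ominus> (a \<ominus> b) = b \<ominus> a"
    using assms by (simp add: a_minus_def minus_add a_comm)
  then show ?thesis
    using env_norm_uminus[of "a \<ominus> b"] assms by simp
qed

lemma env_norm_minus_triangle:
  assumes "a \<in> carrier A" "b \<in> carrier A" "c \<in> carrier A"
  shows "env_norm A (a \<ominus> c) \<le> env_norm A (a \<ominus> b) + env_norm A (b \<ominus> c)"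
proof -
  have "a \<ominus> c = (a \<ominus> b) \<oplus> (b \<ominus> c)"
    using assms by (simp add: a_minus_def a_ac r_neg1 r_neg2)
  then show ?thesis
    using env_norm_add[of "a \<ominus> b" "b \<ominus> c"] assms by simp
qed

lemma env_norm_triangle_diff:
  assumes "a \<in> carrier A" "b \<in> carrier A"
  shows "env_norm A a \<le> env_norm A (a \<ominus> b) + env_norm A b"
proof -
  have "a = (a \<ominus> b) \<oplus> b"
    using assms by (simp add: a_minus_def a_ac r_neg)
  then show ?thesis
    using env_norm_add[of "a \<ominus> b" b] assms by simp
qed

end

text \<open>The GNS seminorm of a positive functional; boundedness of left multiplication follows from
  iterating the Cauchy-Schwarz inequality on the powers \<open>(a* a)^(2^k)\<close>.\<close>

lemma iterated_square_bound:
  fixes t :: "nat \<Rightarrow> real"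
  assumes t: "\<And>k. 0 \<le> t k" and step: "\<And>k. (t k)\<^sup>2 \<le> w * t (Suc k)"
    and bound: "\<And>k. t k \<le> C * H ^ (2 ^ k)" and w: "0 \<le> w" and H: "0 \<le> H"
  shows "t 0 \<le> w * H"
proof (cases "w = 0")
  case True
  then show ?thesis using step[of 0] t[of 0] by simp
next
  case False
  with w have w: "w > 0" by simp
  \<comment> \<open>After division by \<open>w\<close> the hypothesis reads
    \<open>(t k / w)\<^sup>2 \<le> t (Suc k) / w\<close>, so squaring can be iterated.\<close>
  have pow: "(t 0 / w) ^ (2 ^ k) \<le> t k / w" for k
  proof (induction k)
    case (Suc k)
    have "(t 0 / w) ^ (2 ^ Suc k) = ((t 0 / w) ^ (2 ^ k))\<^sup>2"
      by (simp add: power_mult[symmetric] mult.commute)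
    also have "\<dots> \<le> (t k / w)\<^sup>2"
      using Suc t w by (intro power_mono) auto
    also have "\<dots> \<le> t (Suc k) / w"
      using step[of k] w by (simp add: power2_eq_square field_simps)
    finally show ?case .
  qed simp
  have le: "(t 0 / w) ^ (2 ^ k) \<le> C / w * H ^ (2 ^ k)" for k
    using pow[of k] divide_right_mono[OF bound[of k], of w] w by simp
  show ?thesis
  proof (rule ccontr)
    assume "\<not> ?thesis"
    then have gt: "t 0 / w > H" using w by (simp add: field_simps)
    show False
    proof (cases "H = 0")
      case True
      then show False using le[of 0] gt by simp
    next
      case False
      with H have H: "H > 0" by simp
      \<comment> \<open>If \<open>r > 1\<close>, the powers \<open>r ^ (2 ^ k)\<close> would all
        stay below the fixed number \<open>C / w\<close>. This is how the constant \<open>C\<close>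
        disappears from the conclusion.\<close>
      define r where "r = t 0 / w / H"
      have r: "r > 1" unfolding r_def using gt H by (subst less_divide_eq_1_pos) auto
      have "r ^ (2 ^ k) \<le> C / w" for k
        by (simp only: r_def power_divide[of "t 0 / w"] pos_divide_le_eq[OF zero_less_power[OF H]] le)
      moreover obtain n where "C / w < r ^ n"
        using real_arch_pow[OF r] by blast
      moreover have "r ^ n \<le> r ^ (2 ^ n)"
        using r by (intro power_increasing) auto
      ultimately show False by (meson not_less order_trans)
    qed
  qed
qed

locale positive_functional = normed_star_alg +
  fixes \<omega> :: "'a \<Rightarrow> complex"
  assumes omega_add: "x \<in> carrier A \<Longrightarrow> y \<in> carrier A \<Longrightarrow> \<omega> (x \<oplus> y) = \<omega> x + \<omega> y"
    and omega_smult: "x \<in> carrier A \<Longrightarrow> \<omega> (c \<odot> x) = c * \<omega> x"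
    and omega_adj: "x \<in> carrier A \<Longrightarrow> \<omega> (adj A x) = cnj (\<omega> x)"
    and omega_pos: "x \<in> carrier A \<Longrightarrow> 0 \<le> Re (\<omega> (adj A x \<otimes> x))"
    and omega_bound: "x \<in> carrier A \<Longrightarrow> cmod (\<omega> x) \<le> nrm A x"
begin

text \<open>The length of the vector \<open>x\<close> in the GNS pre-Hilbert space of the
  functional.\<close>

definition gns_len :: "'a \<Rightarrow> real" where
  "gns_len x = sqrt (Re (\<omega> (adj A x \<otimes> x)))"

text \<open>The operator norm of left multiplication by \<open>a\<close>. It is computed on the unit
  ball of the semi-definite form, so that null vectors are kept instead of being divided
  out.\<close>

definition gns_norm :: "'a \<Rightarrow> real" where
  "gns_norm a = (SUP b \<in> {b \<in> carrier A. gns_len b \<le> 1}. gns_len (a \<otimes> b))"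

lemma gns_len_nonneg: "x \<in> carrier A \<Longrightarrow> 0 \<le> gns_len x"
  by (simp add: gns_len_def omega_pos)

lemma gns_len_sq: "x \<in> carrier A \<Longrightarrow> (gns_len x)\<^sup>2 = Re (\<omega> (adj A x \<otimes> x))"
  by (simp add: gns_len_def omega_pos)

lemma gns_len_smult: "x \<in> carrier A \<Longrightarrow> gns_len (c \<odot> x) = cmod c * gns_len x"
proof -
  assume x: "x \<in> carrier A"
  have "\<omega> (adj A (c \<odot> x) \<otimes> (c \<odot> x)) = complex_of_real ((cmod c)\<^sup>2) * \<omega> (adj A x \<otimes> x)"
    using x by (simp add: adj_smult mult_smult_left mult_smult_right omega_smult
        complex_norm_square mult_ac del: of_real_power)
  then have "Re (\<omega> (adj A (c \<odot> x) \<otimes> (c \<odot> x))) = (cmod c)\<^sup>2 * Re (\<omega> (adj A x \<otimes> x))"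
    by (simp only: times_complex.sel Re_complex_of_real Im_complex_of_real mult_zero_left diff_zero)
  then show ?thesis
    by (simp add: gns_len_def real_sqrt_mult)
qed

lemma gns_len_sq_add:
  assumes "x \<in> carrier A" "y \<in> carrier A"
  shows "(gns_len (x \<oplus> y))\<^sup>2 = (gns_len x)\<^sup>2 + 2 * Re (\<omega> (adj A x \<otimes> y)) + (gns_len y)\<^sup>2"
proof -
  have "adj A (adj A x \<otimes> y) = adj A y \<otimes> x"
    using assms by (simp add: adj_mult adj_adj)
  then have "\<omega> (adj A y \<otimes> x) = cnj (\<omega> (adj A x \<otimes> y))"
    using assms omega_adj[of "adj A x \<otimes> y"] by simp
  then show ?thesis
    using assms by (simp add: gns_len_sq adj_add l_distr r_distr omega_add)
qed

lemma gns_Cauchy_Schwarz: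
  assumes x: "x \<in> carrier A" and y: "y \<in> carrier A"
  shows "Re (\<omega> (adj A x \<otimes> y)) \<le> gns_len x * gns_len y"
proof -
  define R where "R = Re (\<omega> (adj A x \<otimes> y))"
  \<comment> \<open>The squared length of \<open>s x - t y\<close>. The choice
    \<open>s = gns_len y\<close>, \<open>t = gns_len x\<close> gives the claim multiplied by the
    product of the lengths, which is why null vectors are treated apart.\<close>
  have quad: "0 \<le> s\<^sup>2 * (gns_len x)\<^sup>2 - 2 * (s * t * R) + t\<^sup>2 * (gns_len y)\<^sup>2" for s t :: real
  proof -
    have "0 \<le> (gns_len (complex_of_real s \<odot> x \<oplus> complex_of_real (- t) \<odot> y))\<^sup>2"
      by simp
    also have "\<dots> = s\<^sup>2 * (gns_len x)\<^sup>2 - 2 * (s * t * R) + t\<^sup>2 * (gns_len y)\<^sup>2"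
      using x y by (simp add: gns_len_sq_add gns_len_smult adj_smult mult_smult_left
          mult_smult_right omega_smult power_mult_distrib R_def)
    finally show ?thesis .
  qed
  have nn: "0 \<le> gns_len x" "0 \<le> gns_len y"
    using x y by (auto simp: gns_len_nonneg)
  have "R \<le> gns_len x * gns_len y"
  proof (cases "gns_len x = 0 \<or> gns_len y = 0")
    case False
    then have pos: "0 < gns_len x * gns_len y" using nn by simp
    have "(gns_len x * gns_len y) * R \<le> (gns_len x * gns_len y) * (gns_len x * gns_len y)"
      using quad[of "gns_len y" "gns_len x"] by (simp add: power2_eq_square algebra_simps)
    then show ?thesis using pos by (simp only: mult_le_cancel_left_pos)
  next
    case True
    \<comment> \<open>If one length is 0 and the other is \<open>u\<close>, the scalars
      \<open>R\<close> and \<open>u\<^sup>2 + 1\<close> turn the quadratic form into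
      \<open>R\<^sup>2 * (- (u\<^sup>2) - 2)\<close>. The second factor is negative even for
      \<open>u = 0\<close>, so \<open>R = 0\<close>.\<close>
    have neg: "R = 0" if "0 \<le> R\<^sup>2 * (- (u\<^sup>2) - 2)" for u :: real
    proof -
      have "R\<^sup>2 * (u\<^sup>2 + 2) \<le> 0" using that by (simp add: algebra_simps)
      moreover have "0 < u\<^sup>2 + 2" by (simp add: add_nonneg_pos)
      ultimately show "R = 0" by (auto simp: mult_le_0_iff)
    qed
    from True show ?thesis
    proof
      assume "gns_len x = 0"
      then show ?thesis
        using neg[of "gns_len y"] quad[of "(gns_len y)\<^sup>2 + 1" R]
        by (simp add: power2_eq_square algebra_simps)
    next
      assume "gns_len y = 0"
      then show ?thesis
        using neg[of "gns_len x"] quad[of R "(gns_len x)\<^sup>2 + 1"]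
        by (simp add: power2_eq_square algebra_simps)
    qed
  qed
  then show ?thesis by (simp add: R_def)
qed

lemma gns_len_add:
  assumes "x \<in> carrier A" "y \<in> carrier A"
  shows "gns_len (x \<oplus> y) \<le> gns_len x + gns_len y"
proof (rule power2_le_imp_le)
  show "(gns_len (x \<oplus> y))\<^sup>2 \<le> (gns_len x + gns_len y)\<^sup>2"
    using gns_len_sq_add[OF assms] gns_Cauchy_Schwarz[OF assms]
    by (simp add: power2_eq_square algebra_simps)
qed (use assms gns_len_nonneg in auto)

lemma gns_len_mult_sq:
  assumes "a \<in> carrier A" "b \<in> carrier A"
  shows "(gns_len (a \<otimes> b))\<^sup>2 = Re (\<omega> (adj A b \<otimes> ((adj A a \<otimes> a) \<otimes> b)))"
  using assms by (simp add: gns_len_sq adj_mult m_assoc)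

lemma gns_len_mult_le:
  assumes a: "a \<in> carrier A" and b: "b \<in> carrier A"
  shows "gns_len (a \<otimes> b) \<le> nrm A a * gns_len b"
proof -
  \<comment> \<open>\<open>h k\<close> is the power of \<open>adj A a \<otimes> a\<close> with
    exponent \<open>2 ^ k\<close>. It is self-adjoint, so Cauchy-Schwarz for \<open>b\<close> and
    \<open>h k \<otimes> b\<close> bounds \<open>(t k)\<^sup>2\<close> by \<open>t (Suc k)\<close>,
    up to the squared length of \<open>b\<close>.\<close>
  define h where "h = rec_nat (adj A a \<otimes> a) (\<lambda>_ x. x \<otimes> x)"
  have h0: "h 0 = adj A a \<otimes> a" and hS: "h (Suc k) = h k \<otimes> h k" for k
    by (simp_all add: h_def)
  have h: "h k \<in> carrier A \<and> adj A (h k) = h k" for k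
    by (induction k) (use a in \<open>auto simp: h0 hS adj_mult adj_adj\<close>)
  define t where "t k = Re (\<omega> (adj A b \<otimes> (h k \<otimes> b)))" for k
  have tS: "t (Suc k) = (gns_len (h k \<otimes> b))\<^sup>2" for k
    using gns_len_mult_sq[of "h k" b] h[of k] b by (simp add: t_def hS)
  have t0: "t 0 = (gns_len (a \<otimes> b))\<^sup>2"
    using gns_len_mult_sq[OF a b] by (simp add: t_def h0)
  have t: "0 \<le> t k" for k
    by (cases k) (auto simp: tS t0)
  have "t 0 \<le> (gns_len b)\<^sup>2 * (nrm A a)\<^sup>2"
  proof (rule iterated_square_bound[of t, OF t])
    fix k
    have "t k \<le> gns_len b * gns_len (h k \<otimes> b)"
      unfolding t_def using h b by (intro gns_Cauchy_Schwarz) auto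
    then have "(t k)\<^sup>2 \<le> (gns_len b * gns_len (h k \<otimes> b))\<^sup>2"
      using t by (intro power_mono)
    then show "(t k)\<^sup>2 \<le> (gns_len b)\<^sup>2 * t (Suc k)"
      by (simp add: tS power_mult_distrib)
    have hk: "nrm A (h k) \<le> ((nrm A a)\<^sup>2) ^ (2 ^ k)"
    proof (induction k)
      case 0
      show ?case
        using nrm_mult[of "adj A a" a] mult_right_mono[OF nrm_adj[OF a] nrm_nonneg[OF a]] a
        by (simp add: h0 power2_eq_square)
    next
      case (Suc k)
      have "nrm A (h (Suc k)) \<le> nrm A (h k) * nrm A (h k)"
        using nrm_mult h by (simp add: hS)
      also have "\<dots> \<le> ((nrm A a)\<^sup>2) ^ (2 ^ k) * ((nrm A a)\<^sup>2) ^ (2 ^ k)"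
        using Suc nrm_nonneg h by (intro mult_mono) auto
      finally show ?case by (simp add: power_add[symmetric] mult_2)
    qed
    \<comment> \<open>A crude bound by the norm of the algebra: the factor in front depends on
      \<open>b\<close> alone and is lost in the iteration, while the growth rate
      \<open>(nrm A a)\<^sup>2\<close> survives.\<close>
    have "t k \<le> cmod (\<omega> (adj A b \<otimes> (h k \<otimes> b)))"
      unfolding t_def by (rule complex_Re_le_cmod)
    also have "\<dots> \<le> nrm A (adj A b \<otimes> (h k \<otimes> b))"
      using h[of k] b by (intro omega_bound) auto
    also have "\<dots> \<le> nrm A (adj A b) * nrm A (h k \<otimes> b)"
      using h[of k] b by (intro nrm_mult) auto
    also have "\<dots> \<le> nrm A (adj A b) * (nrm A (h k) * nrm A b)"
      using h[of k] b by (intro mult_left_mono nrm_mult nrm_nonneg) auto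
    also have "\<dots> = (nrm A (adj A b) * nrm A b) * nrm A (h k)"
      by (simp add: mult_ac)
    also have "\<dots> \<le> (nrm A (adj A b) * nrm A b) * ((nrm A a)\<^sup>2) ^ (2 ^ k)"
      using hk b by (intro mult_left_mono mult_nonneg_nonneg nrm_nonneg) auto
    finally show "t k \<le> (nrm A (adj A b) * nrm A b) * ((nrm A a)\<^sup>2) ^ (2 ^ k)" .
  qed auto
  then have "(gns_len (a \<otimes> b))\<^sup>2 \<le> (nrm A a * gns_len b)\<^sup>2"
    unfolding t0 power_mult_distrib by (subst mult.commute)
  then show ?thesis
    by (rule power2_le_imp_le) (intro mult_nonneg_nonneg nrm_nonneg gns_len_nonneg a b)
qed

lemma gns_len_zero: "gns_len \<zero> = 0"
proof -
  have "\<zero> = 0 \<odot> \<zero>"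
    using add_smult[of "\<zero>" 1 "-1"] by (simp add: smult_one smult_minus_one)
  then show ?thesis
    by (metis gns_len_smult norm_zero mult_zero_left zero_closed)
qed

lemma gns_len_le_gns_norm:
  assumes a: "a \<in> carrier A" and b: "b \<in> carrier A" and "gns_len b \<le> 1"
  shows "gns_len (a \<otimes> b) \<le> gns_norm a"
  unfolding gns_norm_def
proof (rule cSUP_upper)
  show "bdd_above ((\<lambda>b. gns_len (a \<otimes> b)) ` {b \<in> carrier A. gns_len b \<le> 1})"
  proof (rule bdd_aboveI[where M = "nrm A a"], clarify)
    fix b assume b: "b \<in> carrier A" "gns_len b \<le> 1"
    then show "gns_len (a \<otimes> b) \<le> nrm A a"
      using gns_len_mult_le[OF a b(1)] mult_left_mono[OF b(2) nrm_nonneg[OF a]] by simp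
  qed
qed (use assms in auto)

lemma gns_norm_leI:
  assumes "\<And>b. b \<in> carrier A \<Longrightarrow> gns_len b \<le> 1 \<Longrightarrow> gns_len (a \<otimes> b) \<le> r"
  shows "gns_norm a \<le> r"
  unfolding gns_norm_def using gns_len_zero assms by (intro cSUP_least) auto

lemma gns_norm_nonneg: "a \<in> carrier A \<Longrightarrow> 0 \<le> gns_norm a"
  using gns_len_le_gns_norm[of a "\<zero>"] gns_len_zero by simp

lemma gns_len_mult:
  assumes a: "a \<in> carrier A" and b: "b \<in> carrier A"
  shows "gns_len (a \<otimes> b) \<le> gns_norm a * gns_len b"
proof (cases "gns_len b = 0")
  \<comment> \<open>A null vector cannot be normalised; by \<open>gns_len_mult_le\<close> left
    multiplication sends it to a null vector.\<close>
  case True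
  then show ?thesis using gns_len_mult_le[OF a b] by simp
next
  case False
  then have pos: "0 < gns_len b" using gns_len_nonneg[OF b] by simp
  define c where "c = complex_of_real (1 / gns_len b)"
  have c: "cmod c = 1 / gns_len b" using pos by (simp add: c_def norm_divide)
  have "gns_len (a \<otimes> (c \<odot> b)) \<le> gns_norm a"
    using a b pos c by (intro gns_len_le_gns_norm) (auto simp: gns_len_smult)
  then show ?thesis
    using a b pos c by (simp add: mult_smult_right gns_len_smult field_simps)
qed

lemma gns_norm_mult:
  assumes a: "a \<in> carrier A" and b: "b \<in> carrier A"
  shows "gns_norm (a \<otimes> b) \<le> gns_norm a * gns_norm b"
proof (rule gns_norm_leI)
  fix c assume c: "c \<in> carrier A" "gns_len c \<le> 1"
  have "gns_len (a \<otimes> (b \<otimes> c)) \<le> gns_norm a * gns_len (b \<otimes> c)"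
    using a b c by (intro gns_len_mult) auto
  also have "\<dots> \<le> gns_norm a * gns_norm b"
    using a b c by (intro mult_left_mono gns_len_le_gns_norm gns_norm_nonneg) auto
  finally show "gns_len (a \<otimes> b \<otimes> c) \<le> gns_norm a * gns_norm b"
    using a b c by (simp add: m_assoc)
qed

text \<open>For the C*-identity, Cauchy-Schwarz gives
  \<open>|a|^2 \<le> |adj a a| \<le> |adj a| |a|\<close>. Cancelling one factor yields
  \<open>|a| \<le> |adj a|\<close>, and the same for \<open>adj a\<close> yields equality.\<close>

lemma cstar_seminorm_gns_norm: "cstar_seminorm A gns_norm"
  unfolding cstar_seminorm_def
proof (intro conjI ballI allI)
  fix a assume a: "a \<in> carrier A"
  show "0 \<le> gns_norm a" by (rule gns_norm_nonneg[OF a])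
  show "gns_norm a \<le> nrm A a"
    using gns_len_mult_le[OF a] mult_left_mono[OF _ nrm_nonneg[OF a]]
    by (intro gns_norm_leI) (metis mult.right_neutral order_trans)
next
  fix a b assume a: "a \<in> carrier A" and b: "b \<in> carrier A"
  show "gns_norm (a \<oplus> b) \<le> gns_norm a + gns_norm b"
  proof (rule gns_norm_leI)
    fix c assume c: "c \<in> carrier A" "gns_len c \<le> 1"
    then show "gns_len ((a \<oplus> b) \<otimes> c) \<le> gns_norm a + gns_norm b"
      using gns_len_add[of "a \<otimes> c" "b \<otimes> c"] gns_len_le_gns_norm[of a c] gns_len_le_gns_norm[of b c] a b
      by (simp add: l_distr)
  qed
  show "gns_norm (a \<otimes> b) \<le> gns_norm a * gns_norm b"
    using a b by (rule gns_norm_mult)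
next
  fix c a assume a: "a \<in> carrier A"
  have le: "gns_norm (c \<odot> a) \<le> cmod c * gns_norm a" if a: "a \<in> carrier A" for c a
  proof (rule gns_norm_leI)
    fix b assume b: "b \<in> carrier A" "gns_len b \<le> 1"
    then show "gns_len (c \<odot> a \<otimes> b) \<le> cmod c * gns_norm a"
      using a by (simp add: mult_smult_left gns_len_smult gns_len_le_gns_norm mult_left_mono)
  qed
  show "gns_norm (c \<odot> a) = cmod c * gns_norm a"
  proof (cases "c = 0")
    case True
    then show ?thesis
      using le[OF a, of 0] gns_norm_nonneg[of "0 \<odot> a"] a by simp
  next
    case False
    have "(1 / c) \<odot> (c \<odot> a) = a"
      using a False by (simp add: smult_smult smult_one)
    then have "cmod c * gns_norm a \<le> gns_norm (c \<odot> a)"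
      using le[of "c \<odot> a" "1 / c"] a False by (simp add: norm_divide field_simps)
    then show ?thesis using le[OF a, of c] by simp
  qed
next
  have le: "(gns_norm a)\<^sup>2 \<le> gns_norm (adj A a \<otimes> a)" if a: "a \<in> carrier A" for a
  proof -
    have "gns_norm a \<le> sqrt (gns_norm (adj A a \<otimes> a))"
    proof (rule gns_norm_leI)
      fix b assume b: "b \<in> carrier A" "gns_len b \<le> 1"
      have "(gns_len (a \<otimes> b))\<^sup>2 \<le> gns_len b * gns_len ((adj A a \<otimes> a) \<otimes> b)"
        unfolding gns_len_mult_sq[OF a b(1)] using a b by (intro gns_Cauchy_Schwarz) auto
      also have "\<dots> \<le> 1 * gns_norm (adj A a \<otimes> a)"
        using a b gns_len_nonneg by (intro mult_mono gns_len_le_gns_norm) auto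
      finally show "gns_len (a \<otimes> b) \<le> sqrt (gns_norm (adj A a \<otimes> a))"
        by (simp add: real_le_rsqrt)
    qed
    then show ?thesis
      using a gns_norm_nonneg by (metis adj_closed m_closed power_mono real_sqrt_pow2)
  qed
  have le2: "gns_norm (adj A a \<otimes> a) \<le> gns_norm (adj A a) * gns_norm a" if "a \<in> carrier A" for a
    using gns_norm_mult[of "adj A a" a] that by simp
  have le3: "gns_norm a \<le> gns_norm (adj A a)" if a: "a \<in> carrier A" for a
  proof (cases "gns_norm a = 0")
    case True
    then show ?thesis using gns_norm_nonneg[of "adj A a"] a by simp
  next
    case False
    have "gns_norm a * gns_norm a \<le> gns_norm (adj A a) * gns_norm a"
      using le[OF a] le2[OF a] by (simp add: power2_eq_square)
    then show ?thesis
      using False gns_norm_nonneg[OF a] by (simp add: mult_le_cancel_right)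
  qed
  fix a assume a: "a \<in> carrier A"
  have "gns_norm (adj A a) = gns_norm a"
    using le3[OF a] le3[of "adj A a"] a by (simp add: adj_adj)
  then show "gns_norm (adj A a \<otimes> a) = (gns_norm a)\<^sup>2"
    using le[OF a] le2[OF a] by (simp add: power2_eq_square)
qed

text \<open>The vector given by the unit has length at most 1, so the length of \<open>a\<close> is
  at most its operator norm. In this way a state produces a lower bound for the enveloping
  norm.\<close>

lemma omega_sq_le_env_norm_sq:
  assumes a: "a \<in> carrier A" and one: "Re (\<omega> \<one>) \<le> 1"
  shows "Re (\<omega> (adj A a \<otimes> a)) \<le> (env_norm A a)\<^sup>2"
proof -
  have "adj A \<one> = \<one>"
    by (metis adj_adj adj_closed adj_mult l_one one_closed r_one)
  then have "gns_len \<one> \<le> 1"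
    using one by (simp add: gns_len_def)
  then have "gns_len a \<le> env_norm A a"
    using gns_len_le_gns_norm[OF a one_closed] seminorm_le_env_norm[OF cstar_seminorm_gns_norm a] a
    by simp
  then show ?thesis
    using gns_len_sq[OF a] gns_len_nonneg[OF a] power_mono by metis
qed

end

section \<open>The enveloping algebra as a ring\<close>

context normed_star_alg
begin

abbreviation "eqv s t \<equiv> (\<lambda>n. env_norm A (s n \<ominus> t n)) \<longlonglongrightarrow> 0"

lemma cauchyD: "s \<in> env_cauchy A \<Longrightarrow> s n \<in> carrier A"
  by (simp add: env_cauchy_def)

lemma cauchyD2: "s \<in> env_cauchy A \<Longrightarrow> e > 0 \<Longrightarrow> \<exists>N. \<forall>m\<ge>N. \<forall>n\<ge>N. env_norm A (s m \<ominus> s n) < e"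
  by (simp add: env_cauchy_def)

lemma minus_self: "a \<in> carrier A \<Longrightarrow> a \<ominus> a = \<zero>"
  by (simp add: a_minus_def r_neg)

lemma cauchy_const: "a \<in> carrier A \<Longrightarrow> (\<lambda>_. a) \<in> env_cauchy A"
  by (simp add: env_cauchy_def minus_self env_norm_zero)

lemma add_minus_add:
  assumes "a \<in> carrier A" "b \<in> carrier A" "c \<in> carrier A" "d \<in> carrier A"
  shows "(a \<oplus> b) \<ominus> (c \<oplus> d) = (a \<ominus> c) \<oplus> (b \<ominus> d)"
  using assms by (simp add: a_minus_def minus_add a_ac)

lemma mult_minus_mult:
  assumes "a \<in> carrier A" "b \<in> carrier A" "c \<in> carrier A" "d \<in> carrier A"
  shows "(a \<otimes> b) \<ominus> (c \<otimes> d) = a \<otimes> (b \<ominus> d) \<oplus> (a \<ominus> c) \<otimes> d"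
proof -
  have "a \<otimes> (b \<ominus> d) \<oplus> (a \<ominus> c) \<otimes> d = a \<otimes> b \<oplus> (\<ominus> (a \<otimes> d) \<oplus> (a \<otimes> d \<oplus> \<ominus> (c \<otimes> d)))"
    using assms by (simp add: a_minus_def l_distr r_distr r_minus l_minus a_assoc)
  also have "\<dots> = (a \<otimes> b) \<ominus> (c \<otimes> d)"
    using assms by (simp add: a_minus_def r_neg1)
  finally show ?thesis ..
qed

lemma env_norm_add_minus_add:
  assumes "a \<in> carrier A" "b \<in> carrier A" "c \<in> carrier A" "d \<in> carrier A"
  shows "env_norm A ((a \<oplus> b) \<ominus> (c \<oplus> d)) \<le> env_norm A (a \<ominus> c) + env_norm A (b \<ominus> d)"
  using assms by (simp add: add_minus_add env_norm_add)

lemma env_norm_mult_minus_mult: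
  assumes "a \<in> carrier A" "b \<in> carrier A" "c \<in> carrier A" "d \<in> carrier A"
  shows "env_norm A ((a \<otimes> b) \<ominus> (c \<otimes> d))
    \<le> env_norm A a * env_norm A (b \<ominus> d) + env_norm A (a \<ominus> c) * env_norm A d"
proof -
  have "env_norm A ((a \<otimes> b) \<ominus> (c \<otimes> d)) \<le> env_norm A (a \<otimes> (b \<ominus> d)) + env_norm A ((a \<ominus> c) \<otimes> d)"
    using assms by (simp add: mult_minus_mult env_norm_add)
  then show ?thesis
    using env_norm_mult[of a "b \<ominus> d"] env_norm_mult[of "a \<ominus> c" d] assms by simp
qed

lemma cauchy_add:
  assumes "s \<in> env_cauchy A" "t \<in> env_cauchy A"
  shows "(\<lambda>n. s n \<oplus> t n) \<in> env_cauchy A"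
  unfolding env_cauchy_def
proof (intro CollectI conjI allI impI)
  fix e :: real assume "e > 0"
  then have e: "e / 2 > 0" by simp
  obtain M where M: "\<And>m n. m \<ge> M \<Longrightarrow> n \<ge> M \<Longrightarrow> env_norm A (s m \<ominus> s n) < e / 2"
    using cauchyD2[OF assms(1) e] by blast
  obtain L where L: "\<And>m n. m \<ge> L \<Longrightarrow> n \<ge> L \<Longrightarrow> env_norm A (t m \<ominus> t n) < e / 2"
    using cauchyD2[OF assms(2) e] by blast
  have "env_norm A ((s m \<oplus> t m) \<ominus> (s n \<oplus> t n)) < e" if "m \<ge> max M L" "n \<ge> max M L" for m n
    using env_norm_add_minus_add[of "s m" "t m" "s n" "t n"] M[of m n] L[of m n] that cauchyD assms
    by (fastforce simp: field_sum_of_halves)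
  then show "\<exists>N. \<forall>m\<ge>N. \<forall>n\<ge>N. env_norm A ((s m \<oplus> t m) \<ominus> (s n \<oplus> t n)) < e" by blast
qed (use assms cauchyD in auto)

lemma cauchy_bounded:
  assumes s: "s \<in> env_cauchy A"
  obtains B where "B > 0" "\<And>n. env_norm A (s n) \<le> B"
proof -
  obtain N where N: "\<And>m n. m \<ge> N \<Longrightarrow> n \<ge> N \<Longrightarrow> env_norm A (s m \<ominus> s n) < 1"
    using cauchyD2[OF s, of 1] by auto
  define B where "B = Max ((\<lambda>n. env_norm A (s n)) ` {..N}) + 1"
  have le: "env_norm A (s n) \<le> B - 1" if "n \<le> N" for n
    unfolding B_def using that by (auto intro: Max_ge)
  have "env_norm A (s n) \<le> B" for n
  proof (cases "n \<le> N")
    case True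
    then show ?thesis using le[of n] by simp
  next
    case False
    then show ?thesis
      using env_norm_triangle_diff[of "s n" "s N"] N[of n N] le[of N] cauchyD[OF s] by fastforce
  qed
  moreover have "B > 0"
    using le[of 0] env_norm_nonneg[OF cauchyD[OF s], of 0] by simp
  ultimately show thesis using that by blast
qed

lemma cauchy_mult:
  assumes s: "s \<in> env_cauchy A" and t: "t \<in> env_cauchy A"
  shows "(\<lambda>n. s n \<otimes> t n) \<in> env_cauchy A"
  unfolding env_cauchy_def
proof (intro CollectI conjI allI impI)
  obtain B where B: "B > 0" "\<And>n. env_norm A (s n) \<le> B" using cauchy_bounded[OF s] by blast
  obtain C where C: "C > 0" "\<And>n. env_norm A (t n) \<le> C" using cauchy_bounded[OF t] by blast
  fix e :: real assume "e > 0"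
  then have e: "e / (2 * C) > 0" "e / (2 * B) > 0" using B C by simp_all
  obtain M where M: "\<And>m n. m \<ge> M \<Longrightarrow> n \<ge> M \<Longrightarrow> env_norm A (s m \<ominus> s n) < e / (2 * C)"
    using cauchyD2[OF s e(1)] by blast
  obtain L where L: "\<And>m n. m \<ge> L \<Longrightarrow> n \<ge> L \<Longrightarrow> env_norm A (t m \<ominus> t n) < e / (2 * B)"
    using cauchyD2[OF t e(2)] by blast
  have "env_norm A ((s m \<otimes> t m) \<ominus> (s n \<otimes> t n)) < e" if "m \<ge> max M L" "n \<ge> max M L" for m n
  proof -
    have "env_norm A ((s m \<otimes> t m) \<ominus> (s n \<otimes> t n))
        \<le> env_norm A (s m) * env_norm A (t m \<ominus> t n) + env_norm A (s m \<ominus> s n) * env_norm A (t n)"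
      using s t cauchyD by (intro env_norm_mult_minus_mult) auto
    also have "\<dots> \<le> B * env_norm A (t m \<ominus> t n) + env_norm A (s m \<ominus> s n) * C"
      using B C s t cauchyD by (intro add_mono mult_mono) (auto intro!: env_norm_nonneg)
    also have "\<dots> < B * (e / (2 * B)) + (e / (2 * C)) * C"
      using B C M[of m n] L[of m n] that by (intro add_strict_mono mult_strict_left_mono mult_strict_right_mono) auto
    also have "\<dots> = e" using B C by simp
    finally show ?thesis .
  qed
  then show "\<exists>N. \<forall>m\<ge>N. \<forall>n\<ge>N. env_norm A ((s m \<otimes> t m) \<ominus> (s n \<otimes> t n)) < e" by blast
qed (use assms cauchyD in auto)

lemma cauchy_uminus: "s \<in> env_cauchy A \<Longrightarrow> (\<lambda>n. \<ominus> s n) \<in> env_cauchy A"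
proof -
  assume s: "s \<in> env_cauchy A"
  have "(\<lambda>n. (\<ominus> \<one>) \<otimes> s n) \<in> env_cauchy A"
    using cauchy_mult[OF cauchy_const s] by simp
  then show ?thesis
    using cauchyD[OF s] by (simp add: l_minus)
qed

lemma cauchy_minus: "s \<in> env_cauchy A \<Longrightarrow> t \<in> env_cauchy A \<Longrightarrow> (\<lambda>n. s n \<ominus> t n) \<in> env_cauchy A"
  unfolding a_minus_def by (intro cauchy_add cauchy_uminus)

lemma eqv_refl: "s \<in> env_cauchy A \<Longrightarrow> eqv s s"
  by (simp add: minus_self env_norm_zero cauchyD)

lemma eqv_sym: "s \<in> env_cauchy A \<Longrightarrow> t \<in> env_cauchy A \<Longrightarrow> eqv s t \<Longrightarrow> eqv t s"
  using env_norm_minus_commute[OF cauchyD cauchyD] by simp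

lemma eqv_trans:
  assumes "s \<in> env_cauchy A" "t \<in> env_cauchy A" "u \<in> env_cauchy A" "eqv s t" "eqv t u"
  shows "eqv s u"
proof (rule tendsto_sandwich[OF _ _ tendsto_const])
  show "(\<lambda>n. env_norm A (s n \<ominus> t n) + env_norm A (t n \<ominus> u n)) \<longlonglongrightarrow> 0"
    using tendsto_add[OF assms(4,5)] by simp
qed (use assms cauchyD in \<open>auto intro!: always_eventually env_norm_nonneg env_norm_minus_triangle\<close>)

lemma eqv_add:
  assumes "s \<in> env_cauchy A" "t \<in> env_cauchy A" "s' \<in> env_cauchy A" "t' \<in> env_cauchy A"
    and "eqv s s'" "eqv t t'"
  shows "eqv (\<lambda>n. s n \<oplus> t n) (\<lambda>n. s' n \<oplus> t' n)"
proof (rule tendsto_sandwich[OF _ _ tendsto_const])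
  show "(\<lambda>n. env_norm A (s n \<ominus> s' n) + env_norm A (t n \<ominus> t' n)) \<longlonglongrightarrow> 0"
    using tendsto_add[OF assms(5,6)] by simp
qed (use assms cauchyD in \<open>auto intro!: always_eventually env_norm_nonneg env_norm_add_minus_add\<close>)

lemma eqv_mult:
  assumes s: "s \<in> env_cauchy A" and t: "t \<in> env_cauchy A" "s' \<in> env_cauchy A" and t': "t' \<in> env_cauchy A"
    and "eqv s s'" "eqv t t'"
  shows "eqv (\<lambda>n. s n \<otimes> t n) (\<lambda>n. s' n \<otimes> t' n)"
proof -
  obtain B where B: "B > 0" "\<And>n. env_norm A (s n) \<le> B" using cauchy_bounded[OF s] by blast
  obtain C where C: "C > 0" "\<And>n. env_norm A (t' n) \<le> C" using cauchy_bounded[OF t'] by blast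
  show ?thesis
  proof (rule tendsto_sandwich[OF _ _ tendsto_const])
    show "(\<lambda>n. B * env_norm A (t n \<ominus> t' n) + env_norm A (s n \<ominus> s' n) * C) \<longlonglongrightarrow> 0"
      using tendsto_add[OF tendsto_mult_left[OF assms(6), of B] tendsto_mult_right[OF assms(5), of C]]
      by simp
    have "env_norm A ((s n \<otimes> t n) \<ominus> (s' n \<otimes> t' n))
        \<le> B * env_norm A (t n \<ominus> t' n) + env_norm A (s n \<ominus> s' n) * C" for n
    proof -
      have "env_norm A ((s n \<otimes> t n) \<ominus> (s' n \<otimes> t' n))
          \<le> env_norm A (s n) * env_norm A (t n \<ominus> t' n) + env_norm A (s n \<ominus> s' n) * env_norm A (t' n)"
        using assms cauchyD by (intro env_norm_mult_minus_mult) auto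
      also have "\<dots> \<le> B * env_norm A (t n \<ominus> t' n) + env_norm A (s n \<ominus> s' n) * C"
        using B C assms cauchyD by (intro add_mono mult_mono) (auto intro!: env_norm_nonneg)
      finally show ?thesis .
    qed
    then show "\<forall>\<^sub>F n in sequentially. env_norm A ((s n \<otimes> t n) \<ominus> (s' n \<otimes> t' n))
        \<le> B * env_norm A (t n \<ominus> t' n) + env_norm A (s n \<ominus> s' n) * C" by simp
  qed (use assms cauchyD in \<open>auto intro!: always_eventually env_norm_nonneg\<close>)
qed

lemma mem_env_class: "t \<in> env_class A s \<longleftrightarrow> t \<in> env_cauchy A \<and> eqv s t"
  by (simp add: env_class_def)

lemma env_class_eq_iff:
  assumes "s \<in> env_cauchy A" "t \<in> env_cauchy A"
  shows "env_class A s = env_class A t \<longleftrightarrow> eqv s t"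
proof
  assume "env_class A s = env_class A t"
  moreover have "t \<in> env_class A t" using assms eqv_refl by (simp add: mem_env_class)
  ultimately show "eqv s t" by (metis mem_env_class)
next
  assume st: "eqv s t"
  show "env_class A s = env_class A t"
  proof (intro Set.set_eqI iffI)
    fix u assume "u \<in> env_class A s"
    then show "u \<in> env_class A t"
      using assms eqv_trans[of t s u] eqv_sym[OF assms st] by (simp add: mem_env_class)
  next
    fix u assume "u \<in> env_class A t"
    then show "u \<in> env_class A s"
      using assms eqv_trans[of s t u] st by (simp add: mem_env_class)
  qed
qed

abbreviation "E \<equiv> enveloping_cstar A"

lemma carrier_env: "carrier E = env_class A ` env_cauchy A"
  by (simp add: enveloping_cstar_def)

lemma class_closed: "s \<in> env_cauchy A \<Longrightarrow> env_class A s \<in> carrier E"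
  by (simp add: carrier_env)

text \<open>All representatives give the same class, and there is at least one by reflexivity, so
  the union over representatives collapses to a single class.\<close>

lemma class_UN2:
  assumes s: "s \<in> env_cauchy A" and t: "t \<in> env_cauchy A"
    and f: "\<And>s' t'. s' \<in> env_cauchy A \<Longrightarrow> t' \<in> env_cauchy A \<Longrightarrow> eqv s s' \<Longrightarrow> eqv t t' \<Longrightarrow>
      env_class A (f s' t') = env_class A (f s t)"
  shows "(\<Union>s'\<in>env_class A s. \<Union>t'\<in>env_class A t. env_class A (f s' t')) = env_class A (f s t)"
proof -
  have "s \<in> env_class A s" "t \<in> env_class A t"
    using s t eqv_refl by (auto simp: mem_env_class)
  moreover have "env_class A (f s' t') = env_class A (f s t)"
    if "s' \<in> env_class A s" "t' \<in> env_class A t" for s' t'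
    using that f by (simp add: mem_env_class)
  ultimately show ?thesis by blast
qed

lemma env_mult:
  assumes "s \<in> env_cauchy A" "t \<in> env_cauchy A"
  shows "env_class A s \<otimes>\<^bsub>E\<^esub> env_class A t = env_class A (\<lambda>n. s n \<otimes> t n)"
proof -
  have "env_class A s \<otimes>\<^bsub>E\<^esub> env_class A t
      = (\<Union>s'\<in>env_class A s. \<Union>t'\<in>env_class A t. env_class A (\<lambda>n. s' n \<otimes> t' n))"
    by (simp add: enveloping_cstar_def)
  also have "\<dots> = env_class A (\<lambda>n. s n \<otimes> t n)"
  proof (rule class_UN2[OF assms])
    fix s' t' assume *: "s' \<in> env_cauchy A" "t' \<in> env_cauchy A" "eqv s s'" "eqv t t'"
    then have "eqv (\<lambda>n. s' n \<otimes> t' n) (\<lambda>n. s n \<otimes> t n)"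
      using assms by (intro eqv_mult eqv_sym[of s] eqv_sym[of t]) auto
    then show "env_class A (\<lambda>n. s' n \<otimes> t' n) = env_class A (\<lambda>n. s n \<otimes> t n)"
      using assms * by (subst env_class_eq_iff) (auto intro: cauchy_mult)
  qed
  finally show ?thesis .
qed

lemma env_add:
  assumes "s \<in> env_cauchy A" "t \<in> env_cauchy A"
  shows "env_class A s \<oplus>\<^bsub>E\<^esub> env_class A t = env_class A (\<lambda>n. s n \<oplus> t n)"
proof -
  have "env_class A s \<oplus>\<^bsub>E\<^esub> env_class A t
      = (\<Union>s'\<in>env_class A s. \<Union>t'\<in>env_class A t. env_class A (\<lambda>n. s' n \<oplus> t' n))"
    by (simp add: enveloping_cstar_def)
  also have "\<dots> = env_class A (\<lambda>n. s n \<oplus> t n)"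
  proof (rule class_UN2[OF assms])
    fix s' t' assume *: "s' \<in> env_cauchy A" "t' \<in> env_cauchy A" "eqv s s'" "eqv t t'"
    then have "eqv (\<lambda>n. s' n \<oplus> t' n) (\<lambda>n. s n \<oplus> t n)"
      using assms by (intro eqv_add eqv_sym[of s] eqv_sym[of t]) auto
    then show "env_class A (\<lambda>n. s' n \<oplus> t' n) = env_class A (\<lambda>n. s n \<oplus> t n)"
      using assms * by (subst env_class_eq_iff) (auto intro: cauchy_add)
  qed
  finally show ?thesis .
qed

lemma env_one: "\<one>\<^bsub>E\<^esub> = env_class A (\<lambda>_. \<one>)"
  and env_zero: "\<zero>\<^bsub>E\<^esub> = env_class A (\<lambda>_. \<zero>)"
  by (simp_all add: enveloping_cstar_def)

lemma ring_env: "ring E"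
proof (rule ringI)
  show "abelian_group E"
  proof (rule abelian_groupI)
    fix x assume "x \<in> carrier E"
    then obtain s where s: "s \<in> env_cauchy A" "x = env_class A s" by (auto simp: carrier_env)
    then show "\<zero>\<^bsub>E\<^esub> \<oplus>\<^bsub>E\<^esub> x = x"
      by (simp add: env_zero env_add cauchy_const cauchyD)
    have "env_class A (\<lambda>n. \<ominus> s n) \<oplus>\<^bsub>E\<^esub> x = \<zero>\<^bsub>E\<^esub>"
      using s by (simp add: env_zero env_add cauchy_uminus cauchyD l_neg)
    then show "\<exists>y\<in>carrier E. y \<oplus>\<^bsub>E\<^esub> x = \<zero>\<^bsub>E\<^esub>"
      using cauchy_uminus[OF s(1)] class_closed by blast
  qed (auto simp: carrier_env env_add env_zero cauchy_add cauchy_const cauchyD a_ac)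
  show "monoid E"
    by (rule monoidI) (auto simp: carrier_env env_mult env_one cauchy_mult cauchy_const cauchyD m_assoc)
qed (auto simp: carrier_env env_add env_mult cauchy_add cauchy_mult cauchyD l_distr r_distr)

lemma env_uminus:
  assumes s: "s \<in> env_cauchy A"
  shows "\<ominus>\<^bsub>E\<^esub> env_class A s = env_class A (\<lambda>n. \<ominus> s n)"
proof -
  interpret E: ring E by (rule ring_env)
  show ?thesis
    using s by (intro E.minus_equality) (auto simp: env_zero env_add cauchy_uminus cauchyD l_neg class_closed)
qed

lemma env_minus:
  "s \<in> env_cauchy A \<Longrightarrow> t \<in> env_cauchy A \<Longrightarrow> env_class A s \<ominus>\<^bsub>E\<^esub> env_class A t = env_class A (\<lambda>n. s n \<ominus> t n)"
  unfolding a_minus_def[of E] by (simp add: env_uminus env_add cauchy_uminus a_minus_def)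

lemma env_norm_diff_le:
  assumes "a \<in> carrier A" "b \<in> carrier A"
  shows "\<bar>env_norm A a - env_norm A b\<bar> \<le> env_norm A (a \<ominus> b)"
  using env_norm_triangle_diff[of a b] env_norm_triangle_diff[of b a] env_norm_minus_commute[of a b] assms
  by linarith

text \<open>The definite description in \<open>nrm\<close> is meaningful because the reverse
  triangle inequality gives all representatives the same limit of seminorms.\<close>

lemma nrm_env:
  assumes s: "s \<in> env_cauchy A"
  shows "(\<lambda>n. env_norm A (s n)) \<longlonglongrightarrow> nrm E (env_class A s)"
proof -
  have "Cauchy (\<lambda>n. env_norm A (s n))"
  proof (rule CauchyI)
    fix e :: real assume "e > 0"
    then obtain N where "\<And>m n. m \<ge> N \<Longrightarrow> n \<ge> N \<Longrightarrow> env_norm A (s m \<ominus> s n) < e"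
      using cauchyD2[OF s] by blast
    then show "\<exists>M. \<forall>m\<ge>M. \<forall>n\<ge>M. norm (env_norm A (s m) - env_norm A (s n)) < e"
      using env_norm_diff_le[OF cauchyD[OF s] cauchyD[OF s]] by (metis le_less_trans real_norm_def)
  qed
  then obtain r where r: "(\<lambda>n. env_norm A (s n)) \<longlonglongrightarrow> r"
    using Cauchy_convergent convergent_def by blast
  have all: "(\<lambda>n. env_norm A (t n)) \<longlonglongrightarrow> r" if "t \<in> env_class A s" for t
  proof -
    have t: "t \<in> env_cauchy A" "eqv s t" using that by (auto simp: mem_env_class)
    have "(\<lambda>n. env_norm A (s n) - env_norm A (t n)) \<longlonglongrightarrow> 0"
      by (rule Lim_null_comparison[OF _ t(2)])
        (use env_norm_diff_le[OF cauchyD[OF s] cauchyD[OF t(1)]] in simp)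
    from tendsto_diff[OF r this] show ?thesis by simp
  qed
  have "s \<in> env_class A s" using s eqv_refl by (simp add: mem_env_class)
  then have "(THE r. \<forall>s\<in>env_class A s. (\<lambda>n. env_norm A (s n)) \<longlonglongrightarrow> r) = r"
    using all by (intro the_equality) (auto dest: LIMSEQ_unique)
  then show ?thesis using r by (simp add: enveloping_cstar_def)
qed

section \<open>Closed ideals of the enveloping algebra, seen on representatives\<close>

lemma closed_ideal_subset: "J \<in> closed_ideals E \<Longrightarrow> J \<subseteq> carrier E"
  by (simp add: closed_ideals_def ideal_def additive_subgroup.a_subset)

lemma closed_ideal_add:
  assumes "J \<in> closed_ideals E" "s \<in> env_cauchy A" "t \<in> env_cauchy A"
    and "env_class A s \<in> J" "env_class A t \<in> J"
  shows "env_class A (\<lambda>n. s n \<oplus> t n) \<in> J"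
  using assms additive_subgroup.a_closed[of J E "env_class A s" "env_class A t"]
  by (simp add: closed_ideals_def ideal_def env_add)

lemma closed_ideal_mult:
  assumes "J \<in> closed_ideals E" "s \<in> env_cauchy A" "t \<in> env_cauchy A" "env_class A s \<in> J"
  shows "env_class A (\<lambda>n. s n \<otimes> t n) \<in> J" "env_class A (\<lambda>n. t n \<otimes> s n) \<in> J"
  using assms ideal.I_r_closed[of J E "env_class A s" "env_class A t"]
    ideal.I_l_closed[of J E "env_class A s" "env_class A t"]
  by (simp_all add: closed_ideals_def env_mult class_closed)

lemma closed_ideal_zero: "J \<in> closed_ideals E \<Longrightarrow> env_class A (\<lambda>_. \<zero>) \<in> J"
  using additive_subgroup.zero_closed[of J E] by (simp add: closed_ideals_def ideal_def env_zero)

text \<open>Turns sequential closedness into an epsilon test on representatives, the form in which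
  averages and Fejer means supply approximants.\<close>

lemma closed_ideal_limit:
  assumes J: "J \<in> closed_ideals E" and s: "s \<in> env_cauchy A"
    and lim: "\<And>e. e > 0 \<Longrightarrow> \<exists>t\<in>env_cauchy A. env_class A t \<in> J \<and> (\<forall>\<^sub>F n in sequentially. env_norm A (t n \<ominus> s n) \<le> e)"
  shows "env_class A s \<in> J"
proof -
  have "\<exists>t\<in>env_cauchy A. env_class A t \<in> J \<and> (\<forall>\<^sub>F n in sequentially. env_norm A (t n \<ominus> s n) \<le> inverse (Suc k))" for k
    by (rule lim) simp
  then obtain t where t: "\<And>k. t k \<in> env_cauchy A" "\<And>k. env_class A (t k) \<in> J"
    "\<And>k. \<forall>\<^sub>F n in sequentially. env_norm A (t k n \<ominus> s n) \<le> inverse (Suc k)" by metis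
  have nrm: "(\<lambda>n. env_norm A (t k n \<ominus> s n)) \<longlonglongrightarrow> nrm E (env_class A (t k) \<ominus>\<^bsub>E\<^esub> env_class A s)" for k
    using nrm_env[OF cauchy_minus[OF t(1) s]] t(1) s by (simp add: env_minus)
  have "(\<lambda>k. nrm E (env_class A (t k) \<ominus>\<^bsub>E\<^esub> env_class A s)) \<longlonglongrightarrow> 0"
  proof (rule tendsto_sandwich[OF _ _ tendsto_const LIMSEQ_inverse_real_of_nat])
    show "\<forall>\<^sub>F k in sequentially. 0 \<le> nrm E (env_class A (t k) \<ominus>\<^bsub>E\<^esub> env_class A s)"
      by (intro always_eventually allI tendsto_lowerbound[OF nrm]) (use t s cauchyD in \<open>auto intro!: env_norm_nonneg\<close>)
    show "\<forall>\<^sub>F k in sequentially. nrm E (env_class A (t k) \<ominus>\<^bsub>E\<^esub> env_class A s) \<le> inverse (real (Suc k))"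
      by (intro always_eventually allI tendsto_upperbound[OF nrm t(3)]) auto
  qed
  moreover have "\<And>u c. (\<forall>n. u n \<in> J) \<and> c \<in> carrier E \<and> (\<lambda>n. nrm E (u n \<ominus>\<^bsub>E\<^esub> c)) \<longlonglongrightarrow> 0 \<longrightarrow> c \<in> J"
    using J unfolding closed_ideals_def mem_Collect_eq by (elim conjE allE)
  from this[of "\<lambda>k. env_class A (t k)" "env_class A s"] show ?thesis
    using t(2) class_closed[OF s] calculation by blast
qed

text \<open>Stability under limits makes \<open>P\<close> a property of classes, by applying it to a constant
  sequence of approximants.\<close>

lemma closed_idealsI:
  assumes zero: "P (\<lambda>_. \<zero>)"
    and add: "\<And>s t. s \<in> env_cauchy A \<Longrightarrow> t \<in> env_cauchy A \<Longrightarrow> P s \<Longrightarrow> P t \<Longrightarrow> P (\<lambda>n. s n \<oplus> t n)"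
    and multr: "\<And>s t. s \<in> env_cauchy A \<Longrightarrow> t \<in> env_cauchy A \<Longrightarrow> P s \<Longrightarrow> P (\<lambda>n. s n \<otimes> t n)"
    and multl: "\<And>s t. s \<in> env_cauchy A \<Longrightarrow> t \<in> env_cauchy A \<Longrightarrow> P s \<Longrightarrow> P (\<lambda>n. t n \<otimes> s n)"
    and lim: "\<And>s. s \<in> env_cauchy A \<Longrightarrow>
      (\<And>e. e > 0 \<Longrightarrow> \<exists>t\<in>env_cauchy A. P t \<and> (\<forall>\<^sub>F n in sequentially. env_norm A (t n \<ominus> s n) < e)) \<Longrightarrow> P s"
  shows "env_class A ` {s \<in> env_cauchy A. P s} \<in> closed_ideals E"
    and "s \<in> env_cauchy A \<Longrightarrow> env_class A s \<in> env_class A ` {s \<in> env_cauchy A. P s} \<longleftrightarrow> P s"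
proof -
  interpret E: ring E by (rule ring_env)
  define J where "J = env_class A ` {s \<in> env_cauchy A. P s}"
  have J: "env_class A s \<in> J \<longleftrightarrow> P s" if s: "s \<in> env_cauchy A" for s
  proof
    assume "env_class A s \<in> J"
    then obtain t where t: "t \<in> env_cauchy A" "P t" "env_class A s = env_class A t" by (auto simp: J_def)
    then have "eqv t s" using s by (simp flip: env_class_eq_iff)
    then have "\<forall>\<^sub>F n in sequentially. env_norm A (t n \<ominus> s n) < e" if "e > 0" for e
      using that order_tendstoD(2) by blast
    then show "P s" using lim[OF s] t by blast
  qed (use s in \<open>auto simp: J_def\<close>)
  have sub: "J \<subseteq> carrier E" by (auto simp: J_def carrier_env)
  \<comment> \<open>An ideal must be an additive subgroup; negation is left multiplication by the
    constant sequence \<open>\<ominus> \<one>\<close>.\<close>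
  have neg: "P (\<lambda>n. \<ominus> s n)" if "s \<in> env_cauchy A" "P s" for s
    using multl[OF that(1) cauchy_const that(2), of "\<ominus> \<one>"] cauchyD[OF that(1)] by (simp add: l_minus)
  have "ideal J E"
  proof (rule idealI[OF ring_env])
    show "subgroup J (add_monoid E)"
    proof (rule E.add.subgroupI)
      show "J \<noteq> {}" using zero cauchy_const[OF zero_closed] by (auto simp: J_def)
      fix a assume "a \<in> J"
      then obtain s where s: "s \<in> env_cauchy A" "P s" "a = env_class A s" by (auto simp: J_def)
      then show "\<ominus>\<^bsub>E\<^esub> a \<in> J" by (simp add: env_uminus J cauchy_uminus neg)
      fix b assume "b \<in> J"
      then obtain t where t: "t \<in> env_cauchy A" "P t" "b = env_class A t" by (auto simp: J_def)
      show "a \<oplus>\<^bsub>E\<^esub> b \<in> J" using s t by (simp add: env_add J cauchy_add add)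
    qed (rule sub)
  qed (auto simp: carrier_env J_def env_mult multr multl cauchy_mult intro!: imageI)
  moreover have "c \<in> J" if t: "\<And>n. t n \<in> J" and c: "c \<in> carrier E"
    and l: "(\<lambda>n. nrm E (t n \<ominus>\<^bsub>E\<^esub> c)) \<longlonglongrightarrow> 0" for t c
  proof -
    obtain s where s: "s \<in> env_cauchy A" "c = env_class A s" using c by (auto simp: carrier_env)
    have "\<forall>n. \<exists>u\<in>env_cauchy A. P u \<and> t n = env_class A u" using t by (auto simp: J_def)
    then obtain u where u: "\<And>n. u n \<in> env_cauchy A" "\<And>n. P (u n)" "\<And>n. t n = env_class A (u n)" by metis
    have "P s"
    proof (rule lim[OF s(1)])
      fix e :: real assume "e > 0"
      then have "\<forall>\<^sub>F n in sequentially. nrm E (t n \<ominus>\<^bsub>E\<^esub> c) < e"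
        using order_tendstoD(2)[OF l] by blast
      then obtain n where "nrm E (t n \<ominus>\<^bsub>E\<^esub> c) < e"
        by (meson eventually_happens trivial_limit_sequentially)
      \<comment> \<open>The norm of a difference of classes is a limit along representatives, so a
        strict bound on it holds for almost all terms.\<close>
      moreover have "(\<lambda>m. env_norm A (u n m \<ominus> s m)) \<longlonglongrightarrow> nrm E (t n \<ominus>\<^bsub>E\<^esub> c)"
        using nrm_env[OF cauchy_minus[OF u(1) s(1)]] u s by (simp add: env_minus)
      ultimately have "\<forall>\<^sub>F m in sequentially. env_norm A (u n m \<ominus> s m) < e"
        using order_tendstoD(2) by blast
      then show "\<exists>t\<in>env_cauchy A. P t \<and> (\<forall>\<^sub>F n in sequentially. env_norm A (t n \<ominus> s n) < e)"
        using u by blast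
    qed
    then show ?thesis using s J by simp
  qed
  ultimately show "env_class A ` {s \<in> env_cauchy A. P s} \<in> closed_ideals E"
    unfolding closed_ideals_def J_def[symmetric] mem_Collect_eq by (intro conjI allI impI) auto
  show "env_class A s \<in> env_class A ` {s \<in> env_cauchy A. P s} \<longleftrightarrow> P s" if "s \<in> env_cauchy A"
    using J[OF that] by (simp add: J_def)
qed

end

section \<open>Integer powers of a partial homeomorphism\<close>

lemma pow_dom_0: "pow_dom S D f 0 = S"
  by (simp add: pow_dom_def)

lemma pow_dom_Suc: "y \<in> pow_dom S D f (Suc n) \<longleftrightarrow> y \<in> pow_dom S D f n \<and> (f ^^ n) y \<in> D"
  by (auto simp: pow_dom_def less_Suc_eq)

lemma pow_dom_subset: "pow_dom S D f n \<subseteq> S"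
  by (auto simp: pow_dom_def)

lemma pow_dom_Suc_left:
  assumes "D \<subseteq> S" "f ` D \<subseteq> S"
  shows "y \<in> pow_dom S D f (Suc n) \<longleftrightarrow> y \<in> D \<and> f y \<in> pow_dom S D f n"
proof -
  have "(\<forall>k<Suc n. (f ^^ k) y \<in> D) \<longleftrightarrow> y \<in> D \<and> (\<forall>k<n. (f ^^ k) (f y) \<in> D)"
    by (simp add: All_less_Suc2 funpow_Suc_right del: funpow.simps(2))
  then show ?thesis using assms by (auto simp: pow_dom_def)
qed

text \<open>The three claims need a joint induction: continuity of the power on its domain exhibits
  the next domain as a preimage of a clopen set, and the next power is continuous only
  there.\<close>

lemma continuous_map_pow_dom:
  assumes D: "openin Y D" "closedin Y D" and f: "continuous_map (subtopology Y D) Y f"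
  shows "openin Y (pow_dom (topspace Y) D f n)" "closedin Y (pow_dom (topspace Y) D f n)"
    "continuous_map (subtopology Y (pow_dom (topspace Y) D f n)) Y (f ^^ n)"
proof (induction n)
  case 0
  { case 1 show ?case by (simp add: pow_dom_0) next
    case 2 show ?case by (simp add: pow_dom_0) next
    case 3 show ?case by (simp add: pow_dom_0) }
next
  case (Suc n)
  let ?P = "pow_dom (topspace Y) D f"
  have eq: "?P (Suc n) = {y \<in> topspace (subtopology Y (?P n)). (f ^^ n) y \<in> D}"
    using pow_dom_subset[of "topspace Y" D f n] by (auto simp: pow_dom_Suc)
  { case 1
    have "openin (subtopology Y (?P n)) (?P (Suc n))"
      unfolding eq by (rule openin_continuous_map_preimage[OF Suc(3) D(1)])
    then show ?case using Suc(1) by (simp add: openin_open_subtopology)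
  next
    case 2
    have "closedin (subtopology Y (?P n)) (?P (Suc n))"
      unfolding eq by (rule closedin_continuous_map_preimage[OF Suc(3) D(2)])
    then show ?case using Suc(2) by (simp add: closedin_closed_subtopology)
  next
    case 3
    have "continuous_map (subtopology Y (?P (Suc n))) Y (f ^^ n)"
      using Suc(3) by (rule continuous_map_from_subtopology_mono) (auto simp: pow_dom_Suc)
    then have "continuous_map (subtopology Y (?P (Suc n))) (subtopology Y D) (f ^^ n)"
      by (auto simp: continuous_map_in_subtopology pow_dom_Suc)
    from continuous_map_compose[OF this f] show ?case by (simp add: o_def) }
qed

text \<open>The preimage of a set containing 0 acquires the whole complement of \<open>U\<close>,
  which is open because \<open>U\<close> is closed.\<close>

lemma continuous_map_extend_by_zero:
  fixes f :: "'y \<Rightarrow> complex"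
  assumes U: "openin Y U" "closedin Y U" and f: "continuous_map (subtopology Y U) euclidean f"
  shows "continuous_map Y euclidean (\<lambda>y. if y \<in> U then f y else 0)"
  unfolding continuous_map_def
proof (intro conjI allI impI)
  fix V :: "complex set" assume "openin euclidean V"
  then have "openin (subtopology Y U) {y \<in> topspace (subtopology Y U). f y \<in> V}"
    using f by (simp add: continuous_map_def)
  then have "openin Y {y \<in> topspace (subtopology Y U). f y \<in> V}"
    using U by (simp add: openin_open_subtopology)
  moreover have "openin Y (if 0 \<in> V then topspace Y - U else {})"
    using U by auto
  moreover have "{y \<in> topspace Y. (if y \<in> U then f y else 0) \<in> V} =
     {y \<in> topspace (subtopology Y U). f y \<in> V} \<union> (if 0 \<in> V then topspace Y - U else {})"
    using openin_subset[OF U(1)] by auto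
  ultimately show "openin Y {y \<in> topspace Y. (if y \<in> U then f y else 0) \<in> V}"
    using openin_Un by metis
qed auto

locale partial_homeo =
  fixes Y :: "'y topology" and F G :: "'y set" and f g :: "'y \<Rightarrow> 'y"
  assumes compact: "compact_space Y" and Hausdorff: "Hausdorff_space Y"
    and F: "openin Y F" "closedin Y F" and G: "openin Y G" "closedin Y G"
    and cont_f: "continuous_map (subtopology Y F) (subtopology Y G) f"
    and cont_g: "continuous_map (subtopology Y G) (subtopology Y F) g"
    and gf: "y \<in> F \<Longrightarrow> g (f y) = y" and fg: "y \<in> G \<Longrightarrow> f (g y) = y"
begin

text \<open>The symmetry between \<open>f\<close> and \<open>g\<close>, by which facts on negative
  powers are read off from those on positive powers.\<close>

lemma swap: "partial_homeo Y G F g f"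
  using compact Hausdorff F G cont_f cont_g gf fg by unfold_locales auto

lemma FG_subset: "F \<subseteq> topspace Y" "G \<subseteq> topspace Y"
  using F G openin_subset by auto

lemma f_mem: "y \<in> F \<Longrightarrow> f y \<in> G" and g_mem: "y \<in> G \<Longrightarrow> g y \<in> F"
  using cont_f cont_g FG_subset by (auto simp: continuous_map_def Pi_iff topspace_subtopology_subset)

lemma images_subset: "f ` F \<subseteq> topspace Y" "g ` G \<subseteq> topspace Y"
  using f_mem g_mem FG_subset by auto

definition dm :: "int \<Rightarrow> 'y set" where
  "dm k = (if 0 \<le> k then pow_dom (topspace Y) F f (nat k) else pow_dom (topspace Y) G g (nat (- k)))"

definition th :: "int \<Rightarrow> 'y \<Rightarrow> 'y" where
  "th k = (if 0 \<le> k then f ^^ nat k else g ^^ nat (- k))"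

lemma dm_0 [simp]: "dm 0 = topspace Y" and th_0 [simp]: "th 0 y = y"
  by (simp_all add: dm_def th_def pow_dom_0)

lemma dm_1: "dm 1 = F" and th_1: "th 1 = f"
  using FG_subset by (auto simp: dm_def th_def pow_dom_def)

lemma dm_minus_1: "dm (-1) = G" and th_minus_1: "th (-1) = g"
  using FG_subset by (auto simp: dm_def th_def pow_dom_def)

lemma dm_subset: "dm k \<subseteq> topspace Y"
  by (auto simp: dm_def pow_dom_def)

lemma dm_clopen: "openin Y (dm k)" "closedin Y (dm k)"
  and cont_th: "continuous_map (subtopology Y (dm k)) Y (th k)"
  using continuous_map_pow_dom[OF F] continuous_map_pow_dom[OF G] cont_f cont_g
  by (auto simp: dm_def th_def continuous_map_in_subtopology)

lemma dm_step_up: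
  assumes "y \<in> dm i" "th i y \<in> F"
  shows "y \<in> dm (i + 1)" "th (i + 1) y = f (th i y)"
proof -
  have "y \<in> dm (i + 1) \<and> th (i + 1) y = f (th i y)"
  proof (cases "0 \<le> i")
    case True
    then have "nat (i + 1) = Suc (nat i)" by simp
    then show ?thesis using assms True by (simp add: dm_def th_def pow_dom_Suc)
  next
    case False
    \<comment> \<open>For negative \<open>i\<close> the last application in \<open>th i\<close> is
      one of \<open>g\<close>, which \<open>f\<close> cancels; \<open>m\<close> counts the remaining
      ones.\<close>
    define m where "m = nat (- (i + 1))"
    have m: "nat (- i) = Suc m" using False by (simp add: m_def)
    have y: "y \<in> pow_dom (topspace Y) G g m" "(g ^^ m) y \<in> G" "th i y = g ((g ^^ m) y)"
      using assms False by (simp_all add: dm_def th_def m pow_dom_Suc)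
    have "f (th i y) = (g ^^ m) y" using y by (simp add: fg)
    moreover have "dm (i + 1) = pow_dom (topspace Y) G g m" "th (i + 1) = g ^^ m"
      using False by (cases "i = -1"; simp add: dm_def th_def m_def pow_dom_0 fun_eq_iff)+
    ultimately show ?thesis using y by simp
  qed
  then show "y \<in> dm (i + 1)" "th (i + 1) y = f (th i y)" by auto
qed

lemma dm_swap: "partial_homeo.dm Y G F g f k = dm (- k)"
  and th_swap: "partial_homeo.th g f k = th (- k)"
proof -
  interpret S: partial_homeo Y G F g f by (rule swap)
  show "S.dm k = dm (- k)" "S.th k = th (- k)"
    by (auto simp: dm_def th_def S.dm_def S.th_def pow_dom_0 fun_eq_iff)
qed

lemma dm_step_down:
  assumes "y \<in> dm i" "th i y \<in> G"
  shows "y \<in> dm (i - 1)" "th (i - 1) y = g (th i y)"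
  using partial_homeo.dm_step_up[OF swap, of y "- i"] assms by (simp_all add: dm_swap th_swap)

text \<open>Away from the change of sign the step of \<open>dm_step_up\<close> is an equivalence. It
  is not one for negative exponents: \<open>dm 0\<close> is all of \<open>Y\<close>, but
  \<open>dm (-1)\<close> is only \<open>G\<close>.\<close>

lemma dm_pos_iff: "0 \<le> k \<Longrightarrow> y \<in> dm (k + 1) \<longleftrightarrow> y \<in> dm k \<and> th k y \<in> F"
  by (simp add: dm_def th_def nat_add_distrib pow_dom_Suc)

lemma dm_neg_iff: "k \<le> 0 \<Longrightarrow> y \<in> dm (k - 1) \<longleftrightarrow> y \<in> dm k \<and> th k y \<in> G"
  using partial_homeo.dm_pos_iff[OF swap, of "- k"] by (simp add: dm_swap th_swap)

lemma th_pos: "0 \<le> k \<Longrightarrow> th (k + 1) y = f (th k y)"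
  by (simp add: th_def nat_add_distrib)

lemma th_neg: "k \<le> 0 \<Longrightarrow> th (k - 1) y = g (th k y)"
  using partial_homeo.th_pos[OF swap, of "- k"] by (simp add: th_swap)

lemma minus_Suc: "- int (Suc n) = - int n - 1"
  by simp

text \<open>The powers obey only a partial group law: \<open>th (i + j)\<close> may have a larger
  domain than \<open>th j\<close> after \<open>th i\<close>, as for \<open>j = - i\<close>. The
  second power is built up one step at a time, and \<open>dm_step_up\<close> and
  \<open>dm_step_down\<close> take care of the cancellation across exponent 0.\<close>

lemma th_comp:
  assumes "y \<in> dm i" "th i y \<in> dm j"
  shows "y \<in> dm (i + j)" "th (i + j) y = th j (th i y)"
proof -
  have pos: "y \<in> dm (i + int n) \<and> th (i + int n) y = th (int n) (th i y)"
    if "y \<in> dm i" "th i y \<in> dm (int n)" for n y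
    using that
  proof (induction n)
    case (Suc n)
    have *: "th i y \<in> dm (int n)" "th (int n) (th i y) \<in> F"
      using dm_pos_iff[of "int n" "th i y"] Suc.prems(2) by (simp_all add: add.commute)
    then have IH: "y \<in> dm (i + int n)" "th (i + int n) y = th (int n) (th i y)"
      using Suc.IH Suc.prems(1) by auto
    then show ?case
      using dm_step_up[OF IH(1)] th_pos[of "int n" "th i y"] * by (simp add: add_ac)
  qed simp
  have neg: "y \<in> dm (i - int n) \<and> th (i - int n) y = th (- int n) (th i y)"
    if "y \<in> dm i" "th i y \<in> dm (- int n)" for n y
    using that
  proof (induction n)
    case (Suc n)
    have *: "th i y \<in> dm (- int n)" "th (- int n) (th i y) \<in> G"
      using dm_neg_iff[of "- int n" "th i y"] Suc.prems(2)[unfolded minus_Suc] by simp_all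
    then have IH: "y \<in> dm (i - int n)" "th (i - int n) y = th (- int n) (th i y)"
      using Suc.IH Suc.prems(1) by auto
    then show ?case
      using dm_step_down[OF IH(1)] th_neg[of "- int n" "th i y", folded minus_Suc] *
      by (simp add: diff_diff_eq add.commute)
  qed simp
  have "y \<in> dm (i + j) \<and> th (i + j) y = th j (th i y)"
    using pos[of y "nat j"] neg[of y "nat (- j)"] assms by (cases "0 \<le> j") auto
  then show "y \<in> dm (i + j)" "th (i + j) y = th j (th i y)" by auto
qed

text \<open>The last step is undone first, and the inverse of the remaining power is attached by
  \<open>th_comp\<close>.\<close>

lemma th_inverse:
  assumes "y \<in> dm i"
  shows "th i y \<in> dm (- i)" "th (- i) (th i y) = y"
proof -
  have pos: "th (int n) y \<in> dm (- int n) \<and> th (- int n) (th (int n) y) = y"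
    if "y \<in> dm (int n)" for n y
    using that
  proof (induction n arbitrary: y)
    case (Suc n)
    have *: "y \<in> dm (int n)" "th (int n) y \<in> F"
      using dm_pos_iff[of "int n" y] Suc.prems by (simp_all add: add.commute)
    have z: "th (int (Suc n)) y = f (th (int n) y)"
      using th_pos[of "int n" y] by (simp add: add.commute)
    have "f (th (int n) y) \<in> dm (-1)" "th (-1) (f (th (int n) y)) = th (int n) y"
      using * by (simp_all add: dm_minus_1 th_minus_1 f_mem gf)
    then have "f (th (int n) y) \<in> dm (-1 + - int n)"
      "th (-1 + - int n) (f (th (int n) y)) = th (- int n) (th (int n) y)"
      using th_comp[of "f (th (int n) y)" "-1" "- int n"] Suc.IH[OF *(1)] by auto
    moreover have "- int (Suc n) = -1 + - int n" by simp
    ultimately show ?case using Suc.IH[OF *(1)] by (simp only: z)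
  qed simp
  have neg: "th (- int n) y \<in> dm (int n) \<and> th (int n) (th (- int n) y) = y"
    if "y \<in> dm (- int n)" for n y
    using that
  proof (induction n arbitrary: y)
    case (Suc n)
    have *: "y \<in> dm (- int n)" "th (- int n) y \<in> G"
      using dm_neg_iff[of "- int n" y] Suc.prems[unfolded minus_Suc] by simp_all
    have z: "th (- int (Suc n)) y = g (th (- int n) y)"
      using th_neg[of "- int n" y, folded minus_Suc] by simp
    have "g (th (- int n) y) \<in> dm 1" "th 1 (g (th (- int n) y)) = th (- int n) y"
      using * by (simp_all add: dm_1 th_1 g_mem fg)
    then have "g (th (- int n) y) \<in> dm (1 + int n)"
      "th (1 + int n) (g (th (- int n) y)) = th (int n) (th (- int n) y)"
      using th_comp[of "g (th (- int n) y)" 1 "int n"] Suc.IH[OF *(1)] by auto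
    then show ?case using Suc.IH[OF *(1)] unfolding z by simp
  qed simp
  show "th i y \<in> dm (- i)" "th (- i) (th i y) = y"
    using pos[of y "nat i"] neg[of y "nat (- i)"] assms by (cases "0 \<le> i"; simp)+
qed

lemma th_mem: "y \<in> dm i \<Longrightarrow> th i y \<in> topspace Y"
  using th_inverse(1) dm_subset by blast

text \<open>From \<open>th i y\<close> one goes back by \<open>- i\<close> and then forward by
  \<open>i + j\<close>, so \<open>th_comp\<close> applies.\<close>

lemma th_restart:
  assumes "y \<in> dm i" "y \<in> dm (i + j)"
  shows "th i y \<in> dm j" "th j (th i y) = th (i + j) y"
  using th_comp[of "th i y" "- i" "i + j"] th_inverse[OF assms(1)] assms by simp_all

section \<open>Powers of the partial automorphism\<close>

lemma C_vanI: "continuous_map Y euclidean h \<Longrightarrow> (\<And>y. y \<notin> K \<Longrightarrow> h y = 0) \<Longrightarrow> h \<in> C_van Y K"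
  by (simp add: C_van_def)

lemma C_van_cont: "h \<in> C_van Y K \<Longrightarrow> continuous_map Y euclidean h"
  and C_van_zero: "h \<in> C_van Y K \<Longrightarrow> y \<notin> K \<Longrightarrow> h y = 0"
  by (simp_all add: C_van_def)

lemma C_van_mono: "h \<in> C_van Y K \<Longrightarrow> K \<subseteq> K' \<Longrightarrow> h \<in> C_van Y K'"
  by (auto simp: C_van_def)

lemma C_van_dm_pullback:
  assumes h: "continuous_map Y euclidean h"
  shows "(\<lambda>y. if y \<in> dm k then h (th k y) else 0) \<in> C_van Y (dm k)"
proof (rule C_vanI)
  show "continuous_map Y euclidean (\<lambda>y. if y \<in> dm k then h (th k y) else 0)"
    using continuous_map_compose[OF cont_th h]
    by (intro continuous_map_extend_by_zero[OF dm_clopen]) (simp add: o_def)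
qed simp

text \<open>\<open>T\<close> is kept abstract because it stands for the inverse of the partial
  automorphism and, after exchanging \<open>f\<close> and \<open>g\<close>, for the automorphism
  itself. Its values are prescribed only on functions supported in \<open>F\<close>, its
  domain.\<close>

lemma paut_pow_dom_aux:
  assumes T: "\<And>b. b \<in> C_van Y F \<Longrightarrow> T b = (\<lambda>y. if y \<in> G then b (g y) else 0)"
  shows "pow_dom (C_van Y (topspace Y)) (C_van Y F) T n = C_van Y (dm (int n))"
    and "b \<in> C_van Y (dm (int n)) \<Longrightarrow> (T ^^ n) b = (\<lambda>y. if y \<in> dm (- int n) then b (th (- int n) y) else 0)"
proof (induction n arbitrary: b)
  case 0
  { case 1 show ?case by (simp add: pow_dom_0) next
    case 2 then show ?case by (auto simp: C_van_def) }
next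
  case (Suc n)
  let ?b = "\<lambda>b y. if y \<in> dm (- int n) then b (th (- int n) y) else 0"
  have dS: "y \<in> dm (int (Suc n)) \<longleftrightarrow> y \<in> dm (int n) \<and> th (int n) y \<in> F" for y
    using dm_pos_iff[of "int n" y] by (simp add: add.commute)
  have b': "?b b \<in> C_van Y F" if "b \<in> C_van Y (dm (int (Suc n)))" for b
  proof (rule C_vanI)
    show "continuous_map Y euclidean (?b b)"
      using C_van_dm_pullback[OF C_van_cont[OF that]] by (rule C_van_cont)
    show "?b b y = 0" if "y \<notin> F" for y
      using that \<open>b \<in> _\<close> th_inverse[of y "- int n"] dS by (auto intro: C_van_zero)
  qed
  { case 1
    show ?case
    proof (intro Set.set_eqI iffI)
      fix b assume "b \<in> pow_dom (C_van Y (topspace Y)) (C_van Y F) T (Suc n)"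
      then have b: "b \<in> C_van Y (dm (int n))" "(T ^^ n) b \<in> C_van Y F"
        by (simp_all add: pow_dom_Suc Suc.IH(1))
      then have v: "?b b \<in> C_van Y F" by (simp add: Suc.IH(2))
      show "b \<in> C_van Y (dm (int (Suc n)))"
      proof (rule C_vanI[OF C_van_cont[OF b(1)]])
        fix z assume z: "z \<notin> dm (int (Suc n))"
        show "b z = 0"
        proof (cases "z \<in> dm (int n)")
          case True
          \<comment> \<open>At \<open>th (int n) z\<close>, which lies outside \<open>F\<close>, the
            pullback of \<open>b\<close> returns the value \<open>b z\<close>.\<close>
          then have "?b b (th (int n) z) = 0" using z dS C_van_zero[OF v] by blast
          then show ?thesis using th_inverse[OF True] by simp
        qed (use b in \<open>auto intro: C_van_zero\<close>)
      qed
    next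
      fix b assume b: "b \<in> C_van Y (dm (int (Suc n)))"
      then have "b \<in> C_van Y (dm (int n))" by (rule C_van_mono) (use dS in auto)
      then show "b \<in> pow_dom (C_van Y (topspace Y)) (C_van Y F) T (Suc n)"
        using b'[OF b] by (simp add: pow_dom_Suc Suc.IH)
    qed
  next
    case 2
    then have "b \<in> C_van Y (dm (int n))" by (rule C_van_mono) (use dS in auto)
    then have "(T ^^ Suc n) b = (\<lambda>y. if y \<in> G then ?b b (g y) else 0)"
      using b'[OF 2] by (simp add: Suc.IH(2) T)
    also have "\<dots> = (\<lambda>y. if y \<in> dm (- int (Suc n)) then b (th (- int (Suc n)) y) else 0)"
    proof
      fix y
      \<comment> \<open>The outermost application of \<open>T\<close> evaluates at
        \<open>g y\<close>, so here the first step of the power is split off rather than the last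
        one.\<close>
      have eq: "- int (Suc n) = -1 + - int n" by simp
      have "y \<in> dm (- int (Suc n)) \<longleftrightarrow> y \<in> G \<and> g y \<in> dm (- int n)"
        using pow_dom_Suc_left[OF FG_subset(2) images_subset(2), of y n] by (simp add: dm_def pow_dom_0 del: of_nat_Suc)
      moreover have "th (- int (Suc n)) y = th (- int n) (g y)" if "y \<in> G" "g y \<in> dm (- int n)"
        using th_comp(2)[of y "-1" "- int n"] that unfolding eq by (simp add: dm_minus_1 th_minus_1)
      ultimately show "(if y \<in> G then ?b b (g y) else 0)
          = (if y \<in> dm (- int (Suc n)) then b (th (- int (Suc n)) y) else 0)" by simp
    qed
    finally show ?case . }
qed

text \<open>Pullback along \<open>f\<close> is injective on functions supported in \<open>G\<close>,
  because each \<open>y\<close> in \<open>G\<close> is \<open>f (g y)\<close>. This makes the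
  \<open>inv_into\<close> in \<open>paut_inv\<close> computable.\<close>

lemma paut_inv_apply:
  assumes b: "b \<in> C_van Y F"
  shows "paut_inv Y F G f b = (\<lambda>y. if y \<in> G then b (g y) else 0)"
proof -
  let ?c = "\<lambda>y. if y \<in> G then b (g y) else 0"
  have "?c \<in> C_van Y G"
    using C_van_dm_pullback[OF C_van_cont[OF b], of "-1"]
    by (simp add: dm_minus_1 th_minus_1 cong: if_cong)
  moreover have "paut F f ?c = b"
    using b f_mem gf by (auto simp: paut_def C_van_def)
  moreover have "inj_on (paut F f) (C_van Y G)"
  proof (rule inj_onI)
    fix u v assume uv: "u \<in> C_van Y G" "v \<in> C_van Y G" "paut F f u = paut F f v"
    show "u = v"
    proof
      fix y
      show "u y = v y"
      proof (cases "y \<in> G")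
        case True
        then show ?thesis
          using fun_cong[OF uv(3), of "g y"] g_mem fg by (simp add: paut_def)
      qed (use uv in \<open>simp add: C_van_def\<close>)
    qed
  qed
  ultimately show ?thesis
    unfolding paut_inv_def by (simp add: inv_into_f_eq)
qed

lemma paut_D_eq: "paut_D Y F G f k = C_van Y (dm k)"
proof (cases "0 \<le> k")
  case True
  then show ?thesis
    using paut_pow_dom_aux(1)[OF paut_inv_apply, of "nat k"] by (simp add: paut_D_def)
next
  case False
  interpret S: partial_homeo Y G F g f by (rule swap)
  show ?thesis
    using False S.paut_pow_dom_aux(1)[of "paut F f" "nat (- k)"]
    by (simp add: paut_D_def paut_def dm_swap)
qed

lemma paut_pow_eq:
  assumes "b \<in> C_van Y (dm (- k))"
  shows "paut_pow Y F G f k b = (\<lambda>y. if y \<in> dm k then b (th k y) else 0)"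
proof (cases "0 \<le> k")
  case True
  interpret S: partial_homeo Y G F g f by (rule swap)
  show ?thesis
    using True assms S.paut_pow_dom_aux(2)[of "paut F f" b "nat k"]
    by (simp add: paut_pow_def paut_def dm_swap th_swap cong: if_cong)
next
  case False
  then show ?thesis
    using assms paut_pow_dom_aux(2)[OF paut_inv_apply, of b "nat (- k)"]
    by (simp add: paut_pow_def cong: if_cong)
qed

end

section \<open>The l1 algebra of a partial homeomorphism\<close>

lemma continuous_map_complex_mult [continuous_intros]:
  fixes f g :: "'a \<Rightarrow> complex"
  shows "continuous_map Y euclidean f \<Longrightarrow> continuous_map Y euclidean g
    \<Longrightarrow> continuous_map Y euclidean (\<lambda>y. f y * g y)"
  by (simp add: continuous_map_atin tendsto_mult)

lemma continuous_map_cnj [continuous_intros]: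
  "continuous_map Y euclidean f \<Longrightarrow> continuous_map Y euclidean (\<lambda>y. cnj (f y))"
  by (simp add: continuous_map_atin tendsto_cnj)

lemma continuous_map_of_real [continuous_intros]:
  "continuous_map Y euclideanreal f \<Longrightarrow> continuous_map Y euclidean (\<lambda>y. complex_of_real (f y))"
  by (simp add: continuous_map_atin tendsto_of_real)

lemma continuous_map_uniform_limit_normed:
  fixes h :: "'a \<Rightarrow> 'y \<Rightarrow> complex"
  assumes "\<And>i. continuous_map Y euclidean (h i)" and "uniform_limit (topspace Y) h l S" and "S \<noteq> bot"
  shows "continuous_map Y euclidean l"
  using Met_TC.continuous_map_uniform_limit[of Y h S l] assms
  by (simp add: uniform_limit_iff)

text \<open>Fubini on pairs of integers: the shear \<open>(n, k) \<mapsto> (k, n - k)\<close> is a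
  bijection that turns the convolution into a product family.\<close>

lemma
  fixes u v :: "int \<Rightarrow> real"
  assumes u: "u summable_on UNIV" "\<And>n. 0 \<le> u n" and v: "v summable_on UNIV" "\<And>n. 0 \<le> v n"
  shows summable_convolution_pair: "(\<lambda>(n, k). u k * v (n - k)) summable_on UNIV"
    and summable_convolution_inner: "(\<lambda>k. u k * v (n - k)) summable_on UNIV"
    and summable_convolution: "(\<lambda>n. \<Sum>\<^sub>\<infinity>k. u k * v (n - k)) summable_on UNIV"
    and infsum_convolution: "(\<Sum>\<^sub>\<infinity>n. \<Sum>\<^sub>\<infinity>k. u k * v (n - k)) = infsum u UNIV * infsum v UNIV"
proof -
  have 1: "(\<lambda>(k, m). u k * v m) summable_on UNIV \<times> UNIV"
  proof (rule summable_on_SigmaI)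
    show "((\<lambda>m. case (k, m) of (k, m) \<Rightarrow> u k * v m) has_sum u k * infsum v UNIV) UNIV" for k
      using v(1) by (simp add: has_sum_cmult_right)
    show "(\<lambda>k. u k * infsum v UNIV) summable_on UNIV"
      using u(1) by (rule summable_on_cmult_left)
  qed (use u v in auto)
  have bij: "bij_betw (\<lambda>(n, k). (k, n - k)) UNIV (UNIV :: (int \<times> int) set)"
    by (rule bij_betw_byWitness[where f' = "\<lambda>(k, m). (k + m, k)"]) auto
  have eq: "(\<lambda>(n, k). u k * v (n - k)) = (\<lambda>x. (\<lambda>(k, m). u k * v m) ((\<lambda>(n, k). (k, n - k)) x))"
    by auto
  show 2: "(\<lambda>(n, k). u k * v (n - k)) summable_on UNIV"
    unfolding eq using 1 by (subst summable_on_reindex_bij_betw[OF bij]) simp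
  then have 3: "(\<lambda>(n, k). u k * v (n - k)) summable_on UNIV \<times> UNIV" by simp
  show inner: "(\<lambda>k. u k * v (n - k)) summable_on UNIV" for n
    using summable_on_SigmaD1[OF 3, of n] by simp
  show "(\<lambda>n. \<Sum>\<^sub>\<infinity>k. u k * v (n - k)) summable_on UNIV"
    using summable_on_SigmaD[OF 3] inner by simp
  have "(\<Sum>\<^sub>\<infinity>n. \<Sum>\<^sub>\<infinity>k. u k * v (n - k)) = infsum (\<lambda>(n, k). u k * v (n - k)) UNIV"
    using infsum_Sigma_banach[OF 3] by simp
  also have "\<dots> = infsum (\<lambda>(k, m). u k * v m) UNIV"
    unfolding eq by (rule infsum_reindex_bij_betw[OF bij])
  also have "\<dots> = (\<Sum>\<^sub>\<infinity>k. \<Sum>\<^sub>\<infinity>m. u k * v m)"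
    using infsum_Sigma_banach[OF 1] by simp
  also have "\<dots> = infsum u UNIV * infsum v UNIV"
    by (simp add: infsum_cmult_right' infsum_cmult_left')
  finally show "(\<Sum>\<^sub>\<infinity>n. \<Sum>\<^sub>\<infinity>k. u k * v (n - k)) = infsum u UNIV * infsum v UNIV" .
qed

lemma sup_norm_leI: "(\<And>y. cmod (h y) \<le> r) \<Longrightarrow> sup_norm h \<le> r"
  unfolding sup_norm_def by (rule cSUP_least) auto

context partial_homeo
begin

abbreviation "L \<equiv> l1_alg Y F G f"

lemma C_van_bounded:
  assumes "h \<in> C_van Y K" "K \<subseteq> topspace Y"
  shows "bdd_above (range (\<lambda>y. cmod (h y)))"
proof -
  have "compactin euclidean (h ` topspace Y)"
    using C_van_cont[OF assms(1)] compact by (meson compact_space_def image_compactin)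
  then have "bounded (h ` topspace Y)"
    by (simp add: compact_imp_bounded)
  then obtain B where B: "\<And>y. y \<in> topspace Y \<Longrightarrow> cmod (h y) \<le> B"
    by (auto simp: bounded_iff)
  have "cmod (h y) \<le> max B 0" for y
  proof (cases "y \<in> topspace Y")
    case False
    then have "y \<notin> K" using assms(2) by blast
    then show ?thesis using C_van_zero[OF assms(1)] by simp
  qed (use B[of y] in simp)
  then show ?thesis by (rule bdd_aboveI2)
qed

lemma cmod_le_sup_norm: "h \<in> C_van Y K \<Longrightarrow> K \<subseteq> topspace Y \<Longrightarrow> cmod (h y) \<le> sup_norm h"
  unfolding sup_norm_def using C_van_bounded by (intro cSUP_upper) auto

lemma sup_norm_nonneg: "h \<in> C_van Y K \<Longrightarrow> K \<subseteq> topspace Y \<Longrightarrow> 0 \<le> sup_norm h"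
  using cmod_le_sup_norm norm_ge_zero order_trans by blast

lemma L_carrier: "a \<in> carrier L \<longleftrightarrow> (\<forall>n. a n \<in> C_van Y (dm n)) \<and> (\<lambda>n. sup_norm (a n)) summable_on UNIV"
  by (simp add: l1_alg_def paut_D_eq)

lemma L_coeff: "a \<in> carrier L \<Longrightarrow> a n \<in> C_van Y (dm n)"
  and L_summable: "a \<in> carrier L \<Longrightarrow> (\<lambda>n. sup_norm (a n)) summable_on UNIV"
  by (simp_all add: L_carrier)

lemma L_cont: "a \<in> carrier L \<Longrightarrow> continuous_map Y euclidean (a n)"
  using L_coeff C_van_cont by blast

lemma L_zero_off: "a \<in> carrier L \<Longrightarrow> y \<notin> dm n \<Longrightarrow> a n y = 0"
  using L_coeff C_van_zero by blast

lemma L_le: "a \<in> carrier L \<Longrightarrow> cmod (a n y) \<le> sup_norm (a n)"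
  using cmod_le_sup_norm[OF L_coeff dm_subset] .

lemma L_nonneg: "a \<in> carrier L \<Longrightarrow> 0 \<le> sup_norm (a n)"
  using sup_norm_nonneg[OF L_coeff dm_subset] .

lemma nrm_L: "nrm L a = (\<Sum>\<^sub>\<infinity>n. sup_norm (a n))"
  by (simp add: l1_alg_def)

lemma L_ops:
  "\<zero>\<^bsub>L\<^esub> = (\<lambda>n y. 0)" "\<one>\<^bsub>L\<^esub> = (\<lambda>n y. if n = 0 \<and> y \<in> topspace Y then 1 else 0)"
  "a \<oplus>\<^bsub>L\<^esub> b = (\<lambda>n y. a n y + b n y)" "c \<odot>\<^bsub>L\<^esub> a = (\<lambda>n y. c * a n y)"
  by (simp_all add: l1_alg_def)

lemma L_simps:
  "\<zero>\<^bsub>L\<^esub> n y = 0" "\<one>\<^bsub>L\<^esub> n y = (if n = 0 \<and> y \<in> topspace Y then 1 else 0)"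
  "(a \<oplus>\<^bsub>L\<^esub> b) n y = a n y + b n y" "(c \<odot>\<^bsub>L\<^esub> a) n y = c * a n y"
  by (simp_all add: L_ops)

text \<open>A summable dominating family \<open>M\<close> gives membership and a norm estimate at
  once, without computing any sup norm.\<close>

lemma L_carrierI:
  assumes "\<And>n. continuous_map Y euclidean (a n)" "\<And>n y. y \<notin> dm n \<Longrightarrow> a n y = 0"
    and "\<And>n y. cmod (a n y) \<le> M n" "M summable_on UNIV"
  shows "a \<in> carrier L" and "nrm L a \<le> infsum M UNIV"
proof -
  have c: "a n \<in> C_van Y (dm n)" for n
    using assms by (intro C_vanI) auto
  have le: "sup_norm (a n) \<le> M n" for n
    using assms(3) by (rule sup_norm_leI)
  have s: "(\<lambda>n. sup_norm (a n)) summable_on UNIV"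
    using sup_norm_nonneg[OF c dm_subset] le by (intro summable_on_comparison_test[OF assms(4)]) auto
  show "a \<in> carrier L" using c s by (simp add: L_carrier)
  show "nrm L a \<le> infsum M UNIV"
    unfolding nrm_L using s assms(4) le by (intro infsum_mono) auto
qed

text \<open>The outer power of the automorphism undoes the inner one on \<open>a k\<close> and moves
  only the argument of \<open>b\<close>. Outside \<open>dm k\<close> both sides vanish with
  \<open>a k\<close>.\<close>

lemma L_mult_fun:
  assumes a: "a \<in> carrier L" and b: "b \<in> carrier L"
  shows "a \<otimes>\<^bsub>L\<^esub> b = (\<lambda>n y. \<Sum>\<^sub>\<infinity>k. a k y * b (n - k) (th k y))"
proof -
  have "paut_pow Y F G f k (\<lambda>z. paut_pow Y F G f (- k) (a k) z * b (n - k) z) y = a k y * b (n - k) (th k y)"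
    for n k y
  proof -
    let ?u = "\<lambda>z. if z \<in> dm (- k) then a k (th (- k) z) else 0"
    have u: "paut_pow Y F G f (- k) (a k) = ?u"
      using L_coeff[OF a] by (simp add: paut_pow_eq)
    have uC: "?u \<in> C_van Y (dm (- k))"
      using C_van_dm_pullback[OF L_cont[OF a]] .
    have "(\<lambda>z. ?u z * b (n - k) z) \<in> C_van Y (dm (- k))"
      using C_van_cont[OF uC] L_cont[OF b] by (intro C_vanI continuous_intros) auto
    then have "paut_pow Y F G f k (\<lambda>z. ?u z * b (n - k) z) y
        = (if y \<in> dm k then ?u (th k y) * b (n - k) (th k y) else 0)"
      by (simp add: paut_pow_eq)
    also have "\<dots> = a k y * b (n - k) (th k y)"
      using th_inverse[of y k] L_zero_off[OF a] by auto
    finally show ?thesis by (simp add: u)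
  qed
  then show ?thesis by (simp add: l1_alg_def)
qed

lemma L_mult:
  "a \<in> carrier L \<Longrightarrow> b \<in> carrier L \<Longrightarrow> (a \<otimes>\<^bsub>L\<^esub> b) n y = (\<Sum>\<^sub>\<infinity>k. a k y * b (n - k) (th k y))"
  by (simp add: L_mult_fun)

lemma L_mult_bound:
  assumes "a \<in> carrier L" "b \<in> carrier L"
  shows "cmod (a k y * b m z) \<le> sup_norm (a k) * sup_norm (b m)"
  unfolding norm_mult using assms by (intro mult_mono L_le L_nonneg) auto

lemma L_mult_abs_summable:
  assumes "a \<in> carrier L" "b \<in> carrier L"
  shows "(\<lambda>k. cmod (a k y * b (n - k) (th k y))) summable_on UNIV"
    and "(\<lambda>k. a k y * b (n - k) (th k y)) summable_on UNIV"
proof -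
  show "(\<lambda>k. cmod (a k y * b (n - k) (th k y))) summable_on UNIV"
    by (rule Infinite_Sum.abs_summable_on_comparison_test'[OF summable_convolution_inner[OF
            L_summable[OF assms(1)] L_nonneg[OF assms(1)] L_summable[OF assms(2)] L_nonneg[OF assms(2)]]
          L_mult_bound[OF assms]])
  then show "(\<lambda>k. a k y * b (n - k) (th k y)) summable_on UNIV"
    by (rule abs_summable_summable)
qed

lemma
  assumes a: "a \<in> carrier L" and b: "b \<in> carrier L"
  shows L_mult_closed: "a \<otimes>\<^bsub>L\<^esub> b \<in> carrier L"
    and L_nrm_mult: "nrm L (a \<otimes>\<^bsub>L\<^esub> b) \<le> nrm L a * nrm L b"
proof -
  let ?M = "\<lambda>n. \<Sum>\<^sub>\<infinity>k. sup_norm (a k) * sup_norm (b (n - k))"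
  note conv = L_summable[OF a] L_nonneg[OF a] L_summable[OF b] L_nonneg[OF b]
  have bound: "cmod ((a \<otimes>\<^bsub>L\<^esub> b) n y) \<le> ?M n" for n y
  proof -
    have "cmod ((a \<otimes>\<^bsub>L\<^esub> b) n y) \<le> (\<Sum>\<^sub>\<infinity>k. cmod (a k y * b (n - k) (th k y)))"
      unfolding L_mult[OF a b] by (rule norm_infsum_bound[OF L_mult_abs_summable(1)[OF a b]])
    also have "\<dots> \<le> ?M n"
      by (intro infsum_mono L_mult_abs_summable(1)[OF a b] summable_convolution_inner[OF conv] L_mult_bound[OF a b])
    finally show ?thesis .
  qed
  have cont: "continuous_map Y euclidean ((a \<otimes>\<^bsub>L\<^esub> b) n)" for n
    unfolding L_mult_fun[OF a b]
  proof (rule continuous_map_uniform_limit_normed[OF _ Weierstrass_m_test_general])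
    show "(\<lambda>k. sup_norm (a k) * sup_norm (b (n - k))) summable_on UNIV"
      by (rule summable_convolution_inner[OF conv])
    show "cmod (a k y * b (n - k) (th k y)) \<le> sup_norm (a k) * sup_norm (b (n - k))" for k y
      by (rule L_mult_bound[OF a b])
    show "continuous_map Y euclidean (\<lambda>y. \<Sum>k\<in>K. a k y * b (n - k) (th k y))" for K
    proof (cases "finite K", intro continuous_map_sum)
      fix k
      \<comment> \<open>\<open>th k\<close> is continuous only on \<open>dm k\<close>. Replacing the
        second factor by its extension by zero changes nothing, as \<open>a k\<close> vanishes off
        \<open>dm k\<close>.\<close>
      have "(\<lambda>y. a k y * b (n - k) (th k y)) = (\<lambda>y. a k y * (if y \<in> dm k then b (n - k) (th k y) else 0))"
        using L_zero_off[OF a] by auto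
      moreover have "continuous_map Y euclidean (\<lambda>y. a k y * (if y \<in> dm k then b (n - k) (th k y) else 0))"
        using L_cont[OF a] C_van_cont[OF C_van_dm_pullback[OF L_cont[OF b]]] by (intro continuous_intros)
      ultimately show "continuous_map Y euclidean (\<lambda>y. a k y * b (n - k) (th k y))" by simp
    qed simp_all
  qed (auto simp: finite_subsets_at_top_neq_bot)
  have zero: "(a \<otimes>\<^bsub>L\<^esub> b) n y = 0" if y: "y \<notin> dm n" for n y
  proof -
    \<comment> \<open>If both factors were nonzero, \<open>th_comp\<close> would put
      \<open>y\<close> into \<open>dm n\<close>.\<close>
    have "a k y * b (n - k) (th k y) = 0" for k
      using L_zero_off[OF a, of y k] L_zero_off[OF b, of "th k y" "n - k"] th_comp(1)[of y k "n - k"] y by auto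
    then show ?thesis unfolding L_mult[OF a b] by (intro infsum_0)
  qed
  note * = L_carrierI[OF cont zero bound summable_convolution[OF conv]]
  show "a \<otimes>\<^bsub>L\<^esub> b \<in> carrier L" by (rule *(1))
  show "nrm L (a \<otimes>\<^bsub>L\<^esub> b) \<le> nrm L a * nrm L b"
    using *(2) by (simp add: nrm_L infsum_convolution[OF conv])
qed

text \<open>The two sums are interchanged and \<open>i = k - j\<close> is substituted. The partial
  law \<open>th k = th (k - j) \<circ> th j\<close> is applied only where the factors from
  \<open>a\<close> and \<open>b\<close> do not vanish.\<close>

lemma L_mult_assoc:
  assumes a: "a \<in> carrier L" and b: "b \<in> carrier L" and c: "c \<in> carrier L"
  shows "(a \<otimes>\<^bsub>L\<^esub> b) \<otimes>\<^bsub>L\<^esub> c = a \<otimes>\<^bsub>L\<^esub> (b \<otimes>\<^bsub>L\<^esub> c)"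
proof (intro ext)
  fix n y
  \<comment> \<open>Absolute summability for Fubini: the values of \<open>c\<close> are bounded by
    \<open>nrm L c\<close>, the other two factors by the summable convolution family.\<close>
  have abs: "(\<lambda>(k, j). a j y * b (k - j) (th j y) * c (n - k) (th k y)) summable_on UNIV \<times> UNIV"
  proof -
    have "(\<lambda>x. norm ((\<lambda>(k, j). a j y * b (k - j) (th j y) * c (n - k) (th k y)) x)) summable_on UNIV"
    proof (rule Infinite_Sum.abs_summable_on_comparison_test')
      show "(\<lambda>x. (\<lambda>(k, j). sup_norm (a j) * sup_norm (b (k - j))) x * nrm L c) summable_on UNIV"
        using summable_convolution_pair[OF L_summable[OF a] L_nonneg[OF a] L_summable[OF b] L_nonneg[OF b]]
        by (rule summable_on_cmult_left)
      fix x :: "int \<times> int"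
      have "sup_norm (c m) \<le> nrm L c" for m
        using finite_sum_le_infsum[OF L_summable[OF c], of "{m}"] L_nonneg[OF c] by (simp add: nrm_L)
      then have "cmod (c m z) \<le> nrm L c" for m z
        using L_le[OF c] order_trans by blast
      then show "norm ((\<lambda>(k, j). a j y * b (k - j) (th j y) * c (n - k) (th k y)) x)
          \<le> (\<lambda>(k, j). sup_norm (a j) * sup_norm (b (k - j))) x * nrm L c"
        by (cases x) (auto simp: norm_mult[of "_ * _"] intro!: mult_mono L_mult_bound[OF a b]
            mult_nonneg_nonneg L_nonneg[OF a] L_nonneg[OF b] simp del: norm_mult)
    qed
    then show ?thesis using abs_summable_summable by (simp only: UNIV_Times_UNIV)
  qed
  have "((a \<otimes>\<^bsub>L\<^esub> b) \<otimes>\<^bsub>L\<^esub> c) n y = (\<Sum>\<^sub>\<infinity>k. (\<Sum>\<^sub>\<infinity>j. a j y * b (k - j) (th j y)) * c (n - k) (th k y))"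
    by (simp add: L_mult[OF L_mult_closed[OF a b] c] L_mult[OF a b])
  also have "\<dots> = (\<Sum>\<^sub>\<infinity>k. \<Sum>\<^sub>\<infinity>j. a j y * b (k - j) (th j y) * c (n - k) (th k y))"
    by (simp add: infsum_cmult_left')
  also have "\<dots> = (\<Sum>\<^sub>\<infinity>j. \<Sum>\<^sub>\<infinity>k. a j y * b (k - j) (th j y) * c (n - k) (th k y))"
    using infsum_swap_banach[OF abs] .
  also have "\<dots> = (\<Sum>\<^sub>\<infinity>j. \<Sum>\<^sub>\<infinity>k. a j y * (b (k - j) (th j y) * c (n - j - (k - j)) (th (k - j) (th j y))))"
  proof (intro infsum_cong)
    fix j k
    show "a j y * b (k - j) (th j y) * c (n - k) (th k y)
        = a j y * (b (k - j) (th j y) * c (n - j - (k - j)) (th (k - j) (th j y)))"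
      using L_zero_off[OF a, of y j] L_zero_off[OF b, of "th j y" "k - j"] th_comp(2)[of y j "k - j"]
      by (cases "y \<in> dm j \<and> th j y \<in> dm (k - j)") auto
  qed
  also have "\<dots> = (\<Sum>\<^sub>\<infinity>j. \<Sum>\<^sub>\<infinity>i. a j y * (b i (th j y) * c (n - j - i) (th i (th j y))))"
  proof (rule infsum_cong)
    fix j :: int
    have bij: "bij_betw (\<lambda>k. k - j) UNIV UNIV"
      by (rule bij_betw_byWitness[where f' = "\<lambda>i. i + j"]) auto
    show "(\<Sum>\<^sub>\<infinity>k. a j y * (b (k - j) (th j y) * c (n - j - (k - j)) (th (k - j) (th j y))))
        = (\<Sum>\<^sub>\<infinity>i. a j y * (b i (th j y) * c (n - j - i) (th i (th j y))))"
      using infsum_reindex_bij_betw[OF bij, of "\<lambda>i. a j y * (b i (th j y) * c (n - j - i) (th i (th j y)))"] .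
  qed
  also have "\<dots> = (a \<otimes>\<^bsub>L\<^esub> (b \<otimes>\<^bsub>L\<^esub> c)) n y"
    by (simp add: L_mult[OF a L_mult_closed[OF b c]] L_mult[OF b c] infsum_cmult_right')
  finally show "((a \<otimes>\<^bsub>L\<^esub> b) \<otimes>\<^bsub>L\<^esub> c) n y = (a \<otimes>\<^bsub>L\<^esub> (b \<otimes>\<^bsub>L\<^esub> c)) n y" .
qed

section \<open>Monomials, the unit and the involution\<close>

lemma infsum_single: "(\<And>k. k \<noteq> i \<Longrightarrow> h k = 0) \<Longrightarrow> (\<Sum>\<^sub>\<infinity>k\<in>UNIV. h k) = (h i :: complex)"
  by (subst infsum_cong_neutral[of "{i}" UNIV h h]) auto

text \<open>The element usually written \<open>h u^m\<close>. For \<open>m = 0\<close> it is the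
  embedded function \<open>h\<close>; for \<open>h\<close> the indicator of \<open>dm m\<close> it
  is the partial isometry \<open>u^m\<close>.\<close>

definition monomial :: "int \<Rightarrow> ('y \<Rightarrow> complex) \<Rightarrow> int \<Rightarrow> 'y \<Rightarrow> complex" where
  "monomial m h = (\<lambda>n y. if n = m then h y else 0)"

lemma monomial_closed:
  assumes h: "h \<in> C_van Y (dm m)"
  shows "monomial m h \<in> carrier L" "nrm L (monomial m h) \<le> sup_norm h"
proof -
  let ?M = "\<lambda>n. if n = m then sup_norm h else 0"
  have s: "?M summable_on UNIV"
    by (rule finite_nonzero_values_imp_summable_on) simp
  have 1: "continuous_map Y euclidean (monomial m h n)" for n
    using C_van_cont[OF h] by (cases "n = m") (simp_all add: monomial_def)
  have 2: "monomial m h n y = 0" if "y \<notin> dm n" for n y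
    using C_van_zero[OF h] that by (auto simp: monomial_def)
  have 3: "cmod (monomial m h n y) \<le> ?M n" for n y
    using cmod_le_sup_norm[OF h dm_subset] by (simp add: monomial_def)
  note * = L_carrierI[OF 1 2 3 s]
  have "infsum ?M UNIV = sup_norm h"
    by (subst infsum_cong_neutral[of "{m}" UNIV ?M ?M]) auto
  then show "monomial m h \<in> carrier L" "nrm L (monomial m h) \<le> sup_norm h"
    using * by simp_all
qed

lemma monomial_mult:
  assumes h: "h \<in> C_van Y (dm m)" and b: "b \<in> carrier L"
  shows "monomial m h \<otimes>\<^bsub>L\<^esub> b = (\<lambda>n y. h y * b (n - m) (th m y))"
  unfolding L_mult_fun[OF monomial_closed(1)[OF h] b]
proof (intro ext)
  fix n y
  show "(\<Sum>\<^sub>\<infinity>k. monomial m h k y * b (n - k) (th k y)) = h y * b (n - m) (th m y)"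
    by (subst infsum_single[of m]) (auto simp: monomial_def)
qed

lemma mult_monomial:
  assumes h: "h \<in> C_van Y (dm m)" and b: "b \<in> carrier L"
  shows "b \<otimes>\<^bsub>L\<^esub> monomial m h = (\<lambda>n y. b (n - m) y * h (th (n - m) y))"
  unfolding L_mult_fun[OF b monomial_closed(1)[OF h]]
proof (intro ext)
  fix n y
  show "(\<Sum>\<^sub>\<infinity>k. b k y * monomial m h (n - k) (th k y)) = b (n - m) y * h (th (n - m) y)"
    by (subst infsum_single[of "n - m"]) (auto simp: monomial_def)
qed

definition unit_on :: "'y set \<Rightarrow> 'y \<Rightarrow> complex" where
  "unit_on K = (\<lambda>y. if y \<in> K then 1 else 0)"

text \<open>The indicator is continuous because \<open>dm m\<close> is clopen; this puts the partial
  isometries into the algebra.\<close>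

lemma unit_on_dm: "unit_on (dm m) \<in> C_van Y (dm m)"
  using C_van_dm_pullback[of "\<lambda>_. 1" m] by (simp add: unit_on_def)

lemma L_one: "\<one>\<^bsub>L\<^esub> = monomial 0 (unit_on (dm 0))"
  by (auto simp: L_simps monomial_def unit_on_def fun_eq_iff)

lemma L_adj_fun: "a \<in> carrier L \<Longrightarrow> adj L a = (\<lambda>n y. if y \<in> dm n then cnj (a (- n) (th n y)) else 0)"
proof -
  assume a: "a \<in> carrier L"
  have "(\<lambda>y. cnj (a (- n) y)) \<in> C_van Y (dm (- n))" for n
    using L_coeff[OF a, of "- n"]
    by (auto simp: C_van_def intro: continuous_intros)
  then show ?thesis by (simp add: l1_alg_def paut_pow_eq)
qed

lemma L_adj: "a \<in> carrier L \<Longrightarrow> adj L a n y = (if y \<in> dm n then cnj (a (- n) (th n y)) else 0)"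
  by (simp add: L_adj_fun)

lemma
  assumes a: "a \<in> carrier L"
  shows L_adj_closed: "adj L a \<in> carrier L" and L_nrm_adj: "nrm L (adj L a) \<le> nrm L a"
proof -
  have bij: "bij_betw uminus UNIV (UNIV :: int set)"
    by (rule bij_betw_byWitness[where f' = uminus]) auto
  have s: "(\<lambda>n. sup_norm (a (- n))) summable_on UNIV"
    using L_summable[OF a] summable_on_reindex_bij_betw[OF bij, of "\<lambda>n. sup_norm (a n)"] by simp
  have 1: "continuous_map Y euclidean (adj L a n)" for n
    unfolding L_adj_fun[OF a] using L_cont[OF a]
    by (intro C_van_cont[OF C_van_dm_pullback[of "\<lambda>y. cnj (a (- n) y)"]] continuous_intros) auto
  have 2: "adj L a n y = 0" if "y \<notin> dm n" for n y
    using that by (simp add: L_adj[OF a])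
  have 3: "cmod (adj L a n y) \<le> sup_norm (a (- n))" for n y
    using L_le[OF a] L_nonneg[OF a] by (simp add: L_adj[OF a])
  note * = L_carrierI[OF 1 2 3 s]
  show "adj L a \<in> carrier L" by (rule *(1))
  show "nrm L (adj L a) \<le> nrm L a"
    using *(2) infsum_reindex_bij_betw[OF bij, of "\<lambda>n. sup_norm (a n)"] by (simp add: nrm_L)
qed

lemma L_adj_mult:
  assumes a: "a \<in> carrier L" and b: "b \<in> carrier L"
  shows "adj L (a \<otimes>\<^bsub>L\<^esub> b) = adj L b \<otimes>\<^bsub>L\<^esub> adj L a"
proof (intro ext)
  fix n y
  have *: "(adj L b \<otimes>\<^bsub>L\<^esub> adj L a) n y = (\<Sum>\<^sub>\<infinity>j. adj L b j y * adj L a (n - j) (th j y))"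
    using a b by (simp add: L_mult L_adj_closed)
  show "adj L (a \<otimes>\<^bsub>L\<^esub> b) n y = (adj L b \<otimes>\<^bsub>L\<^esub> adj L a) n y"
  proof (cases "y \<in> dm n")
    case False
    then have "adj L b j y * adj L a (n - j) (th j y) = 0" for j
      using th_comp(1)[of y j "n - j"] by (auto simp: L_adj a b)
    then have "(adj L b \<otimes>\<^bsub>L\<^esub> adj L a) n y = 0" unfolding * by (intro infsum_0)
    then show ?thesis using False by (simp only: L_adj[OF L_mult_closed[OF a b]] if_False)
  next
    case True
    \<comment> \<open>On the right the factor from \<open>b\<close> has degree
      \<open>j = n + k\<close>, where \<open>k\<close> is the degree of \<open>a\<close> at the
      shifted point \<open>th n y\<close>.\<close>
    have bij: "bij_betw (\<lambda>k. n + k) UNIV (UNIV :: int set)"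
      by (rule bij_betw_byWitness[where f' = "\<lambda>k. k - n"]) auto
    have "adj L (a \<otimes>\<^bsub>L\<^esub> b) n y = (\<Sum>\<^sub>\<infinity>k. cnj (a k (th n y) * b (- n - k) (th k (th n y))))"
      using True by (simp add: L_adj L_mult_closed L_mult a b flip: infsum_cnj)
    also have "\<dots> = (\<Sum>\<^sub>\<infinity>k. adj L b (n + k) y * adj L a (n - (n + k)) (th (n + k) y))"
    proof (rule infsum_cong)
      fix k
      show "cnj (a k (th n y) * b (- n - k) (th k (th n y)))
          = adj L b (n + k) y * adj L a (n - (n + k)) (th (n + k) y)"
      proof (cases "th n y \<in> dm k")
        case th: True
        note c = th_comp[OF True th]
        have "th (n + k) y \<in> dm (- k)" "th (- k) (th (n + k) y) = th n y"
          using th_inverse[OF th] c by simp_all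
        then show ?thesis using c by (simp add: L_adj a b mult.commute)
      next
        case False
        \<comment> \<open>If \<open>th k\<close> is undefined at \<open>th n y\<close>, then
          \<open>th (n + k)\<close> is undefined at \<open>y\<close>, and both sides are 0.\<close>
        then have "y \<notin> dm (n + k)" using th_restart(1)[OF True, of k] by blast
        then show ?thesis using False by (simp add: L_adj a b L_zero_off[OF a])
      qed
    qed
    also have "\<dots> = (\<Sum>\<^sub>\<infinity>j. adj L b j y * adj L a (n - j) (th j y))"
      using infsum_reindex_bij_betw[OF bij, of "\<lambda>j. adj L b j y * adj L a (n - j) (th j y)"] .
    finally show ?thesis by (simp add: *)
  qed
qed

lemma L_add_closed:
  assumes a: "a \<in> carrier L" and b: "b \<in> carrier L"
  shows "a \<oplus>\<^bsub>L\<^esub> b \<in> carrier L"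
proof (rule L_carrierI(1))
  show "(\<lambda>n. sup_norm (a n) + sup_norm (b n)) summable_on UNIV"
    by (intro summable_on_add L_summable a b)
  show "cmod ((a \<oplus>\<^bsub>L\<^esub> b) n y) \<le> sup_norm (a n) + sup_norm (b n)" for n y
    using norm_triangle_le[OF add_mono[OF L_le[OF a] L_le[OF b]]] by (simp add: L_simps)
  show "continuous_map Y euclidean ((a \<oplus>\<^bsub>L\<^esub> b) n)" for n
    unfolding L_ops using L_cont[OF a] L_cont[OF b] by (intro continuous_intros)
qed (simp add: L_simps L_zero_off a b)

lemma L_smult_closed:
  assumes a: "a \<in> carrier L"
  shows "c \<odot>\<^bsub>L\<^esub> a \<in> carrier L"
proof (rule L_carrierI(1))
  show "(\<lambda>n. cmod c * sup_norm (a n)) summable_on UNIV"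
    by (intro summable_on_cmult_right L_summable a)
  show "cmod ((c \<odot>\<^bsub>L\<^esub> a) n y) \<le> cmod c * sup_norm (a n)" for n y
    using L_le[OF a] by (simp add: L_simps norm_mult mult_left_mono)
  show "continuous_map Y euclidean ((c \<odot>\<^bsub>L\<^esub> a) n)" for n
    unfolding L_ops using L_cont[OF a] by (intro continuous_intros) auto
qed (simp add: L_simps L_zero_off a)

section \<open>The algebra axioms and the bound on coefficients\<close>

lemma ring_L: "ring L"
proof (rule ringI)
  show "abelian_group L"
  proof (rule abelian_groupI)
    fix a assume "a \<in> carrier L"
    then show "\<exists>b\<in>carrier L. b \<oplus>\<^bsub>L\<^esub> a = \<zero>\<^bsub>L\<^esub>"
      by (intro bexI[of _ "(-1) \<odot>\<^bsub>L\<^esub> a"] L_smult_closed) (simp add: L_ops)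
  next
    show "\<zero>\<^bsub>L\<^esub> \<in> carrier L"
      using L_smult_closed[OF monomial_closed(1)[OF unit_on_dm], of 0] by (simp add: L_ops)
  qed (simp add: L_add_closed, simp_all add: L_ops add_ac)
  show "monoid L"
  proof (rule monoidI)
    fix a assume a: "a \<in> carrier L"
    show "\<one>\<^bsub>L\<^esub> \<otimes>\<^bsub>L\<^esub> a = a"
      unfolding L_one monomial_mult[OF unit_on_dm a]
      using L_zero_off[OF a] dm_subset by (auto simp: unit_on_def fun_eq_iff subset_iff)
    show "a \<otimes>\<^bsub>L\<^esub> \<one>\<^bsub>L\<^esub> = a"
      unfolding L_one mult_monomial[OF unit_on_dm a]
      using L_zero_off[OF a] th_mem by (auto simp: unit_on_def fun_eq_iff)
  qed (simp_all add: L_mult_closed L_mult_assoc L_one monomial_closed unit_on_dm del: dm_0)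
  fix a b c assume abc: "a \<in> carrier L" "b \<in> carrier L" "c \<in> carrier L"
  have add: "(a \<oplus>\<^bsub>L\<^esub> b) n y = a n y + b n y" for a b n y by (simp add: L_simps)
  show "(a \<oplus>\<^bsub>L\<^esub> b) \<otimes>\<^bsub>L\<^esub> c = a \<otimes>\<^bsub>L\<^esub> c \<oplus>\<^bsub>L\<^esub> b \<otimes>\<^bsub>L\<^esub> c"
    by (intro ext) (simp add: add L_mult abc L_add_closed distrib_right infsum_add L_mult_abs_summable)
  show "c \<otimes>\<^bsub>L\<^esub> (a \<oplus>\<^bsub>L\<^esub> b) = c \<otimes>\<^bsub>L\<^esub> a \<oplus>\<^bsub>L\<^esub> c \<otimes>\<^bsub>L\<^esub> b"
    by (intro ext) (simp add: add L_mult abc L_add_closed distrib_left infsum_add L_mult_abs_summable)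
qed

sublocale L: normed_star_alg L
proof (intro normed_star_alg.intro ring_L normed_star_alg_axioms.intro)
  fix a b and c d :: complex assume a: "a \<in> carrier L"
  have sm: "(c \<odot>\<^bsub>L\<^esub> a) n y = c * a n y" for a c n y by (simp add: L_simps)
  show "c \<odot>\<^bsub>L\<^esub> a \<in> carrier L" by (rule L_smult_closed[OF a])
  show "adj L a \<in> carrier L" by (rule L_adj_closed[OF a])
  show "adj L (c \<odot>\<^bsub>L\<^esub> a) = cnj c \<odot>\<^bsub>L\<^esub> adj L a"
    using a by (auto simp: L_adj L_smult_closed L_simps fun_eq_iff)
  show "adj L (adj L a) = a"
    using a th_inverse by (auto simp: L_adj L_adj_closed L_zero_off fun_eq_iff)
  show "0 \<le> nrm L a" unfolding nrm_L using L_nonneg[OF a] by (rule infsum_nonneg)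
  show "nrm L (adj L a) \<le> nrm L a" by (rule L_nrm_adj[OF a])
  show "(c + d) \<odot>\<^bsub>L\<^esub> a = c \<odot>\<^bsub>L\<^esub> a \<oplus>\<^bsub>L\<^esub> d \<odot>\<^bsub>L\<^esub> a" "c \<odot>\<^bsub>L\<^esub> (d \<odot>\<^bsub>L\<^esub> a) = (c * d) \<odot>\<^bsub>L\<^esub> a"
    "1 \<odot>\<^bsub>L\<^esub> a = a"
    by (simp_all add: L_ops algebra_simps)
  assume b: "b \<in> carrier L"
  show "(c \<odot>\<^bsub>L\<^esub> a) \<otimes>\<^bsub>L\<^esub> b = c \<odot>\<^bsub>L\<^esub> (a \<otimes>\<^bsub>L\<^esub> b)"
    by (intro ext) (simp add: sm L_mult L_smult_closed a b mult.assoc infsum_cmult_right')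
  show "a \<otimes>\<^bsub>L\<^esub> (c \<odot>\<^bsub>L\<^esub> b) = c \<odot>\<^bsub>L\<^esub> (a \<otimes>\<^bsub>L\<^esub> b)"
    by (intro ext) (simp add: sm L_mult L_smult_closed a b mult.left_commute infsum_cmult_right')
  show "adj L (a \<oplus>\<^bsub>L\<^esub> b) = adj L a \<oplus>\<^bsub>L\<^esub> adj L b"
    using a b by (auto simp: L_adj L_add_closed L_simps fun_eq_iff)
  show "adj L (a \<otimes>\<^bsub>L\<^esub> b) = adj L b \<otimes>\<^bsub>L\<^esub> adj L a" by (rule L_adj_mult[OF a b])
  show "nrm L (a \<otimes>\<^bsub>L\<^esub> b) \<le> nrm L a * nrm L b" by (rule L_nrm_mult[OF a b])
qed

lemma L_uminus: "a \<in> carrier L \<Longrightarrow> \<ominus>\<^bsub>L\<^esub> a = (\<lambda>n y. - a n y)"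
  using L.smult_minus_one[of a] by (simp add: L_ops)

lemma L_minus: "b \<in> carrier L \<Longrightarrow> a \<ominus>\<^bsub>L\<^esub> b = (\<lambda>n y. a n y - b n y)"
  by (simp add: a_minus_def L_uminus L_ops)

text \<open>The vector states of the regular representation bound the coefficients.\<close>

lemma cmod_le_env_norm:
  assumes a: "a \<in> carrier L"
  shows "cmod (a n z) \<le> env_norm L a"
proof (cases "z \<in> dm n")
  case False
  then show ?thesis using L_zero_off[OF a] L.env_norm_nonneg[OF a] by simp
next
  case True
  \<comment> \<open>With the base point moved to \<open>th n z\<close>, the number
    \<open>|a n z|^2\<close> becomes the term of index \<open>- n\<close> in the squared length
    computed next.\<close>
  define y where "y = th n z"
  have y: "y \<in> dm (- n)" "th (- n) y = z" using th_inverse[OF True] by (simp_all add: y_def)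
  have yY: "y \<in> topspace Y" using y dm_subset by blast
  \<comment> \<open>This is the squared length of the image of the basis vector at \<open>y\<close>
    under \<open>x\<close>, in the regular representation along the orbit of
    \<open>y\<close>.\<close>
  have sq: "(adj L x \<otimes>\<^bsub>L\<^esub> x) 0 y = complex_of_real (\<Sum>\<^sub>\<infinity>k. if y \<in> dm k then (cmod (x (- k) (th k y)))\<^sup>2 else 0)"
    and summ: "(\<lambda>k. if y \<in> dm k then (cmod (x (- k) (th k y)))\<^sup>2 else 0) summable_on UNIV"
    if x: "x \<in> carrier L" for x
  proof -
    have eq: "adj L x k y * x (0 - k) (th k y)
        = complex_of_real (if y \<in> dm k then (cmod (x (- k) (th k y)))\<^sup>2 else 0)" for k
      by (simp add: L_adj[OF x] complex_norm_square mult.commute del: of_real_power)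
    have "(\<lambda>k. complex_of_real (if y \<in> dm k then (cmod (x (- k) (th k y)))\<^sup>2 else 0)) summable_on UNIV"
      using L_mult_abs_summable(2)[OF L_adj_closed[OF x] x, of y 0] unfolding eq .
    from summable_on_Re[OF this]
    show s: "(\<lambda>k. if y \<in> dm k then (cmod (x (- k) (th k y)))\<^sup>2 else 0) summable_on UNIV" by simp
    show "(adj L x \<otimes>\<^bsub>L\<^esub> x) 0 y = complex_of_real (\<Sum>\<^sub>\<infinity>k. if y \<in> dm k then (cmod (x (- k) (th k y)))\<^sup>2 else 0)"
      unfolding L_mult[OF L_adj_closed[OF x] x] eq
      using infsumI[OF has_sum_of_real[OF has_sum_infsum[OF s]]] .
  qed
  interpret W: positive_functional L "\<lambda>x. x 0 y"
  proof
    fix x assume x: "x \<in> carrier L"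
    show "adj L x 0 y = cnj (x 0 y)" using yY by (simp add: L_adj[OF x])
    show "0 \<le> Re ((adj L x \<otimes>\<^bsub>L\<^esub> x) 0 y)" by (simp add: sq[OF x] infsum_nonneg)
    have "cmod (x 0 y) \<le> sup_norm (x 0)" by (rule L_le[OF x])
    also have "\<dots> \<le> nrm L x"
      using finite_sum_le_infsum[OF L_summable[OF x], of "{0}"] L_nonneg[OF x] by (simp add: nrm_L)
    finally show "cmod (x 0 y) \<le> nrm L x" .
  qed (simp_all add: L_simps)
  have "(cmod (a n z))\<^sup>2 \<le> (\<Sum>\<^sub>\<infinity>k. if y \<in> dm k then (cmod (a (- k) (th k y)))\<^sup>2 else 0)"
    using finite_sum_le_infsum[OF summ[OF a], of "{- n}"] y by simp
  also have "\<dots> \<le> (env_norm L a)\<^sup>2"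
    using W.omega_sq_le_env_norm_sq[OF a] by (simp add: sq[OF a] L_simps)
  finally show ?thesis
    using L.env_norm_nonneg[OF a] power2_le_imp_le by blast
qed

end

section \<open>Coefficient multipliers and Fejer means\<close>

text \<open>Dominated convergence for series. The bound 2 is the one that holds for
  \<open>|1 - w|\<close> when \<open>|w| \<le> 1\<close>, the form of the weights in
  \<open>wt_tendsto\<close>.\<close>

lemma tendsto_infsum_weights:
  fixes u :: "int \<Rightarrow> real"
  assumes u: "u summable_on UNIV" "\<And>n. 0 \<le> u n"
    and v: "\<And>N n. 0 \<le> v N n" "\<And>N n. v N n \<le> 2" "\<And>n. (\<lambda>N. v N n) \<longlonglongrightarrow> 0"
  shows "(\<lambda>N::nat. \<Sum>\<^sub>\<infinity>n. v N n * u n) \<longlonglongrightarrow> 0"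
proof (rule LIMSEQ_I)
  fix e :: real assume e: "e > 0"
  have "(u has_sum infsum u UNIV) UNIV" using u by simp
  \<comment> \<open>Outside \<open>S\<close> the weights are at most 2, so the tail contributes at
    most \<open>e / 4\<close>; the finite part will stay below \<open>e / 2\<close>.\<close>
  then obtain S where S: "finite S" "dist (sum u S) (infsum u UNIV) \<le> e / 8"
    using has_sum_finite_approximation[of u UNIV "infsum u UNIV" "e / 8"] e by auto
  have sub: "u summable_on B" for B
    using u(1) by (rule summable_on_subset_banach) simp
  have "infsum u UNIV = sum u S + infsum u (- S)"
    using infsum_Un_disjoint[of u S "- S"] S sub by (simp add: Compl_partition)
  then have tail: "infsum u (- S) \<le> e / 8"
    using S(2) by (simp add: dist_real_def)
  have "(\<lambda>N. \<Sum>n\<in>S. v N n * u n) \<longlonglongrightarrow> (\<Sum>n\<in>S. 0 * u n)"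
    by (intro tendsto_sum tendsto_mult v tendsto_const)
  then obtain N0 where N0: "\<And>N. N \<ge> N0 \<Longrightarrow> \<bar>\<Sum>n\<in>S. v N n * u n\<bar> < e / 2"
    using e LIMSEQ_D[of "\<lambda>N. \<Sum>n\<in>S. v N n * u n" 0 "e / 2"] by auto
  have "\<bar>\<Sum>\<^sub>\<infinity>n. v N n * u n\<bar> < e" if N: "N \<ge> N0" for N
  proof -
    have le: "v N n * u n \<le> 2 * u n" "0 \<le> v N n * u n" for n
      using u v by (auto intro: mult_right_mono)
    have s2: "(\<lambda>n. 2 * u n) summable_on B" for B
      using sub by (rule summable_on_cmult_right)
    have s: "(\<lambda>n. v N n * u n) summable_on B" for B
      using le by (intro summable_on_comparison_test[OF s2])
    have "(\<Sum>\<^sub>\<infinity>n. v N n * u n) = (\<Sum>n\<in>S. v N n * u n) + (\<Sum>\<^sub>\<infinity>n\<in>-S. v N n * u n)"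
      using infsum_Un_disjoint[of "\<lambda>n. v N n * u n" S "- S"] S s by (simp add: Compl_partition)
    also have "(\<Sum>\<^sub>\<infinity>n\<in>-S. v N n * u n) \<le> (\<Sum>\<^sub>\<infinity>n\<in>-S. 2 * u n)"
      using le by (intro infsum_mono s s2)
    also have "\<dots> = 2 * infsum u (- S)" by (simp add: infsum_cmult_right')
    finally have "(\<Sum>\<^sub>\<infinity>n. v N n * u n) < e"
      using N0[OF N] tail e by linarith
    moreover have "0 \<le> (\<Sum>\<^sub>\<infinity>n. v N n * u n)" using le by (intro infsum_nonneg)
    ultimately show ?thesis by simp
  qed
  then show "\<exists>no. \<forall>N\<ge>no. norm ((\<Sum>\<^sub>\<infinity>n. v N n * u n) - 0) < e" by auto
qed

text \<open>Orthogonality of characters of the cyclic group of order \<open>K\<close>. The sum is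
  geometric with ratio a \<open>K\<close>-th root of unity, which is 1 only if \<open>K\<close>
  divides \<open>m\<close>; the bound on \<open>m\<close> then leaves \<open>m = 0\<close>.\<close>

lemma sum_cis_roots:
  fixes m :: int
  assumes "\<bar>m\<bar> < int K"
  shows "(\<Sum>r<K. cis (of_int m * (real r * (2 * pi / K)))) = (if m = 0 then of_nat K else 0)"
proof (cases "m = 0")
  case False
  define z where "z = cis (of_int m * (2 * pi / K))"
  have K: "K > 0" using assms by simp
  have "cis (of_int m * (real r * (2 * pi / K))) = z ^ r" for r
    unfolding z_def Complex.DeMoivre by (rule arg_cong[of _ _ cis]) simp
  moreover have "z ^ K = 1"
  proof -
    have "z ^ K = cis (real K * (of_int m * (2 * pi / K)))" by (simp only: z_def Complex.DeMoivre)
    also have "real K * (of_int m * (2 * pi / K)) = 2 * pi * of_int m" using K by simp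
    also have "cis (2 * pi * of_int m) = 1" by (rule cis_multiple_2pi) simp
    finally show ?thesis .
  qed
  moreover have "z \<noteq> 1"
  proof
    assume "z = 1"
    then have "cos (of_int m * (2 * pi / K)) = 1" by (simp add: z_def complex_eq_iff)
    then obtain n :: int where "of_int m * (2 * pi / K) = of_int n * 2 * pi"
      using cos_one_2pi_int by blast
    then have "real_of_int m = real_of_int (n * int K)" using K by (simp add: field_simps)
    then have "m = n * int K" by (simp only: of_int_eq_iff)
    then show False using dvd_imp_le_int[of m "int K"] assms False by simp
  qed
  ultimately show ?thesis using False by (simp add: sum_gp_strict)
qed simp

text \<open>The coefficients of \<open>|1 + z + ... + z^(N-1)|^2 / N\<close>, in the form obtained
  by multiplying out the square; this form shows the positivity of the kernel. For
  \<open>N = 0\<close> the value is 0.\<close>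

definition fejer :: "nat \<Rightarrow> int \<Rightarrow> complex" where
  "fejer N n = (\<Sum>i<N. \<Sum>j<N. if int i - int j + n = 0 then 1 else 0) / of_nat N"

lemma fejer_eq: "fejer N n = of_nat (nat (int N - \<bar>n\<bar>)) / of_nat N"
proof -
  have "(\<Sum>j<N. if int i - int j + n = 0 then 1 else 0 :: complex) = (if 0 \<le> int i + n \<and> int i + n < int N then 1 else 0)" for i
  proof -
    have "(\<Sum>j<N. if int i - int j + n = 0 then 1 else 0 :: complex)
        = (\<Sum>j<N. if j = nat (int i + n) then (if 0 \<le> int i + n then 1 else 0) else 0)"
      by (intro sum.cong) auto
    then show ?thesis by (simp add: sum.delta) auto
  qed
  then have "(\<Sum>i<N. \<Sum>j<N. if int i - int j + n = 0 then 1 else 0 :: complex)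
      = (\<Sum>i<N. if 0 \<le> int i + n \<and> int i + n < int N then 1 else 0)" by simp
  also have "\<dots> = of_nat (card {i \<in> {..<N}. 0 \<le> int i + n \<and> int i + n < int N})"
    by (simp add: sum.If_cases Int_def)
  also have "{i \<in> {..<N}. 0 \<le> int i + n \<and> int i + n < int N} = {nat (- n)..<min N (nat (int N - n))}"
    by auto
  also have "card \<dots> = nat (int N - \<bar>n\<bar>)" by auto
  finally show ?thesis by (simp add: fejer_def)
qed

lemma fejer_bound: "cmod (fejer N n) \<le> 1"
proof -
  have "real (nat (int N - \<bar>n\<bar>)) \<le> real N" by linarith
  then show ?thesis by (auto simp: fejer_eq norm_divide divide_le_eq_1)
qed

lemma fejer_eq_0: "int N \<le> \<bar>n\<bar> \<Longrightarrow> fejer N n = 0"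
  by (simp add: fejer_eq)

lemma fejer_tendsto: "(\<lambda>N. fejer N n) \<longlonglongrightarrow> 1"
proof -
  have "(\<lambda>N. 1 - complex_of_real (\<bar>of_int n\<bar> * inverse (real N))) \<longlonglongrightarrow> 1 - complex_of_real (\<bar>of_int n\<bar> * 0)"
    by (intro tendsto_intros LIMSEQ_inverse_real_of_nat[THEN LIMSEQ_imp_Suc])
  moreover have "\<forall>\<^sub>F N in sequentially. 1 - complex_of_real (\<bar>of_int n\<bar> * inverse (real N)) = fejer N n"
  proof (rule eventually_sequentiallyI)
    fix N assume N: "N \<ge> nat \<bar>n\<bar> + 1"
    then have "real (nat (int N - \<bar>n\<bar>)) = real N - \<bar>of_int n\<bar>" by simp
    moreover have "fejer N n = complex_of_real (real (nat (int N - \<bar>n\<bar>)) / real N)"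
      by (simp add: fejer_eq)
    moreover have "(real N - \<bar>of_int n\<bar>) / real N = 1 - \<bar>of_int n\<bar> * inverse (real N)"
      using N by (simp add: field_simps)
    ultimately show "1 - complex_of_real (\<bar>of_int n\<bar> * inverse (real N)) = fejer N n"
      by simp
  qed
  ultimately show ?thesis by (simp add: tendsto_cong)
qed

text \<open>Sampling the Fejer kernel at the \<open>K\<close>-th roots of unity; the sampling is exact in degrees
  below \<open>K - N\<close>.\<close>

lemma fejer_sample:
  assumes "\<bar>n\<bar> + int N \<le> int K" "N > 0"
  shows "fejer N n = (\<Sum>r<K. complex_of_real ((cmod (\<Sum>i<N. cis (real i * (real r * (2 * pi / K)))))\<^sup>2 / (real K * real N))
      * cis (of_int n * (real r * (2 * pi / K))))"
proof -
  let ?t = "\<lambda>r. real r * (2 * pi / K)"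
  have K: "K > 0" using assms by simp
  have sq: "complex_of_real ((cmod (\<Sum>i<N. cis (real i * t)))\<^sup>2) * cis (of_int n * t)
      = (\<Sum>i<N. \<Sum>j<N. cis (of_int (int i - int j + n) * t))" for t
  proof -
    have "complex_of_real ((cmod (\<Sum>i<N. cis (real i * t)))\<^sup>2)
        = (\<Sum>i<N. \<Sum>j<N. cis (real i * t) * cis (- (real j * t)))"
      by (simp only: complex_norm_square cnj_sum cis_cnj sum_product)
    then have "complex_of_real ((cmod (\<Sum>i<N. cis (real i * t)))\<^sup>2) * cis (of_int n * t)
        = (\<Sum>i<N. \<Sum>j<N. cis (real i * t) * cis (- (real j * t)) * cis (of_int n * t))"
      by (simp only: sum_distrib_right)
    then show ?thesis
      unfolding cis_mult by (simp only:) (intro sum.cong refl arg_cong[of _ _ cis], simp add: algebra_simps)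
  qed
  have "(\<Sum>r<K. complex_of_real ((cmod (\<Sum>i<N. cis (real i * ?t r)))\<^sup>2 / (real K * real N)) * cis (of_int n * ?t r))
      = (\<Sum>r<K. complex_of_real ((cmod (\<Sum>i<N. cis (real i * ?t r)))\<^sup>2) * cis (of_int n * ?t r)) / (of_nat K * of_nat N)"
    by (simp add: sum_divide_distrib)
  also have "\<dots> = (\<Sum>r<K. \<Sum>i<N. \<Sum>j<N. cis (of_int (int i - int j + n) * ?t r)) / (of_nat K * of_nat N)"
    by (simp only: sq)
  also have "(\<Sum>r<K. \<Sum>i<N. \<Sum>j<N. cis (of_int (int i - int j + n) * ?t r))
      = (\<Sum>i<N. \<Sum>j<N. \<Sum>r<K. cis (of_int (int i - int j + n) * ?t r))"
    by (subst sum.swap, rule sum.cong[OF refl]) (rule sum.swap)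
  \<comment> \<open>The degree \<open>int i - int j + n\<close> has modulus at most
    \<open>N - 1 + |n|\<close>, which is less than \<open>K\<close>, so orthogonality
    applies.\<close>
  also have "\<dots> = (\<Sum>i<N. \<Sum>j<N. if int i - int j + n = 0 then of_nat K else 0)"
    using assms by (intro sum.cong refl sum_cis_roots) auto
  also have "\<dots> = of_nat K * (\<Sum>i<N. \<Sum>j<N. if int i - int j + n = 0 then 1 else 0)"
    by (simp add: sum_distrib_left if_distrib[of "\<lambda>x. _ * x"] cong: if_cong)
  finally show ?thesis using K by (simp add: fejer_def)
qed

context partial_homeo
begin

section \<open>Multipliers, the dual circle action and contractivity\<close>

definition wt :: "(int \<Rightarrow> complex) \<Rightarrow> (int \<Rightarrow> 'y \<Rightarrow> complex) \<Rightarrow> int \<Rightarrow> 'y \<Rightarrow> complex" where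
  "wt w a = (\<lambda>n y. w n * a n y)"

lemma
  assumes a: "a \<in> carrier L" and w: "\<And>n. cmod (w n) \<le> B"
  shows wt_closed: "wt w a \<in> carrier L"
    and nrm_wt: "nrm L (wt w a) \<le> (\<Sum>\<^sub>\<infinity>n. cmod (w n) * sup_norm (a n))"
proof -
  have "(\<lambda>n. B * sup_norm (a n)) summable_on UNIV"
    by (intro summable_on_cmult_right L_summable a)
  then have s: "(\<lambda>n. cmod (w n) * sup_norm (a n)) summable_on UNIV"
    by (rule summable_on_comparison_test) (auto intro!: mult_right_mono mult_nonneg_nonneg w L_nonneg[OF a])
  have 1: "continuous_map Y euclidean (wt w a n)" for n
    unfolding wt_def using L_cont[OF a] by (intro continuous_intros) auto
  have 2: "wt w a n y = 0" if "y \<notin> dm n" for n y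
    using L_zero_off[OF a that] by (simp add: wt_def)
  have 3: "cmod (wt w a n y) \<le> cmod (w n) * sup_norm (a n)" for n y
    unfolding wt_def norm_mult by (intro mult_left_mono L_le a) simp
  note * = L_carrierI[OF 1 2 3 s]
  show "wt w a \<in> carrier L" by (rule *(1))
  show "nrm L (wt w a) \<le> (\<Sum>\<^sub>\<infinity>n. cmod (w n) * sup_norm (a n))" by (rule *(2))
qed

lemma wt_tendsto:
  assumes a: "a \<in> carrier L" and w: "\<And>N n. cmod (w N n) \<le> 1" "\<And>n. (\<lambda>N. w N n) \<longlonglongrightarrow> 1"
  shows "(\<lambda>N. nrm L (a \<ominus>\<^bsub>L\<^esub> wt (w N) a)) \<longlonglongrightarrow> 0"
proof (rule tendsto_sandwich[OF _ _ tendsto_const tendsto_infsum_weights])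
  let ?v = "\<lambda>N n. cmod (1 - w N n)"
  show v2: "?v N n \<le> 2" for N n
    using norm_triangle_ineq4[of 1 "w N n"] w(1)[of N n] by simp
  have eq: "a \<ominus>\<^bsub>L\<^esub> wt (w N) a = wt (\<lambda>n. 1 - w N n) a" for N
    by (simp add: L_minus wt_closed[OF a w(1)]) (simp add: wt_def algebra_simps)
  show "\<forall>\<^sub>F N in sequentially. nrm L (a \<ominus>\<^bsub>L\<^esub> wt (w N) a) \<le> (\<Sum>\<^sub>\<infinity>n. ?v N n * sup_norm (a n))"
    unfolding eq using nrm_wt[OF a v2] by (intro always_eventually allI)
  show "\<forall>\<^sub>F N in sequentially. 0 \<le> nrm L (a \<ominus>\<^bsub>L\<^esub> wt (w N) a)"
    unfolding eq using L.nrm_nonneg[OF wt_closed[OF a v2]] by (intro always_eventually allI)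
  show "(\<lambda>N. ?v N n) \<longlonglongrightarrow> 0" for n
    using tendsto_norm[OF tendsto_diff[OF tendsto_const w(2)], of 1] by simp
qed (use L_summable[OF a] L_nonneg[OF a] in auto)

text \<open>The dual action is by star-automorphisms that do not increase the l1 norm, so composing
  a C*-seminorm with it gives another C*-seminorm, which the largest one dominates.\<close>

lemma env_norm_gauge_le:
  assumes a: "a \<in> carrier L"
  shows "env_norm L (wt (\<lambda>n. cis (of_int n * t)) a) \<le> env_norm L a"
proof (rule L.env_norm_leI)
  let ?g = "wt (\<lambda>n. cis (of_int n * t))"
  fix p assume p: "cstar_seminorm L p"
  have cl: "?g a \<in> carrier L" if "a \<in> carrier L" for a
    using that by (rule wt_closed[where B = 1]) simp
  have nrm: "nrm L (?g a) \<le> nrm L a" if "a \<in> carrier L" for a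
    using nrm_wt[OF that, of "\<lambda>n. cis (of_int n * t)" 1] by (simp add: nrm_L)
  have add: "?g (a \<oplus>\<^bsub>L\<^esub> b) = ?g a \<oplus>\<^bsub>L\<^esub> ?g b" for a b
    by (simp add: wt_def L_ops algebra_simps)
  have smult: "?g (c \<odot>\<^bsub>L\<^esub> a) = c \<odot>\<^bsub>L\<^esub> ?g a" for c a
    by (simp add: wt_def L_ops algebra_simps)
  have mult: "?g (a \<otimes>\<^bsub>L\<^esub> b) = ?g a \<otimes>\<^bsub>L\<^esub> ?g b" if "a \<in> carrier L" "b \<in> carrier L" for a b
  proof (intro ext)
    fix n y
    have "?g (a \<otimes>\<^bsub>L\<^esub> b) n y = cis (of_int n * t) * (\<Sum>\<^sub>\<infinity>k. a k y * b (n - k) (th k y))"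
      by (simp add: wt_def L_mult that)
    also have "\<dots> = (\<Sum>\<^sub>\<infinity>k. cis (of_int n * t) * (a k y * b (n - k) (th k y)))"
      by (simp add: infsum_cmult_right')
    also have "\<dots> = (\<Sum>\<^sub>\<infinity>k. ?g a k y * ?g b (n - k) (th k y))"
    proof (rule infsum_cong)
      fix k
      have "cis (of_int n * t) = cis (of_int k * t) * cis (of_int (n - k) * t)"
        by (simp add: cis_mult algebra_simps)
      then show "cis (of_int n * t) * (a k y * b (n - k) (th k y)) = ?g a k y * ?g b (n - k) (th k y)"
        by (simp add: wt_def)
    qed
    finally show "?g (a \<otimes>\<^bsub>L\<^esub> b) n y = (?g a \<otimes>\<^bsub>L\<^esub> ?g b) n y"
      by (simp add: L_mult cl that)
  qed
  have adj: "?g (adj L a) = adj L (?g a)" if "a \<in> carrier L" for a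
  proof (intro ext)
    fix n y
    show "?g (adj L a) n y = adj L (?g a) n y"
      unfolding L_adj[OF cl[OF that]] by (simp add: wt_def L_adj[OF that] cis_cnj)
  qed
  have "cstar_seminorm L (\<lambda>a. p (?g a))"
    using p cl nrm L.m_closed L.a_closed unfolding cstar_seminorm_def
    by (auto simp: add smult mult adj intro: order_trans)
  from L.seminorm_le_env_norm[OF this a] show "p (?g a) \<le> env_norm L a" .
qed

text \<open>Triangle inequality for a nonnegative combination of dual circle automorphisms, each of
  them contractive.\<close>

lemma env_norm_wt_sum_le:
  fixes R :: nat
  assumes a: "a \<in> carrier L" and c: "\<And>r. 0 \<le> c r"
  shows "env_norm L (wt (\<lambda>n. \<Sum>r<R. complex_of_real (c r) * cis (of_int n * t r)) a) \<le> (\<Sum>r<R. c r) * env_norm L a"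
proof (induction R)
  case 0
  have "wt (\<lambda>n. \<Sum>r<(0::nat). complex_of_real (c r) * cis (of_int n * t r)) a = \<zero>\<^bsub>L\<^esub>"
    by (simp add: wt_def L_ops)
  then show ?case using L.env_norm_zero by simp
next
  case (Suc R)
  let ?w = "\<lambda>R n. \<Sum>r<R. complex_of_real (c r) * cis (of_int n * t r)"
  have bd: "cmod (?w R n) \<le> (\<Sum>r<R. c r)" for R n
    using c by (intro order_trans[OF norm_sum] sum_mono) (simp add: norm_mult)
  let ?g = "wt (\<lambda>n. cis (of_int n * t R)) a"
  have g: "?g \<in> carrier L" using a by (rule wt_closed[where B = 1]) simp
  have "wt (?w (Suc R)) a = wt (?w R) a \<oplus>\<^bsub>L\<^esub> complex_of_real (c R) \<odot>\<^bsub>L\<^esub> ?g"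
    by (simp add: wt_def L_ops algebra_simps)
  then have "env_norm L (wt (?w (Suc R)) a) \<le> env_norm L (wt (?w R) a) + env_norm L (complex_of_real (c R) \<odot>\<^bsub>L\<^esub> ?g)"
    using L.env_norm_add[of "wt (?w R) a" "complex_of_real (c R) \<odot>\<^bsub>L\<^esub> ?g"] wt_closed[OF a bd] g by simp
  also have "env_norm L (complex_of_real (c R) \<odot>\<^bsub>L\<^esub> ?g) \<le> c R * env_norm L ?g"
    using L.env_norm_smult[OF g, of "complex_of_real (c R)"] c by simp
  also have "c R * env_norm L ?g \<le> c R * env_norm L a"
    using env_norm_gauge_le[OF a] c by (intro mult_left_mono)
  finally show ?case using Suc by (simp add: algebra_simps)
qed

definition trunc :: "nat \<Rightarrow> int \<Rightarrow> complex" where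
  "trunc M n = (if \<bar>n\<bar> \<le> int M then 1 else 0)"

lemma trunc_bound: "cmod (trunc M n) \<le> 1"
  by (simp add: trunc_def)

lemma trunc_tendsto: "(\<lambda>M. trunc M n) \<longlonglongrightarrow> 1"
  by (rule tendsto_eventually, rule eventually_sequentiallyI[of "nat \<bar>n\<bar>"]) (simp add: trunc_def)

lemma env_norm_le_trunc:
  assumes a: "a \<in> carrier L"
  shows "(\<lambda>M. env_norm L (a \<ominus>\<^bsub>L\<^esub> wt (trunc M) a)) \<longlonglongrightarrow> 0"
proof (rule tendsto_sandwich[OF _ _ tendsto_const wt_tendsto[OF a trunc_bound trunc_tendsto]])
  have "a \<ominus>\<^bsub>L\<^esub> wt (trunc M) a \<in> carrier L" for M
    using a wt_closed[OF a trunc_bound] by simp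
  then show "\<forall>\<^sub>F M in sequentially. env_norm L (a \<ominus>\<^bsub>L\<^esub> wt (trunc M) a) \<le> nrm L (a \<ominus>\<^bsub>L\<^esub> wt (trunc M) a)"
    "\<forall>\<^sub>F M in sequentially. 0 \<le> env_norm L (a \<ominus>\<^bsub>L\<^esub> wt (trunc M) a)"
    by (auto intro!: always_eventually L.env_norm_le_nrm L.env_norm_nonneg)
qed

text \<open>The finite average reproduces the Fejer weights only in bounded degree. Hence the
  estimate is first made for truncations and then extended by l1 approximation, since the multiplier
  is also contractive in the l1 norm.\<close>

lemma env_norm_fejer:
  assumes a: "a \<in> carrier L"
  shows "env_norm L (wt (fejer N) a) \<le> env_norm L a"
proof (cases "N = 0")
  case True
  then have "wt (fejer N) a = \<zero>\<^bsub>L\<^esub>" by (simp add: wt_def fejer_def L_ops)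
  then show ?thesis using L.env_norm_zero L.env_norm_nonneg[OF a] by simp
next
  case False
  have fin: "env_norm L (wt (fejer N) (wt (trunc M) a)) \<le> env_norm L (wt (trunc M) a)" for M
  proof -
    \<comment> \<open>Enough sample points for the sampling to be exact in all degrees up to
      \<open>M\<close>.\<close>
    define K where "K = N + M"
    define c where "c r = (cmod (\<Sum>i<N. cis (real i * (real r * (2 * pi / K)))))\<^sup>2 / (real K * real N)" for r
    let ?w = "\<lambda>n. \<Sum>r<K. complex_of_real (c r) * cis (of_int n * (real r * (2 * pi / K)))"
    have w: "fejer N n = ?w n" if "\<bar>n\<bar> \<le> int M" for n
      unfolding c_def using that False by (intro fejer_sample) (auto simp: K_def)
    have "wt (fejer N) (wt (trunc M) a) = wt ?w (wt (trunc M) a)"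
      using w by (auto simp: wt_def trunc_def fun_eq_iff)
    \<comment> \<open>Degree 0 of the sampling identity: the nonnegative weights have total mass
      \<open>fejer N 0 = 1\<close>, so the combination is convex.\<close>
    moreover have "complex_of_real (\<Sum>r<K. c r) = 1"
      using w[of 0] False by (simp add: fejer_eq)
    then have "(\<Sum>r<K. c r) = 1" using of_real_eq_1_iff by blast
    moreover have "0 \<le> c r" for r by (simp add: c_def)
    ultimately show ?thesis
      using env_norm_wt_sum_le[OF wt_closed[OF a trunc_bound[of M]], where c = c and R = K
          and t = "\<lambda>r. real r * (2 * pi / K)"]
      by simp
  qed
  have le: "env_norm L (wt (fejer N) a) \<le> env_norm L a
      + (nrm L (a \<ominus>\<^bsub>L\<^esub> wt (trunc M) a) + nrm L (a \<ominus>\<^bsub>L\<^esub> wt (trunc M) a))" for M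
  proof -
    let ?f = "wt (trunc M) a" and ?d = "a \<ominus>\<^bsub>L\<^esub> wt (trunc M) a"
    have f: "?f \<in> carrier L" by (rule wt_closed[OF a trunc_bound])
    have d: "?d \<in> carrier L" using a f by simp
    have "wt (fejer N) a = wt (fejer N) ?f \<oplus>\<^bsub>L\<^esub> wt (fejer N) ?d"
      by (simp add: L_minus f) (simp add: wt_def L_ops algebra_simps)
    then have "env_norm L (wt (fejer N) a) \<le> env_norm L (wt (fejer N) ?f) + env_norm L (wt (fejer N) ?d)"
      using L.env_norm_add wt_closed[OF f fejer_bound] wt_closed[OF d fejer_bound] by simp
    moreover have "env_norm L (wt (fejer N) ?d) \<le> nrm L ?d"
    proof -
      have "nrm L (wt (fejer N) ?d) \<le> nrm L ?d"
      proof (rule order_trans[OF nrm_wt[OF d fejer_bound]])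
        show "(\<Sum>\<^sub>\<infinity>n. cmod (fejer N n) * sup_norm (?d n)) \<le> nrm L ?d"
          unfolding nrm_L
        proof (rule infsum_mono[OF _ L_summable[OF d]])
          show "cmod (fejer N n) * sup_norm (?d n) \<le> sup_norm (?d n)" for n
            using mult_right_mono[OF fejer_bound L_nonneg[OF d]] by simp
          then show "(\<lambda>n. cmod (fejer N n) * sup_norm (?d n)) summable_on UNIV"
            using L_nonneg[OF d] by (intro summable_on_comparison_test[OF L_summable[OF d]]) auto
        qed
      qed
      then show ?thesis
        using L.env_norm_le_nrm[OF wt_closed[OF d fejer_bound]] by (rule order_trans[rotated])
    qed
    moreover have "env_norm L ?f \<le> env_norm L (?f \<ominus>\<^bsub>L\<^esub> a) + env_norm L a"
      using L.env_norm_triangle_diff[OF f a] .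
    moreover have "env_norm L (?f \<ominus>\<^bsub>L\<^esub> a) \<le> nrm L ?d"
      using L.env_norm_minus_commute[OF f a] L.env_norm_le_nrm[OF d] by simp
    ultimately show ?thesis using fin[of M] by linarith
  qed
  have "(\<lambda>M. env_norm L a + (nrm L (a \<ominus>\<^bsub>L\<^esub> wt (trunc M) a) + nrm L (a \<ominus>\<^bsub>L\<^esub> wt (trunc M) a)))
      \<longlonglongrightarrow> env_norm L a + (0 + 0)"
    by (intro tendsto_intros wt_tendsto[OF a trunc_bound trunc_tendsto])
  then show ?thesis
    using le by (intro tendsto_lowerbound[of _ "env_norm L a" sequentially]) auto
qed

section \<open>Closed ideals of continuous functions\<close>

abbreviation "CY \<equiv> C_van Y (topspace Y)"

text \<open>The functions \<open>n q / (1 + n q)\<close> act as an approximate unit. On the compact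
  set where \<open>|h| \<ge> e\<close> finitely many members of \<open>I\<close> have no common
  zero, so the sum \<open>q\<close> of their squared moduli is bounded below there; off this set
  \<open>h\<close> itself is small.\<close>

lemma closed_ideal_of_continuous_functions:
  assumes I: "I \<subseteq> CY" and zero: "(\<lambda>_. 0) \<in> I"
    and add: "\<And>h k. h \<in> I \<Longrightarrow> k \<in> I \<Longrightarrow> (\<lambda>y. h y + k y) \<in> I"
    and mult: "\<And>h k. h \<in> CY \<Longrightarrow> k \<in> I \<Longrightarrow> (\<lambda>y. h y * k y) \<in> I"
    and lim: "\<And>h. h \<in> CY \<Longrightarrow> (\<And>e. e > 0 \<Longrightarrow> \<exists>k\<in>I. \<forall>y. cmod (k y - h y) \<le> e) \<Longrightarrow> h \<in> I"
    and h: "h \<in> CY" and van: "\<And>y. y \<in> topspace Y \<Longrightarrow> \<forall>k\<in>I. k y = 0 \<Longrightarrow> h y = 0"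
  shows "h \<in> I"
proof (rule lim[OF h])
  fix e :: real assume e: "e > 0"
  define K where "K = {y \<in> topspace Y. cmod (h y) \<in> {e..}}"
  have clK: "closedin Y K"
    unfolding K_def by (rule closedin_continuous_map_preimage[of _ euclideanreal])
      (auto intro: continuous_intros C_van_cont[OF h])
  then have K: "compactin Y K" using compact by (simp add: closedin_compact_space)
  define U where "U k = {y \<in> topspace Y. k y \<in> - {0}}" for k :: "'y \<Rightarrow> complex"
  have op: "openin Y (U k)" if "k \<in> I" for k
    unfolding U_def using that I C_van_cont
    by (intro openin_continuous_map_preimage[of _ euclidean]) auto
  have cover: "K \<subseteq> \<Union>(U ` I)"
  proof
    fix y assume y: "y \<in> K"
    then have "h y \<noteq> 0" using e by (auto simp: K_def)
    then obtain k where "k \<in> I" "k y \<noteq> 0" using van[of y] y by (auto simp: K_def)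
    then show "y \<in> \<Union>(U ` I)" using y by (auto simp: K_def U_def)
  qed
  obtain \<F> where "finite \<F>" "\<F> \<subseteq> U ` I" and \<F>: "K \<subseteq> \<Union>\<F>"
    using compactinD[OF K _ cover] op by blast
  then obtain H where H: "H \<subseteq> I" "finite H" "\<F> = U ` H"
    using finite_subset_image[of \<F> U I] by metis
  \<comment> \<open>Squared moduli add up without cancellation, and each of them, being
    \<open>cnj k * k\<close>, stays in the ideal.\<close>
  define q where "q y = (\<Sum>k\<in>H. (cmod (k y))\<^sup>2)" for y
  have qI: "(\<lambda>y. complex_of_real (q y)) \<in> I"
    using H(2,1) unfolding q_def
  proof (induction H rule: finite_induct)
    case (insert k H)
    have kI: "k \<in> I" using insert by simp
    have kC: "k \<in> CY" using kI I by blast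
    have "(\<lambda>y. cnj (k y)) \<in> CY"
      by (rule C_vanI[OF continuous_map_cnj[OF C_van_cont[OF kC]]]) (simp add: C_van_zero[OF kC])
    then have "(\<lambda>y. cnj (k y) * k y) \<in> I" using kI by (rule mult)
    from add[OF this insert.IH] insert show ?case
      by (simp add: complex_norm_square mult.commute del: of_real_power)
  qed (simp add: zero)
  have q0: "0 \<le> q y" for y by (simp add: q_def sum_nonneg)
  have qpos: "q y > 0" if "y \<in> K" for y
  proof -
    have "y \<in> \<Union>(U ` H)" using that \<F> H(3) by blast
    then obtain k where "k \<in> H" "k y \<noteq> 0" by (auto simp: U_def)
    then show ?thesis unfolding q_def using H(2) by (intro sum_pos2[of _ k]) auto
  qed
  have qcont: "continuous_map Y euclideanreal q"
    unfolding q_def using H I by (intro continuous_intros H) (auto intro: C_van_cont)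
  obtain c where c: "c > 0" "\<And>y. y \<in> K \<Longrightarrow> c \<le> q y"
  proof (cases "K = {}")
    case False
    have "compact (q ` K)" using image_compactin[OF K qcont] by simp
    then obtain m where "m \<in> q ` K" "\<And>x. x \<in> q ` K \<Longrightarrow> m \<le> x"
      using compact_attains_inf[of "q ` K"] False by auto
    then show thesis using that[of m] qpos by auto
  qed (use that[of 1] in auto)
  \<comment> \<open>Chosen so that \<open>e * n * c = sup_norm h\<close>; with
    \<open>q \<ge> c\<close> on \<open>K\<close> this gives \<open>|h| / (1 + n q) \<le> e\<close>
    there.\<close>
  define n where "n = sup_norm h / (e * c)"
  have n0: "0 \<le> n" using sup_norm_nonneg[OF h] e c by (simp add: n_def)
  let ?d = "\<lambda>y. 1 + n * q y"
  have d: "?d y \<ge> 1" for y using n0 q0 by simp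
  define k where "k y = (h y * complex_of_real (n / ?d y)) * complex_of_real (q y)" for y
  have "(\<lambda>y. h y * complex_of_real (n / ?d y)) \<in> CY"
  proof (rule C_vanI)
    have "continuous_map Y euclideanreal (\<lambda>y. n / ?d y)"
      using d by (intro continuous_intros qcont) (smt (verit))
    then have "continuous_map Y euclidean (\<lambda>y. complex_of_real (n / ?d y))"
      by (rule continuous_map_of_real)
    then show "continuous_map Y euclidean (\<lambda>y. h y * complex_of_real (n / ?d y))"
      using C_van_cont[OF h] by (intro continuous_map_complex_mult)
  qed (use h in \<open>auto simp: C_van_def\<close>)
  then have kI: "k \<in> I" unfolding k_def using qI by (rule mult)
  have "cmod (k y - h y) \<le> e" for y
  proof -
    have "k y - h y = - (h y * complex_of_real (1 / ?d y))"
    proof -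
      have "n / ?d y * q y - 1 = - (1 / ?d y)" using d[of y] by (simp add: field_simps)
      then have "complex_of_real (n / ?d y) * complex_of_real (q y) - 1 = - complex_of_real (1 / ?d y)"
        by (metis of_real_1 of_real_diff of_real_minus of_real_mult)
      moreover have "k y - h y = h y * (complex_of_real (n / ?d y) * complex_of_real (q y) - 1)"
        by (simp add: k_def algebra_simps)
      ultimately show ?thesis by simp
    qed
    then have eq: "cmod (k y - h y) = cmod (h y) / ?d y"
      using d[of y] by (simp only: norm_minus_cancel norm_mult norm_of_real) simp
    show ?thesis
    proof (cases "y \<in> K")
      case True
      have "cmod (h y) \<le> sup_norm h" using cmod_le_sup_norm[OF h] by simp
      also have "\<dots> = e * (n * c)" using e c by (simp add: n_def)
      also have "\<dots> \<le> e * ?d y"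
        using mult_left_mono[OF c(2)[OF True] n0] e by (intro mult_left_mono) auto
      finally show ?thesis unfolding eq using d[of y] by (simp add: divide_le_eq)
    next
      case False
      have "cmod (h y) \<le> e"
        using False e C_van_zero[OF h, of y] by (cases "y \<in> topspace Y") (auto simp: K_def)
      also have "e \<le> e * ?d y" using d[of y] e by simp
      finally show ?thesis unfolding eq using d[of y] by (simp add: divide_le_eq)
    qed
  qed
  then show "\<exists>k\<in>I. \<forall>y. cmod (k y - h y) \<le> e" using kI by blast
qed

end

section \<open>Averaging over unitaries\<close>

locale free_partial_homeo = partial_homeo +
  assumes free: "no_periodic_points (topspace Y) F f"
begin

lemma th_free: "n \<noteq> 0 \<Longrightarrow> y \<in> dm n \<Longrightarrow> th n y \<noteq> y"
proof -
  have pos: False if "n > 0" "y \<in> dm n" "th n y = y" for n y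
  proof -
    have "y \<in> pow_dom (topspace Y) F f (nat n)" "(f ^^ nat n) y = y" "nat n \<ge> 1"
      using that by (simp_all add: dm_def th_def)
    then show False using free unfolding no_periodic_points_def by blast
  qed
  show ?thesis if "n \<noteq> 0" "y \<in> dm n"
    using pos[of n y] pos[of "- n" y] th_inverse[OF that(2)] that by (cases "n > 0") auto
qed

definition Uni :: "('a \<Rightarrow> complex) set" where
  "Uni = {u \<in> CY. \<forall>y\<in>topspace Y. cmod (u y) = 1}"

lemma UniD: "u \<in> Uni \<Longrightarrow> u \<in> CY" "u \<in> Uni \<Longrightarrow> y \<in> topspace Y \<Longrightarrow> cmod (u y) = 1"
  by (simp_all add: Uni_def)

text \<open>Freeness enters here: the two points are distinct. The opposite values 1 and -1 make
  \<open>phi u n y\<close>, defined below, vanish.\<close>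

lemma Uni_separates:
  assumes "n \<noteq> 0" "y \<in> dm n"
  obtains u where "u \<in> Uni" "u y = 1" "u (th n y) = -1"
proof -
  have yY: "y \<in> topspace Y" "th n y \<in> topspace Y" using assms dm_subset th_mem by auto
  have "normal_space Y"
    using compact Hausdorff compact_Hausdorff_or_regular_imp_normal_space by blast
  moreover have "closedin Y {y}" "closedin Y {th n y}"
    using yY Hausdorff by (simp_all add: closedin_Hausdorff_singleton)
  moreover have "disjnt {y} {th n y}" using th_free[OF assms] by simp
  ultimately obtain h where h: "continuous_map Y euclideanreal h" "h ` {y} \<subseteq> {0}" "h ` {th n y} \<subseteq> {1}"
    using Urysohn_lemma_alt[of Y "{y}" "{th n y}" 0 1] by blast
  define u where "u z = (if z \<in> topspace Y then cis (pi * h z) else 0)" for z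
  have "continuous_map Y euclideanreal (\<lambda>z. pi * h z)"
    using h(1) by (intro continuous_intros) auto
  moreover have "continuous_map euclideanreal euclidean cis"
    by (simp add: continuous_on_cis)
  ultimately have "continuous_map Y euclidean (\<lambda>z. cis (pi * h z))"
    using continuous_map_compose[of Y euclideanreal "\<lambda>z. pi * h z" euclidean cis] by (simp add: o_def)
  then have "continuous_map Y euclidean u"
    by (rule continuous_map_eq) (simp add: u_def)
  then have "u \<in> Uni" by (auto simp: Uni_def C_van_def u_def)
  moreover have "u y = 1" "u (th n y) = -1"
    using h yY by (auto simp: u_def)
  ultimately show thesis using that by blast
qed

text \<open>The factor by which the coefficient at \<open>n\<close> is multiplied when
  \<open>a\<close> is replaced by the mean of \<open>a\<close> and its conjugate by
  \<open>u\<close>.\<close>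

definition phi :: "('a \<Rightarrow> complex) \<Rightarrow> int \<Rightarrow> 'a \<Rightarrow> complex" where
  "phi u n y = (1 + cnj (u y) * u (th n y)) / 2"

lemma phi_bound: "u \<in> Uni \<Longrightarrow> y \<in> dm n \<Longrightarrow> cmod (phi u n y) \<le> 1"
proof -
  assume u: "u \<in> Uni" and y: "y \<in> dm n"
  have "cmod (1 + cnj (u y) * u (th n y)) \<le> cmod 1 + cmod (cnj (u y) * u (th n y))"
    by (rule norm_triangle_ineq)
  also have "\<dots> = 2"
    using UniD(2)[OF u, of y] UniD(2)[OF u th_mem[OF y]] y dm_subset[of n] by (simp add: norm_mult subset_iff)
  finally show ?thesis by (simp add: phi_def norm_divide)
qed

lemma phi_0: "u \<in> Uni \<Longrightarrow> y \<in> topspace Y \<Longrightarrow> phi u 0 y = 1"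
  using UniD(2)[of u y] complex_norm_square[of "u y"] by (simp add: phi_def mult.commute)

text \<open>For each point some unitary makes the factor 0, hence smaller than 1/2 on a
  neighbourhood. Compactness of the clopen set \<open>dm n\<close> leaves finitely many
  unitaries.\<close>

lemma finite_separating_set:
  assumes n: "n \<noteq> 0"
  shows "\<exists>U. finite U \<and> U \<subseteq> Uni \<and> (\<forall>y\<in>dm n. \<exists>u\<in>U. cmod (phi u n y) < 1/2)"
proof -
  define W where "W u = {y \<in> topspace (subtopology Y (dm n)). cmod (phi u n y) \<in> {..<1/2}}" for u
  have op: "openin Y (W u)" if "u \<in> Uni" for u
  proof -
    have u: "continuous_map Y euclidean u" using UniD(1)[OF that] by (rule C_van_cont)
    have "continuous_map (subtopology Y (dm n)) euclidean (\<lambda>y. u (th n y))"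
      using continuous_map_compose[OF cont_th u] by (simp add: o_def)
    then have "continuous_map (subtopology Y (dm n)) euclidean (\<lambda>y. (1 + cnj (u y) * u (th n y)) * (1/2))"
      using continuous_map_from_subtopology[OF u]
      by (intro continuous_map_complex_mult continuous_map_add continuous_map_cnj) auto
    then have "continuous_map (subtopology Y (dm n)) euclidean (phi u n)"
      by (simp add: phi_def[abs_def])
    then have "continuous_map (subtopology Y (dm n)) euclideanreal (\<lambda>y. cmod (phi u n y))"
      by (rule continuous_map_norm)
    then have "openin (subtopology Y (dm n)) (W u)"
      unfolding W_def by (rule openin_continuous_map_preimage) simp
    then show ?thesis by (simp add: openin_open_subtopology dm_clopen)
  qed
  have cover: "dm n \<subseteq> \<Union>(W ` Uni)"
  proof
    fix y assume y: "y \<in> dm n"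
    obtain u where "u \<in> Uni" "u y = 1" "u (th n y) = -1" using Uni_separates[OF n y] by blast
    moreover from this have "y \<in> W u" using y dm_subset[of n] by (auto simp: W_def phi_def)
    ultimately show "y \<in> \<Union>(W ` Uni)" by blast
  qed
  obtain \<F> where "finite \<F>" "\<F> \<subseteq> W ` Uni" and \<F>: "dm n \<subseteq> \<Union>\<F>"
    using compactinD[OF closedin_compact_space[OF compact dm_clopen(2)] _ cover] op by blast
  then obtain U where U: "U \<subseteq> Uni" "finite U" "\<F> = W ` U"
    using finite_subset_image[of \<F> W Uni] by metis
  have "\<exists>u\<in>U. cmod (phi u n y) < 1/2" if "y \<in> dm n" for y
  proof -
    have "y \<in> \<Union>(W ` U)" using that \<F> U(3) by blast
    then show ?thesis by (auto simp: W_def)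
  qed
  then show ?thesis using U by blast
qed

lemma separating_list:
  assumes "finite S" "0 \<notin> S"
  obtains us where "set us \<subseteq> Uni" "\<And>n y. n \<in> S \<Longrightarrow> y \<in> dm n \<Longrightarrow> \<exists>u\<in>set us. cmod (phi u n y) < 1/2"
proof -
  have "\<forall>n\<in>S. \<exists>U. finite U \<and> U \<subseteq> Uni \<and> (\<forall>y\<in>dm n. \<exists>u\<in>U. cmod (phi u n y) < 1/2)"
    using finite_separating_set assms(2) by metis
  then obtain U where U: "\<forall>n\<in>S. finite (U n) \<and> U n \<subseteq> Uni \<and> (\<forall>y\<in>dm n. \<exists>u\<in>U n. cmod (phi u n y) < 1/2)"
    by metis
  have "finite (\<Union>(U ` S))" using assms(1) U by blast
  then obtain us where us: "set us = \<Union>(U ` S)" using finite_list by blast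
  show thesis
  proof
    have "U n \<subseteq> Uni" if "n \<in> S" for n using U that by simp
    then show "set us \<subseteq> Uni" unfolding us by (rule UN_least)
    show "\<exists>u\<in>set us. cmod (phi u n y) < 1/2" if n: "n \<in> S" and y: "y \<in> dm n" for n y
    proof -
      have "\<exists>u\<in>U n. cmod (phi u n y) < 1/2" using U n y by simp
      then show ?thesis unfolding us using n by (elim bexE) (rule bexI, assumption, rule UN_I)
    qed
  qed
qed

section \<open>Iterated averages and the coefficient at 0\<close>

abbreviation "emb \<equiv> monomial 0"

lemma emb_closed: "h \<in> CY \<Longrightarrow> emb h \<in> carrier L" "h \<in> CY \<Longrightarrow> nrm L (emb h) \<le> sup_norm h"
  using monomial_closed[of h 0] by simp_all

lemma emb_mult: "h \<in> CY \<Longrightarrow> b \<in> carrier L \<Longrightarrow> (emb h \<otimes>\<^bsub>L\<^esub> b) n y = h y * b n y"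
  and mult_emb: "h \<in> CY \<Longrightarrow> b \<in> carrier L \<Longrightarrow> (b \<otimes>\<^bsub>L\<^esub> emb h) n y = b n y * h (th n y)"
  using monomial_mult[of h 0 b] mult_monomial[of h 0 b] by simp_all

definition half :: "'a \<Rightarrow> complex" where "half y = unit_on (topspace Y) y / 2"

lemma half_CY: "half \<in> CY"
proof (rule C_vanI)
  have "continuous_map Y euclidean (\<lambda>y. unit_on (topspace Y) y * (1/2))"
    using C_van_cont[OF unit_on_dm[of 0]] by (intro continuous_map_complex_mult) auto
  then show "continuous_map Y euclidean half" by (simp add: half_def[abs_def])
qed (simp add: half_def unit_on_def)

text \<open>Iterates \<open>a \<mapsto> (a + cnj u a u) / 2\<close>. The scalar 1/2 is absorbed into
  functions on \<open>Y\<close>, so each step consists of sums and of products with fixed elements,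
  under which a closed ideal is visibly stable.\<close>

primrec avg :: "('a \<Rightarrow> complex) list \<Rightarrow> (int \<Rightarrow> 'a \<Rightarrow> complex) \<Rightarrow> int \<Rightarrow> 'a \<Rightarrow> complex" where
  "avg [] a = a"
| "avg (u # us) a = emb half \<otimes>\<^bsub>L\<^esub> avg us a \<oplus>\<^bsub>L\<^esub> (emb (\<lambda>y. half y * cnj (u y)) \<otimes>\<^bsub>L\<^esub> avg us a) \<otimes>\<^bsub>L\<^esub> emb u"

lemma half_cnj_CY: "u \<in> CY \<Longrightarrow> (\<lambda>y. half y * cnj (u y)) \<in> CY"
  by (rule C_vanI[OF continuous_map_complex_mult[OF C_van_cont[OF half_CY] continuous_map_cnj[OF C_van_cont]]])
    (auto simp: half_def unit_on_def)

lemma avg_closed: "a \<in> carrier L \<Longrightarrow> set us \<subseteq> Uni \<Longrightarrow> avg us a \<in> carrier L"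
proof (induction us)
  case (Cons u us)
  then have "u \<in> CY" "avg us a \<in> carrier L" using UniD(1) by auto
  then show ?case by (simp add: emb_closed half_CY half_cnj_CY)
qed simp

lemma avg_coeff:
  assumes a: "a \<in> carrier L" and "set us \<subseteq> Uni"
  shows "avg us a n y = a n y * (\<Prod>u\<leftarrow>us. phi u n y)"
  using assms(2)
proof (induction us)
  case (Cons u us)
  then have u: "u \<in> CY" and c: "avg us a \<in> carrier L" using UniD(1) avg_closed[OF a] by auto
  show ?case
  proof (cases "y \<in> dm n")
    case True
    then have h: "half y = 1/2" using dm_subset by (auto simp: half_def unit_on_def)
    have "avg (u # us) a n y = half y * avg us a n y + half y * cnj (u y) * avg us a n y * u (th n y)"
      using u c by (simp add: L_simps emb_mult mult_emb emb_closed half_CY half_cnj_CY)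
    also have "\<dots> = avg us a n y * phi u n y"
      unfolding h phi_def by (simp add: field_simps)
    finally show ?thesis using Cons by simp
  next
    case False
    then show ?thesis using L_zero_off[OF a False] L_zero_off[OF avg_closed[OF a Cons.prems] False] by simp
  qed
qed simp

lemma env_norm_emb: "h \<in> CY \<Longrightarrow> env_norm L (emb h) \<le> sup_norm h"
  using L.env_norm_le_nrm[OF emb_closed(1)] emb_closed(2) order_trans by blast

text \<open>Each of the two summands contributes 1/2: the functions \<open>half\<close> and
  \<open>half * cnj u\<close> have sup norm at most 1/2, and \<open>u\<close> at most 1.\<close>

lemma env_norm_avg:
  assumes a: "a \<in> carrier L" and "set us \<subseteq> Uni"
  shows "env_norm L (avg us a) \<le> env_norm L a"
  using assms(2)
proof (induction us)
  case (Cons u us)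
  let ?b = "avg us a" and ?h = "\<lambda>y. half y * cnj (u y)"
  have u: "u \<in> CY" and b: "?b \<in> carrier L" using Cons.prems UniD(1) avg_closed[OF a] by auto
  have le: "sup_norm half \<le> 1/2" "sup_norm ?h \<le> 1/2" "sup_norm u \<le> 1"
  proof -
    have u1: "cmod (u y) \<le> 1" for y
      using UniD(2)[of u y] C_van_zero[OF u, of y] Cons.prems by (cases "y \<in> topspace Y") auto
    have h: "cmod (half y) \<le> 1/2" for y by (simp add: half_def unit_on_def)
    show "sup_norm half \<le> 1/2" using h by (rule sup_norm_leI)
    show "sup_norm u \<le> 1" using u1 by (rule sup_norm_leI)
    show "sup_norm ?h \<le> 1/2"
      using mult_mono[OF h u1] by (intro sup_norm_leI) (simp add: norm_mult)
  qed
  have m: "env_norm L (emb h \<otimes>\<^bsub>L\<^esub> x) \<le> r * env_norm L x" "env_norm L (x \<otimes>\<^bsub>L\<^esub> emb h) \<le> r * env_norm L x"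
    if "h \<in> CY" "sup_norm h \<le> r" "x \<in> carrier L" for h r x
  proof -
    have "env_norm L (emb h) \<le> r" using env_norm_emb[OF that(1)] that(2) by simp
    then have "env_norm L (emb h) * env_norm L x \<le> r * env_norm L x"
      using L.env_norm_nonneg[OF that(3)] by (rule mult_right_mono)
    then show "env_norm L (emb h \<otimes>\<^bsub>L\<^esub> x) \<le> r * env_norm L x" "env_norm L (x \<otimes>\<^bsub>L\<^esub> emb h) \<le> r * env_norm L x"
      using L.env_norm_mult[OF emb_closed(1)[OF that(1)] that(3)]
        L.env_norm_mult[OF that(3) emb_closed(1)[OF that(1)]] by (simp_all add: mult.commute)
  qed
  have c: "emb half \<otimes>\<^bsub>L\<^esub> ?b \<in> carrier L" "emb ?h \<otimes>\<^bsub>L\<^esub> ?b \<in> carrier L"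
    "(emb ?h \<otimes>\<^bsub>L\<^esub> ?b) \<otimes>\<^bsub>L\<^esub> emb u \<in> carrier L"
    using b u by (auto intro!: L.m_closed emb_closed(1) half_CY half_cnj_CY)
  have "env_norm L (avg (u # us) a) \<le> env_norm L (emb half \<otimes>\<^bsub>L\<^esub> ?b) + env_norm L ((emb ?h \<otimes>\<^bsub>L\<^esub> ?b) \<otimes>\<^bsub>L\<^esub> emb u)"
    using L.env_norm_add[OF c(1,3)] by simp
  also have "\<dots> \<le> 1/2 * env_norm L ?b + 1 * env_norm L (emb ?h \<otimes>\<^bsub>L\<^esub> ?b)"
    by (intro add_mono m le half_CY b u c)
  also have "env_norm L (emb ?h \<otimes>\<^bsub>L\<^esub> ?b) \<le> 1/2 * env_norm L ?b"
    by (intro m le half_cnj_CY b u)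
  finally show ?case using Cons by simp
qed simp

lemma L_minus_apply: "b \<in> carrier L \<Longrightarrow> (a \<ominus>\<^bsub>L\<^esub> b) n y = a n y - b n y"
  by (simp add: L_minus)

lemma avg_minus:
  assumes "a \<in> carrier L" "b \<in> carrier L" "set us \<subseteq> Uni"
  shows "avg us a \<ominus>\<^bsub>L\<^esub> avg us b = avg us (a \<ominus>\<^bsub>L\<^esub> b)"
  by (intro ext) (simp add: L_minus_apply avg_coeff avg_closed assms left_diff_distrib)

lemma closed_ideal_avg:
  assumes J: "J \<in> closed_ideals (enveloping_cstar L)" and s: "s \<in> env_cauchy L" "env_class L s \<in> J"
    and us: "set us \<subseteq> Uni"
  shows "(\<lambda>k. avg us (s k)) \<in> env_cauchy L \<and> env_class L (\<lambda>k. avg us (s k)) \<in> J"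
  using us
proof (induction us)
  case (Cons u us)
  then have u: "u \<in> CY" using UniD(1) by simp
  have IH: "(\<lambda>k. avg us (s k)) \<in> env_cauchy L" "env_class L (\<lambda>k. avg us (s k)) \<in> J"
    using Cons by auto
  note c = L.cauchy_const[OF emb_closed(1)]
  note 1 = L.cauchy_mult[OF c[OF half_CY] IH(1)] L.closed_ideal_mult(2)[OF J IH(1) c[OF half_CY] IH(2)]
  note 2 = L.cauchy_mult[OF c[OF half_cnj_CY[OF u]] IH(1)]
    L.closed_ideal_mult(2)[OF J IH(1) c[OF half_cnj_CY[OF u]] IH(2)]
  note 3 = L.cauchy_mult[OF 2(1) c[OF u]] L.closed_ideal_mult(1)[OF J 2(1) c[OF u] 2(2)]
  show ?case
    using L.cauchy_add[OF 1(1) 3(1)] L.closed_ideal_add[OF J 1(1) 3(1) 1(2) 3(2)] by simp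
qed (use s in simp)

text \<open>One small factor makes the product small, as all the others have modulus at most 1. This
  lets a single list serve several degrees and all points.\<close>

lemma prod_list_phi_bound:
  assumes "set us \<subseteq> Uni" "y \<in> dm n"
  shows "cmod (\<Prod>u\<leftarrow>us. phi u n y) \<le> 1"
    and "\<exists>u\<in>set us. cmod (phi u n y) < 1/2 \<Longrightarrow> cmod (\<Prod>u\<leftarrow>us. phi u n y) \<le> 1/2"
proof -
  have "cmod (\<Prod>u\<leftarrow>us. phi u n y) \<le> 1 \<and>
    ((\<exists>u\<in>set us. cmod (phi u n y) < 1/2) \<longrightarrow> cmod (\<Prod>u\<leftarrow>us. phi u n y) \<le> 1/2)"
    using assms(1)
  proof (induction us)
    case (Cons u us)
    define x where "x = cmod (phi u n y)"
    define p where "p = cmod (\<Prod>u\<leftarrow>us. phi u n y)"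
    have x: "0 \<le> x" "x \<le> 1" using phi_bound[of u y n] Cons.prems assms(2) by (auto simp: x_def)
    have p: "0 \<le> p" "p \<le> 1" "(\<exists>u\<in>set us. cmod (phi u n y) < 1/2) \<Longrightarrow> p \<le> 1/2"
      using Cons by (auto simp: p_def)
    have xp: "x * p \<le> x" "x * p \<le> p" using x p by (auto intro: mult_left_le mult_left_le_one_le)
    have "x * p \<le> 1/2" if "\<exists>v\<in>set (u # us). cmod (phi v n y) < 1/2"
    proof (cases "x < 1/2")
      case False
      then have "p \<le> 1/2" using that by (intro p(3)) (auto simp: x_def)
      then show ?thesis using xp(2) by linarith
    qed (use xp(1) in linarith)
    then show ?case using xp x by (simp add: norm_mult flip: x_def p_def) 
  qed simp
  then show "cmod (\<Prod>u\<leftarrow>us. phi u n y) \<le> 1"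
    "\<exists>u\<in>set us. cmod (phi u n y) < 1/2 \<Longrightarrow> cmod (\<Prod>u\<leftarrow>us. phi u n y) \<le> 1/2" by auto
qed

text \<open>Repeating one separating list \<open>p\<close> times multiplies the nonzero coefficients
  off degree 0 by factors of modulus at most \<open>(1/2) ^ p\<close> and leaves degree 0 alone,
  since \<open>phi u 0 = 1\<close> on \<open>Y\<close>. Finite support enters because a list is
  built for finitely many degrees.\<close>

lemma avg_tends_to_diagonal:
  assumes a: "a \<in> carrier L" and fin: "\<And>n. \<bar>n\<bar> > M \<Longrightarrow> a n = (\<lambda>_. 0)" and e: "e > 0"
  obtains us where "set us \<subseteq> Uni" "env_norm L (avg us a \<ominus>\<^bsub>L\<^esub> emb (a 0)) \<le> e"
proof -
  have "finite ({-M..M} - {0})" "0 \<notin> {-M..M} - {0}" by auto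
  then obtain vs where vs: "set vs \<subseteq> Uni"
    "\<And>n y. n \<in> {-M..M} - {0} \<Longrightarrow> y \<in> dm n \<Longrightarrow> \<exists>u\<in>set vs. cmod (phi u n y) < 1/2"
    by (rule separating_list) blast+
  have "(\<lambda>p. (1/2) ^ p * nrm L a) \<longlonglongrightarrow> 0 * nrm L a"
    by (intro tendsto_mult LIMSEQ_power_zero tendsto_const) simp
  then have "\<forall>\<^sub>F p in sequentially. (1/2) ^ p * nrm L a < e"
    using e by (intro order_tendstoD(2)) auto
  then obtain p where p: "(1/2) ^ p * nrm L a < e"
    by (auto simp: eventually_sequentially)
  define us where "us = concat (replicate p vs)"
  have us: "set us \<subseteq> Uni" using vs(1) by (auto simp: us_def)
  have prod: "(\<Prod>u\<leftarrow>us. phi u n y) = (\<Prod>u\<leftarrow>vs. phi u n y) ^ p" for n y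
    unfolding us_def by (induction p) auto
  let ?d = "avg us a \<ominus>\<^bsub>L\<^esub> emb (a 0)"
  have a0: "a 0 \<in> CY" using L_coeff[OF a, of 0] by simp
  have d: "?d \<in> carrier L" using avg_closed[OF a us] emb_closed(1)[OF a0] by simp
  have dn: "?d n y = a n y * (\<Prod>u\<leftarrow>us. phi u n y) - (if n = 0 then a 0 y else 0)" for n y
    unfolding L_minus_apply[OF emb_closed(1)[OF a0]] avg_coeff[OF a us] by (simp add: monomial_def)
  have bound: "cmod (?d n y) \<le> (1/2) ^ p * sup_norm (a n)" for n y
  proof (cases "y \<in> dm n")
    case False
    then show ?thesis using L_zero_off[OF d False] L_nonneg[OF a] by simp
  next
    case True
    consider "n = 0" | "n \<noteq> 0" "\<bar>n\<bar> \<le> M" | "\<bar>n\<bar> > M" by linarith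
    then show ?thesis
    proof cases
      case 1
      have "phi u 0 y = 1" if "u \<in> set us" for u
        using phi_0[of u y] that us True 1 by auto
      then have "(\<Prod>u\<leftarrow>us. phi u n y) = 1"
        using 1 by (induction us) auto
      then show ?thesis
        unfolding dn using 1 L_nonneg[OF a] by simp
    next
      case 2
      then have "n \<in> {-M..M} - {0}" by auto
      then have "cmod (\<Prod>u\<leftarrow>vs. phi u n y) ^ p \<le> (1/2) ^ p"
        using prod_list_phi_bound(2)[OF vs(1) True vs(2)[OF _ True]] by (intro power_mono) auto
      then have "cmod (a n y) * cmod (\<Prod>u\<leftarrow>vs. phi u n y) ^ p \<le> sup_norm (a n) * (1/2) ^ p"
        using L_le[OF a] L_nonneg[OF a] by (intro mult_mono) auto
      then show ?thesis
        unfolding dn prod using 2 by (simp add: norm_mult norm_power mult.commute)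
    next
      case 3
      then have "?d n y = 0" unfolding dn using fin[OF 3] by auto
      then show ?thesis using L_nonneg[OF a] by simp
    qed
  qed
  have "nrm L ?d \<le> infsum (\<lambda>n. (1/2) ^ p * sup_norm (a n)) UNIV"
    by (rule L_carrierI(2)[OF L_cont[OF d] L_zero_off[OF d] bound summable_on_cmult_right[OF L_summable[OF a]]])
  also have "\<dots> = (1/2) ^ p * nrm L a" by (simp add: nrm_L infsum_cmult_right')
  finally have "env_norm L ?d \<le> e" using L.env_norm_le_nrm[OF d] p by linarith
  then show thesis using that us by blast
qed

text \<open>Half of \<open>e\<close> goes to the Cauchy tail and half to the truncation. The
  coefficient at 0 is kept exactly, and \<open>m0\<close> lets the index be taken as late as another
  approximation demands.\<close>

lemma cauchy_trunc:
  assumes s: "s \<in> env_cauchy L" and e: "e > 0"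
  obtains M a m where "a \<in> carrier L" "\<And>n. \<bar>n\<bar> > int M \<Longrightarrow> a n = (\<lambda>_. 0)" "a 0 = s m 0"
    "\<And>k. k \<ge> m \<Longrightarrow> env_norm L (s k \<ominus>\<^bsub>L\<^esub> a) \<le> e" "m \<ge> m0"
proof -
  have e2: "e/2 > 0" using e by simp
  obtain m' where m': "\<And>k l. k \<ge> m' \<Longrightarrow> l \<ge> m' \<Longrightarrow> env_norm L (s k \<ominus>\<^bsub>L\<^esub> s l) < e/2"
    using L.cauchyD2[OF s e2] by blast
  define m where "m = max m' m0"
  note sm = L.cauchyD[OF s]
  obtain M where M: "env_norm L (s m \<ominus>\<^bsub>L\<^esub> wt (trunc M) (s m)) < e/2"
    using order_tendstoD(2)[OF env_norm_le_trunc[OF sm[of m]] e2] by (auto simp: eventually_sequentially)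
  show thesis
  proof
    show a: "wt (trunc M) (s m) \<in> carrier L" by (rule wt_closed[OF sm trunc_bound])
    show "wt (trunc M) (s m) n = (\<lambda>_. 0)" if "\<bar>n\<bar> > int M" for n
      using that by (simp add: wt_def trunc_def)
    show "wt (trunc M) (s m) 0 = s m 0" by (simp add: wt_def trunc_def)
    show "m \<ge> m0" by (simp add: m_def)
    show "env_norm L (s k \<ominus>\<^bsub>L\<^esub> wt (trunc M) (s m)) \<le> e" if "k \<ge> m" for k
      using L.env_norm_minus_triangle[OF sm[of k] sm[of m] a] M m'[of k m] that by (simp add: m_def)
  qed
qed

text \<open>\<open>h\<close> is the coefficient at 0 of the class of \<open>s\<close>. Three errors
  occur: between the averages of \<open>s k\<close> and \<open>a\<close>, between the average of
  \<open>a\<close> and its diagonal, and between this diagonal and \<open>h\<close>.\<close>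

lemma closed_ideal_diagonal:
  assumes J: "J \<in> closed_ideals (enveloping_cstar L)" and s: "s \<in> env_cauchy L" "env_class L s \<in> J"
    and h: "h \<in> CY" and lim: "\<And>e. e > 0 \<Longrightarrow> \<forall>\<^sub>F k in sequentially. \<forall>y. cmod (s k 0 y - h y) \<le> e"
  shows "env_class L (\<lambda>_. emb h) \<in> J"
proof (rule L.closed_ideal_limit[OF J L.cauchy_const[OF emb_closed(1)[OF h]]])
  fix e :: real assume "e > 0"
  then have e: "e/3 > 0" by simp
  obtain m0 where m0: "\<And>k y. k \<ge> m0 \<Longrightarrow> cmod (s k 0 y - h y) \<le> e/3"
    using lim[OF e] unfolding eventually_sequentially by blast
  obtain M a m where a: "a \<in> carrier L" "\<And>n. \<bar>n\<bar> > int M \<Longrightarrow> a n = (\<lambda>_. 0)" "a 0 = s m 0"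
    "\<And>k. k \<ge> m \<Longrightarrow> env_norm L (s k \<ominus>\<^bsub>L\<^esub> a) \<le> e/3" "m \<ge> m0"
    using cauchy_trunc[OF s(1) e] by metis
  \<comment> \<open>The list depends on the fixed element \<open>a\<close> and not on
    \<open>k\<close>; the same averaging can thus be applied to every term of \<open>s\<close>,
    giving one class in \<open>J\<close>.\<close>
  obtain us where us: "set us \<subseteq> Uni" "env_norm L (avg us a \<ominus>\<^bsub>L\<^esub> emb (a 0)) \<le> e/3"
    using avg_tends_to_diagonal[OF a(1,2) e] by metis
  have a0: "a 0 \<in> CY" using L_coeff[OF a(1), of 0] by simp
  note sk = L.cauchyD[OF s(1)]
  have "env_norm L (avg us (s k) \<ominus>\<^bsub>L\<^esub> emb h) \<le> e" if k: "k \<ge> m" for k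
  proof -
    have "env_norm L (avg us (s k) \<ominus>\<^bsub>L\<^esub> avg us a) \<le> env_norm L (s k \<ominus>\<^bsub>L\<^esub> a)"
      using sk a us by (simp add: avg_minus env_norm_avg)
    moreover have "env_norm L (emb (a 0) \<ominus>\<^bsub>L\<^esub> emb h) \<le> e/3"
    proof -
      have d: "(\<lambda>y. a 0 y - h y) \<in> CY"
        using C_van_cont[OF a0] C_van_cont[OF h] C_van_zero[OF a0] C_van_zero[OF h]
        by (intro C_vanI continuous_map_diff) auto
      have "emb (a 0) \<ominus>\<^bsub>L\<^esub> emb h = emb (\<lambda>y. a 0 y - h y)"
        using emb_closed(1)[OF h] by (auto simp: L_minus monomial_def fun_eq_iff)
      moreover have "sup_norm (\<lambda>y. a 0 y - h y) \<le> e/3"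
        using m0[OF a(5)] a(3) by (intro sup_norm_leI) simp
      ultimately show ?thesis using env_norm_emb[OF d] by simp
    qed
    moreover have "env_norm L (avg us (s k) \<ominus>\<^bsub>L\<^esub> emb h)
        \<le> env_norm L (avg us (s k) \<ominus>\<^bsub>L\<^esub> avg us a) + env_norm L (avg us a \<ominus>\<^bsub>L\<^esub> emb h)"
      using sk a us h by (intro L.env_norm_minus_triangle avg_closed emb_closed)
    moreover have "env_norm L (avg us a \<ominus>\<^bsub>L\<^esub> emb h)
        \<le> env_norm L (avg us a \<ominus>\<^bsub>L\<^esub> emb (a 0)) + env_norm L (emb (a 0) \<ominus>\<^bsub>L\<^esub> emb h)"
      using a us h a0 by (intro L.env_norm_minus_triangle avg_closed emb_closed)
    ultimately show ?thesis using us(2) a(4)[OF k] by linarith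
  qed
  then have "\<forall>\<^sub>F k in sequentially. env_norm L (avg us (s k) \<ominus>\<^bsub>L\<^esub> emb h) \<le> e"
    unfolding eventually_sequentially by blast
  then show "\<exists>t\<in>env_cauchy L. env_class L t \<in> J \<and> (\<forall>\<^sub>F n in sequentially. env_norm L (t n \<ominus>\<^bsub>L\<^esub> emb h) \<le> e)"
    using closed_ideal_avg[OF J s us(1)] by blast
qed

end

section \<open>Classification of the closed ideals\<close>

lemma tendsto_0_leI:
  fixes z :: "nat \<Rightarrow> complex"
  assumes "\<And>e. e > 0 \<Longrightarrow> \<forall>\<^sub>F n in sequentially. cmod (z n) \<le> e"
  shows "z \<longlonglongrightarrow> 0"
proof (rule tendstoI)
  fix e :: real assume e: "e > 0"
  then have "\<forall>\<^sub>F n in sequentially. cmod (z n) \<le> e/2" by (intro assms) simp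
  then show "\<forall>\<^sub>F n in sequentially. dist (z n) 0 < e"
    by (rule eventually_mono) (use e in simp)
qed

lemma invariant_sets_iff:
  assumes "V \<subseteq> S" "D \<subseteq> S"
  shows "V \<in> invariant_sets S D f \<longleftrightarrow> f ` (V \<inter> D) = V \<inter> f ` D"
proof -
  have le1: "(\<forall>n\<le>1. P n) \<longleftrightarrow> P 0 \<and> P 1" for P :: "nat \<Rightarrow> bool"
    by (auto simp: le_Suc_eq)
  have 0: "V \<inter> pow_dom S D f 0 = V" "V \<inter> pow_ran S D f 0 = V"
    using assms by (auto simp: pow_ran_def pow_dom_0)
  have 1: "pow_dom S D f 1 = D" using assms by (auto simp: pow_dom_def)
  then have 2: "pow_ran S D f 1 = f ` D" by (simp add: pow_ran_def)
  show ?thesis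
    using assms 0 unfolding invariant_sets_def mem_Collect_eq le1 1 2 by simp
qed

context partial_homeo
begin

lemma image_F: "f ` F = G"
proof
  show "G \<subseteq> f ` F"
  proof
    fix y assume "y \<in> G"
    then have "y = f (g y)" "g y \<in> F" by (simp_all add: fg g_mem)
    then show "y \<in> f ` F" by (rule image_eqI)
  qed
qed (use f_mem in auto)

text \<open>As \<open>f\<close> is injective on \<open>F\<close> with inverse \<open>g\<close>, a
  single equality of images gives stability under both \<open>f\<close> and \<open>g\<close>, hence
  under every integer power.\<close>

lemma invariant_iff:
  assumes V: "V \<subseteq> topspace Y"
  shows "V \<in> invariant_sets (topspace Y) F f \<longleftrightarrow> (\<forall>k. \<forall>y\<in>V \<inter> dm k. th k y \<in> V)"
proof -
  have "V \<in> invariant_sets (topspace Y) F f \<longleftrightarrow> f ` (V \<inter> F) = V \<inter> G"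
    unfolding invariant_sets_iff[OF V FG_subset(1)] image_F ..
  also have "\<dots> \<longleftrightarrow> (\<forall>k. \<forall>y\<in>V \<inter> dm k. th k y \<in> V)"
  proof
    assume eq: "f ` (V \<inter> F) = V \<inter> G"
    have up: "f y \<in> V" if "y \<in> V" "y \<in> F" for y using eq that by blast
    have down: "g y \<in> V" if y: "y \<in> V" "y \<in> G" for y
    proof -
      have "y \<in> f ` (V \<inter> F)" using eq y by simp
      then obtain z where "z \<in> V" "z \<in> F" "y = f z" by blast
      then show ?thesis by (simp add: gf)
    qed
    have pos: "y \<in> dm (int n) \<Longrightarrow> th (int n) y \<in> V" if "y \<in> V" for n y
    proof (induction n)
      case (Suc n)
      then show ?case
        using up dm_pos_iff[of "int n" y] th_pos[of "int n" y] by (simp add: add.commute)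
    qed (use that in simp)
    have neg: "y \<in> dm (- int n) \<Longrightarrow> th (- int n) y \<in> V" if "y \<in> V" for n y
    proof (induction n)
      case (Suc n)
      then have "y \<in> dm (- int n)" "th (- int n) y \<in> G"
        using dm_neg_iff[of "- int n" y] Suc.prems[unfolded minus_Suc] by simp_all
      then show ?case
        using Suc.IH down th_neg[of "- int n" y, folded minus_Suc] by simp
    qed (use that in simp)
    show "\<forall>k. \<forall>y\<in>V \<inter> dm k. th k y \<in> V"
    proof (intro allI ballI)
      fix k y assume "y \<in> V \<inter> dm k"
      then show "th k y \<in> V"
        using pos[of y "nat k"] neg[of y "nat (- k)"] by (cases "0 \<le> k") auto
    qed
  next
    assume inv: "\<forall>k. \<forall>y\<in>V \<inter> dm k. th k y \<in> V"
    have "f y \<in> V \<inter> G" if "y \<in> V \<inter> F" for y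
      using inv[rule_format, of y 1] that f_mem by (simp add: dm_1 th_1)
    moreover have "y \<in> f ` (V \<inter> F)" if "y \<in> V \<inter> G" for y
    proof -
      have "g y \<in> V \<inter> F" using inv[rule_format, of y "-1"] that g_mem by (simp add: dm_minus_1 th_minus_1)
      moreover have "y = f (g y)" using fg that by simp
      ultimately show ?thesis by blast
    qed
    ultimately show "f ` (V \<inter> F) = V \<inter> G" by blast
  qed
  finally show ?thesis .
qed

lemma clos_invD:
  assumes "V \<in> clos_inv Y F f"
  shows "closedin Y V" "V \<subseteq> topspace Y" "y \<in> V \<Longrightarrow> y \<in> dm k \<Longrightarrow> th k y \<in> V"
proof -
  show cl: "closedin Y V" using assms by (simp add: clos_inv_def)
  then show sub: "V \<subseteq> topspace Y" by (rule closedin_subset)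
  show "y \<in> V \<Longrightarrow> y \<in> dm k \<Longrightarrow> th k y \<in> V"
    using assms invariant_iff[OF sub] by (simp add: clos_inv_def)
qed

lemma clos_invI:
  assumes "closedin Y V" "\<And>k y. y \<in> V \<Longrightarrow> y \<in> dm k \<Longrightarrow> th k y \<in> V"
  shows "V \<in> clos_inv Y F f"
  using assms invariant_iff[OF closedin_subset[OF assms(1)]] by (simp add: clos_inv_def)

text \<open>\<open>h\<close> is the \<open>k\<close>-th Fourier coefficient of the class. The bound
  \<open>cmod_le_env_norm\<close> is uniform in the point, so the coefficient functions are
  uniformly Cauchy and their limit is continuous.\<close>

lemma coeff_limit:
  assumes s: "s \<in> env_cauchy L"
  obtains h where "h \<in> C_van Y (dm k)"
    "\<And>e. e > 0 \<Longrightarrow> \<forall>\<^sub>F n in sequentially. \<forall>y. cmod (s n k y - h y) \<le> e"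
proof -
  note sL = L.cauchyD[OF s]
  have uc: "\<exists>N. \<forall>m\<ge>N. \<forall>n\<ge>N. \<forall>y. cmod (s m k y - s n k y) \<le> e" if e: "e > 0" for e
  proof -
    obtain N where N: "\<And>m n. m \<ge> N \<Longrightarrow> n \<ge> N \<Longrightarrow> env_norm L (s m \<ominus>\<^bsub>L\<^esub> s n) < e"
      using L.cauchyD2[OF s e] by blast
    have "cmod (s m k y - s n k y) \<le> e" if "m \<ge> N" "n \<ge> N" for m n y
    proof -
      have "cmod ((s m \<ominus>\<^bsub>L\<^esub> s n) k y) \<le> env_norm L (s m \<ominus>\<^bsub>L\<^esub> s n)"
        using sL by (intro cmod_le_env_norm) simp
      then show ?thesis using N[OF that] by (simp add: L_minus[OF sL])
    qed
    then show ?thesis by blast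
  qed
  have conv: "convergent (\<lambda>n. s n k y)" for y
  proof (rule Cauchy_convergent, rule metric_CauchyI)
    fix e :: real assume e: "e > 0"
    then obtain N where N: "\<forall>m\<ge>N. \<forall>n\<ge>N. \<forall>y. cmod (s m k y - s n k y) \<le> e/2" using uc[of "e/2"] by auto
    have "dist (s m k y) (s n k y) < e" if "m \<ge> N" "n \<ge> N" for m n
      using N[rule_format, OF that, of y] e by (simp add: dist_norm)
    then show "\<exists>M. \<forall>m\<ge>M. \<forall>n\<ge>M. dist (s m k y) (s n k y) < e" by blast
  qed
  define h where "h y = lim (\<lambda>n. s n k y)" for y
  have h: "(\<lambda>n. s n k y) \<longlonglongrightarrow> h y" for y
    using conv[of y] by (simp add: h_def convergent_LIMSEQ_iff)
  have unif: "\<forall>\<^sub>F n in sequentially. \<forall>y. cmod (s n k y - h y) \<le> e" if e: "e > 0" for e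
  proof -
    obtain N where N: "\<And>m n y. m \<ge> N \<Longrightarrow> n \<ge> N \<Longrightarrow> cmod (s m k y - s n k y) \<le> e" using uc[OF e] by blast
    have "cmod (s n k y - h y) \<le> e" if "n \<ge> N" for n y
    proof (rule tendsto_upperbound)
      show "(\<lambda>m. cmod (s n k y - s m k y)) \<longlonglongrightarrow> cmod (s n k y - h y)"
        by (intro tendsto_intros h)
      show "\<forall>\<^sub>F m in sequentially. cmod (s n k y - s m k y) \<le> e"
        using N[OF that] by (intro eventually_sequentiallyI[of N])
    qed simp
    then show ?thesis unfolding eventually_sequentially by blast
  qed
  have "h \<in> C_van Y (dm k)"
  proof (rule C_vanI)
    have "uniform_limit (topspace Y) (\<lambda>n. s n k) h sequentially"
      unfolding uniform_limit_iff dist_norm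
    proof (intro allI impI)
      fix e :: real assume e: "e > 0"
      then have "\<forall>\<^sub>F n in sequentially. \<forall>y. cmod (s n k y - h y) \<le> e/2" by (intro unif) simp
      then show "\<forall>\<^sub>F n in sequentially. \<forall>y\<in>topspace Y. cmod (s n k y - h y) < e"
      proof eventually_elim
        case (elim n)
        show ?case
        proof
          fix y show "cmod (s n k y - h y) < e" using elim[rule_format, of y] e by linarith
        qed
      qed
    qed
    then show "continuous_map Y euclidean h"
      using L_cont[OF sL] by (intro continuous_map_uniform_limit_normed[of Y "\<lambda>n. s n k" h sequentially]) auto
    fix y assume "y \<notin> dm k"
    then show "h y = 0" using h[of y] L_zero_off[OF sL] by (simp add: LIMSEQ_const_iff)
  qed
  then show thesis using unif that by blast
qed

text \<open>Expresses on a representative that the Fourier coefficients of its class vanish on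
  \<open>V\<close>.\<close>

definition null_on :: "'y set \<Rightarrow> (nat \<Rightarrow> int \<Rightarrow> 'y \<Rightarrow> complex) \<Rightarrow> bool" where
  "null_on V s \<longleftrightarrow> (\<forall>k. \<forall>y\<in>V. (\<lambda>n. s n k y) \<longlonglongrightarrow> 0)"

definition ideal_of :: "'y set \<Rightarrow> (nat \<Rightarrow> int \<Rightarrow> 'y \<Rightarrow> complex) set set" where
  "ideal_of V = env_class L ` {s \<in> env_cauchy L. null_on V s}"

lemma ideal_of_mono: "V \<subseteq> W \<Longrightarrow> ideal_of W \<subseteq> ideal_of V"
  unfolding ideal_of_def null_on_def by (intro image_mono) blast

end

context free_partial_homeo
begin

text \<open>Replacing one factor by a finitely supported approximation turns the convolution into a
  finite sum.\<close>

lemma null_on_mult: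
  assumes V: "V \<in> clos_inv Y F f" and s: "s \<in> env_cauchy L" and t: "t \<in> env_cauchy L" and n: "null_on V s"
  shows "null_on V (\<lambda>n. s n \<otimes>\<^bsub>L\<^esub> t n)" "null_on V (\<lambda>n. t n \<otimes>\<^bsub>L\<^esub> s n)"
proof -
  note sL = L.cauchyD[OF s] and tL = L.cauchyD[OF t]
  obtain B where B: "B > 0" "\<And>n. env_norm L (s n) \<le> B" using L.cauchy_bounded[OF s] by blast
  have fin: "(\<Sum>\<^sub>\<infinity>j. c j) = (\<Sum>j\<in>S. c j)" if "finite S" "\<And>j. j \<notin> S \<Longrightarrow> c j = 0" for c :: "int \<Rightarrow> complex" and S
    using that by (subst infsum_cong_neutral[of S UNIV c c]) auto
  have main: "\<forall>\<^sub>F n in sequentially. cmod ((s n \<otimes>\<^bsub>L\<^esub> t n) k y) \<le> e \<and> cmod ((t n \<otimes>\<^bsub>L\<^esub> s n) k y) \<le> e"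
    if y: "y \<in> V" and e: "e > 0" for k y e
  proof -
    \<comment> \<open>\<open>B\<close> bounds the terms of \<open>s\<close>, so replacing
      \<open>t n\<close> by \<open>a\<close> in a product costs at most
      \<open>B * (e / (2 * B)) = e / 2\<close>.\<close>
    have e': "e / (2 * B) > 0" using e B by simp
    obtain M a m where a: "a \<in> carrier L" "\<And>n. \<bar>n\<bar> > int M \<Longrightarrow> a n = (\<lambda>_. 0)"
      "\<And>k. k \<ge> m \<Longrightarrow> env_norm L (t k \<ominus>\<^bsub>L\<^esub> a) \<le> e / (2 * B)"
      using cauchy_trunc[OF t e'] by metis
    have sn: "(\<lambda>n. s n j z) \<longlonglongrightarrow> 0" if "z \<in> V" for j z
      using n that by (simp add: null_on_def)
    have "(s n \<otimes>\<^bsub>L\<^esub> a) k y = (\<Sum>j\<in>{k - int M..k + int M}. s n j y * a (k - j) (th j y))" for n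
      unfolding L_mult[OF sL a(1)] by (rule fin) (auto simp: a(2))
    moreover have "(\<lambda>n. \<Sum>j\<in>{k - int M..k + int M}. s n j y * a (k - j) (th j y)) \<longlonglongrightarrow> 0"
      by (intro tendsto_null_sum tendsto_mult_left_zero sn y)
    ultimately have lim: "(\<lambda>n. (s n \<otimes>\<^bsub>L\<^esub> a) k y) \<longlonglongrightarrow> 0" by simp
    have 1: "\<forall>\<^sub>F n in sequentially. cmod ((s n \<otimes>\<^bsub>L\<^esub> a) k y) < e/2"
      using tendstoD[OF lim, of "e/2"] e by simp
    have "(a \<otimes>\<^bsub>L\<^esub> s n) k y = (\<Sum>j\<in>{- int M..int M}. a j y * s n (k - j) (th j y))" for n
      unfolding L_mult[OF a(1) sL] by (rule fin) (auto simp: a(2))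
    moreover have "(\<lambda>n. a j y * s n (k - j) (th j y)) \<longlonglongrightarrow> 0" for j
    proof (cases "y \<in> dm j")
      case True
      \<comment> \<open>With \<open>a\<close> on the left the coefficients of \<open>s n\<close> are
        evaluated at \<open>th j y\<close>, so invariance of \<open>V\<close> is used; with
        \<open>a\<close> on the right they are evaluated at \<open>y\<close>.\<close>
      then have "th j y \<in> V" using clos_invD(3)[OF V y] by simp
      then show ?thesis by (intro tendsto_mult_right_zero sn)
    qed (simp add: L_zero_off[OF a(1)])
    then have "(\<lambda>n. \<Sum>j\<in>{- int M..int M}. a j y * s n (k - j) (th j y)) \<longlonglongrightarrow> 0"
      by (rule tendsto_null_sum)
    ultimately have lim: "(\<lambda>n. (a \<otimes>\<^bsub>L\<^esub> s n) k y) \<longlonglongrightarrow> 0" by simp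
    have 2: "\<forall>\<^sub>F n in sequentially. cmod ((a \<otimes>\<^bsub>L\<^esub> s n) k y) < e/2"
      using tendstoD[OF lim, of "e/2"] e by simp
    have 3: "\<forall>\<^sub>F n in sequentially. n \<ge> m" by (rule eventually_ge_at_top)
    from 1 2 3 show ?thesis
    proof eventually_elim
      case (elim n)
      let ?d = "t n \<ominus>\<^bsub>L\<^esub> a"
      have d: "?d \<in> carrier L" using tL a(1) by simp
      have "env_norm L (s n) * env_norm L ?d \<le> B * (e / (2 * B))"
        using B a(3)[OF elim(3)] L.env_norm_nonneg[OF d] by (intro mult_mono) auto
      then have small: "env_norm L (s n) * env_norm L ?d \<le> e/2" using B by simp
      have t: "t n = a \<oplus>\<^bsub>L\<^esub> ?d"
        by (simp add: L_minus[OF a(1)] L_ops)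
      have "s n \<otimes>\<^bsub>L\<^esub> t n = s n \<otimes>\<^bsub>L\<^esub> a \<oplus>\<^bsub>L\<^esub> s n \<otimes>\<^bsub>L\<^esub> ?d"
        by (subst t) (rule L.r_distr[OF a(1) d sL])
      then have "cmod ((s n \<otimes>\<^bsub>L\<^esub> t n) k y) \<le> cmod ((s n \<otimes>\<^bsub>L\<^esub> a) k y) + cmod ((s n \<otimes>\<^bsub>L\<^esub> ?d) k y)"
        by (simp only: L_simps norm_triangle_ineq)
      also have "cmod ((s n \<otimes>\<^bsub>L\<^esub> ?d) k y) \<le> env_norm L (s n) * env_norm L ?d"
        by (rule order_trans[OF cmod_le_env_norm[OF L.m_closed[OF sL d]] L.env_norm_mult[OF sL d]])
      finally have A: "cmod ((s n \<otimes>\<^bsub>L\<^esub> t n) k y) \<le> e" using elim(1) small by linarith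
      have "t n \<otimes>\<^bsub>L\<^esub> s n = a \<otimes>\<^bsub>L\<^esub> s n \<oplus>\<^bsub>L\<^esub> ?d \<otimes>\<^bsub>L\<^esub> s n"
        by (subst t) (rule L.l_distr[OF a(1) d sL])
      then have "cmod ((t n \<otimes>\<^bsub>L\<^esub> s n) k y) \<le> cmod ((a \<otimes>\<^bsub>L\<^esub> s n) k y) + cmod ((?d \<otimes>\<^bsub>L\<^esub> s n) k y)"
        by (simp only: L_simps norm_triangle_ineq)
      also have "cmod ((?d \<otimes>\<^bsub>L\<^esub> s n) k y) \<le> env_norm L ?d * env_norm L (s n)"
        by (rule order_trans[OF cmod_le_env_norm[OF L.m_closed[OF d sL]] L.env_norm_mult[OF d sL]])
      also have "env_norm L ?d * env_norm L (s n) = env_norm L (s n) * env_norm L ?d" by simp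
      finally have "cmod ((t n \<otimes>\<^bsub>L\<^esub> s n) k y) \<le> e" using elim(2) small by linarith
      with A show ?case by simp
    qed
  qed
  show "null_on V (\<lambda>n. s n \<otimes>\<^bsub>L\<^esub> t n)"
    unfolding null_on_def
    by (intro allI ballI tendsto_0_leI, rule eventually_mono, rule main) auto
  show "null_on V (\<lambda>n. t n \<otimes>\<^bsub>L\<^esub> s n)"
    unfolding null_on_def
    by (intro allI ballI tendsto_0_leI, rule eventually_mono, rule main) auto
qed

text \<open>Closedness rests on \<open>cmod_le_env_norm\<close>: a seminorm error of size
  \<open>e\<close> moves each coefficient by at most \<open>e\<close> at each point.\<close>

lemma
  assumes V: "V \<in> clos_inv Y F f"
  shows ideal_of_closed_ideal: "ideal_of V \<in> closed_ideals (enveloping_cstar L)"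
    and class_in_ideal_of: "s \<in> env_cauchy L \<Longrightarrow> env_class L s \<in> ideal_of V \<longleftrightarrow> null_on V s"
proof -
  have zero: "null_on V (\<lambda>_. \<zero>\<^bsub>L\<^esub>)" by (simp add: null_on_def L_simps)
  have add: "null_on V (\<lambda>n. s n \<oplus>\<^bsub>L\<^esub> t n)" if "null_on V s" "null_on V t" for s t
    using that unfolding null_on_def L_simps by (auto intro: tendsto_add_zero)
  have lim: "null_on V s" if s: "s \<in> env_cauchy L" and
    approx: "\<And>e. e > 0 \<Longrightarrow> \<exists>t\<in>env_cauchy L. null_on V t \<and> (\<forall>\<^sub>F n in sequentially. env_norm L (t n \<ominus>\<^bsub>L\<^esub> s n) < e)" for s
    unfolding null_on_def
  proof (intro allI ballI tendsto_0_leI)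
    fix k y and e :: real assume y: "y \<in> V" and "e > 0"
    then have e: "e/2 > 0" by simp
    obtain t where t: "t \<in> env_cauchy L" "null_on V t" "\<forall>\<^sub>F n in sequentially. env_norm L (t n \<ominus>\<^bsub>L\<^esub> s n) < e/2"
      using approx[OF e] by blast
    have "(\<lambda>n. t n k y) \<longlonglongrightarrow> 0" using t(2) y by (simp add: null_on_def)
    then have "\<forall>\<^sub>F n in sequentially. cmod (t n k y) < e/2"
      using tendstoD[of "\<lambda>n. t n k y" 0 sequentially "e/2"] e by simp
    with t(3) show "\<forall>\<^sub>F n in sequentially. cmod (s n k y) \<le> e"
    proof eventually_elim
      case (elim n)
      note sn = L.cauchyD[OF s, of n] and tn = L.cauchyD[OF t(1), of n]
      have "cmod ((t n \<ominus>\<^bsub>L\<^esub> s n) k y) \<le> env_norm L (t n \<ominus>\<^bsub>L\<^esub> s n)"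
        using sn tn by (intro cmod_le_env_norm) simp
      then have "cmod (t n k y - s n k y) < e/2" using elim(1) by (simp add: L_minus[OF sn])
      moreover have "cmod (s n k y) \<le> cmod (t n k y) + cmod (t n k y - s n k y)"
        using norm_triangle_sub[of "s n k y" "t n k y"] by (simp add: norm_minus_commute)
      ultimately show ?case using elim(2) by simp
    qed
  qed
  note I = L.closed_idealsI[of "null_on V", OF zero add null_on_mult(1)[OF V] null_on_mult(2)[OF V] lim]
  show "ideal_of V \<in> closed_ideals (enveloping_cstar L)"
    unfolding ideal_of_def by (rule I(1))
  show "s \<in> env_cauchy L \<Longrightarrow> env_class L s \<in> ideal_of V \<longleftrightarrow> null_on V s"
    unfolding ideal_of_def by (rule I(2))
qed

lemma emb_in_ideal_of:
  assumes V: "V \<in> clos_inv Y F f" and h: "h \<in> CY"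
  shows "env_class L (\<lambda>_. emb h) \<in> ideal_of V \<longleftrightarrow> h \<in> C_van Y (topspace Y - V)"
proof -
  have "env_class L (\<lambda>_. emb h) \<in> ideal_of V \<longleftrightarrow> (\<forall>y\<in>V. h y = 0)"
    unfolding class_in_ideal_of[OF V L.cauchy_const[OF emb_closed(1)[OF h]]]
    by (auto simp: null_on_def monomial_def LIMSEQ_const_iff)
  also have "\<dots> \<longleftrightarrow> h \<in> C_van Y (topspace Y - V)"
    using h by (auto simp: C_van_def)
  finally show ?thesis .
qed

section \<open>From a closed ideal to a closed invariant set and back\<close>

definition diag :: "(nat \<Rightarrow> int \<Rightarrow> 'a \<Rightarrow> complex) set set \<Rightarrow> ('a \<Rightarrow> complex) set" where
  "diag J = {h \<in> CY. env_class L (\<lambda>_. emb h) \<in> J}"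

definition zeros :: "(nat \<Rightarrow> int \<Rightarrow> 'a \<Rightarrow> complex) set set \<Rightarrow> 'a set" where
  "zeros J = {y \<in> topspace Y. \<forall>h\<in>diag J. h y = 0}"

text \<open>The functions in \<open>J\<close> form a closed ideal of \<open>C(Y)\<close>, and such
  an ideal is determined by its zero set.\<close>

lemma diag_eq:
  assumes J: "J \<in> closed_ideals (enveloping_cstar L)"
  shows "diag J = C_van Y (topspace Y - zeros J)"
proof (intro Set.set_eqI iffI)
  fix h assume "h \<in> C_van Y (topspace Y - zeros J)"
  then have h: "h \<in> CY" and van: "\<And>y. y \<in> topspace Y \<Longrightarrow> \<forall>k\<in>diag J. k y = 0 \<Longrightarrow> h y = 0"
    by (auto simp: C_van_def zeros_def)
  note c = L.cauchy_const[OF emb_closed(1)]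
  show "h \<in> diag J"
  proof (rule closed_ideal_of_continuous_functions[OF _ _ _ _ _ h van])
    show "diag J \<subseteq> CY" by (auto simp: diag_def)
    have "emb (\<lambda>_. 0) = \<zero>\<^bsub>L\<^esub>" by (auto simp: monomial_def L_ops fun_eq_iff)
    then show "(\<lambda>_. 0) \<in> diag J"
      using L.closed_ideal_zero[OF J] by (simp add: diag_def C_van_def)
  next
    fix k l assume k: "k \<in> diag J" and l: "l \<in> diag J"
    then have kl: "k \<in> CY" "l \<in> CY" by (auto simp: diag_def)
    have "emb (\<lambda>y. k y + l y) = emb k \<oplus>\<^bsub>L\<^esub> emb l" by (auto simp: monomial_def L_ops fun_eq_iff)
    moreover have "(\<lambda>y. k y + l y) \<in> CY"
      using kl by (auto simp: C_van_def intro: continuous_map_add)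
    ultimately show "(\<lambda>y. k y + l y) \<in> diag J"
      using L.closed_ideal_add[OF J c[OF kl(1)] c[OF kl(2)]] k l by (simp add: diag_def)
  next
    fix k l assume k: "k \<in> CY" and l: "l \<in> diag J"
    then have lC: "l \<in> CY" by (auto simp: diag_def)
    have "emb (\<lambda>y. k y * l y) = emb k \<otimes>\<^bsub>L\<^esub> emb l"
      by (intro ext, unfold emb_mult[OF k emb_closed(1)[OF lC]]) (simp add: monomial_def)
    moreover have "(\<lambda>y. k y * l y) \<in> CY"
      using k lC by (auto simp: C_van_def intro: continuous_map_complex_mult)
    ultimately show "(\<lambda>y. k y * l y) \<in> diag J"
      using L.closed_ideal_mult(2)[OF J c[OF lC] c[OF k]] l by (simp add: diag_def)
  next
    fix k assume k: "k \<in> CY" and approx: "\<And>e. e > 0 \<Longrightarrow> \<exists>l\<in>diag J. \<forall>y. cmod (l y - k y) \<le> e"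
    have "env_class L (\<lambda>_. emb k) \<in> J"
    proof (rule L.closed_ideal_limit[OF J c[OF k]])
      fix e :: real assume "e > 0"
      then obtain l where l: "l \<in> diag J" "\<And>y. cmod (l y - k y) \<le> e" using approx by blast
      then have lC: "l \<in> CY" by (simp add: diag_def)
      have d: "(\<lambda>y. l y - k y) \<in> CY" using k lC by (auto simp: C_van_def intro: continuous_map_diff)
      have "emb l \<ominus>\<^bsub>L\<^esub> emb k = emb (\<lambda>y. l y - k y)"
        by (intro ext) (simp add: L_minus_apply[OF emb_closed(1)[OF k]], simp add: monomial_def)
      then have le: "env_norm L (emb l \<ominus>\<^bsub>L\<^esub> emb k) \<le> e"
        using order_trans[OF env_norm_emb[OF d] sup_norm_leI[OF l(2)]] by simp
      have "env_class L (\<lambda>_. emb l) \<in> J" using l(1) by (simp add: diag_def)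
      then show "\<exists>t\<in>env_cauchy L. env_class L t \<in> J \<and> (\<forall>\<^sub>F n in sequentially. env_norm L (t n \<ominus>\<^bsub>L\<^esub> emb k) \<le> e)"
        using le c[OF lC] by (intro bexI[of _ "\<lambda>_. emb l"]) auto
    qed
    then show "k \<in> diag J" using k by (simp add: diag_def)
  qed
qed (auto simp: diag_def zeros_def C_van_def)

text \<open>Conjugating \<open>h\<close> by the partial isometry of degree \<open>k\<close> gives
  \<open>h \<circ> th k\<close>, cut off to \<open>dm k\<close>. It stays in the ideal, so it
  vanishes at the common zero \<open>y\<close>, which says that \<open>h\<close> vanishes at
  \<open>th k y\<close>.\<close>

lemma zeros_clos_inv:
  assumes J: "J \<in> closed_ideals (enveloping_cstar L)"
  shows "zeros J \<in> clos_inv Y F f"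
proof (rule clos_invI)
  have z: "(\<lambda>_. 0) \<in> diag J" unfolding diag_eq[OF J] by (simp add: C_van_def)
  have "zeros J = (\<Inter>h\<in>diag J. {y \<in> topspace Y. h y \<in> {0}})"
    using z by (auto simp: zeros_def)
  moreover have "closedin Y {y \<in> topspace Y. h y \<in> {0}}" if "h \<in> diag J" for h
  proof (rule closedin_continuous_map_preimage)
    show "continuous_map Y euclidean h" using that by (simp add: diag_def C_van_def)
  qed simp
  ultimately show "closedin Y (zeros J)" using z by auto
  fix k y assume y: "y \<in> zeros J" "y \<in> dm k"
  have "h (th k y) = 0" if h: "h \<in> diag J" for h
  proof -
    have hC: "h \<in> CY" using h by (simp add: diag_def)
    let ?v = "monomial k (unit_on (dm k))" and ?w = "monomial (- k) (unit_on (dm (- k)))"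
    let ?p = "\<lambda>y. if y \<in> dm k then h (th k y) else 0"
    have v: "?v \<in> carrier L" "?w \<in> carrier L" using monomial_closed(1)[OF unit_on_dm] by auto
    note e = emb_closed(1)[OF hC]
    note c = L.cauchy_const
    have eq: "?v \<otimes>\<^bsub>L\<^esub> emb h \<otimes>\<^bsub>L\<^esub> ?w = emb ?p"
    proof (intro ext)
      fix n z
      have "(?v \<otimes>\<^bsub>L\<^esub> emb h \<otimes>\<^bsub>L\<^esub> ?w) n z
          = unit_on (dm k) z * emb h n (th k z) * unit_on (dm (- k)) (th (n + k) z)"
        unfolding mult_monomial[OF unit_on_dm L.m_closed[OF v(1) e]]
        unfolding monomial_mult[OF unit_on_dm e] by simp
      also have "\<dots> = emb ?p n z"
        using th_inverse(1)[of z k] by (auto simp: monomial_def unit_on_def)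
      finally show "(?v \<otimes>\<^bsub>L\<^esub> emb h \<otimes>\<^bsub>L\<^esub> ?w) n z = emb ?p n z" .
    qed
    have "env_class L (\<lambda>_. emb h) \<in> J" using h by (simp add: diag_def)
    then have "env_class L (\<lambda>_. ?v \<otimes>\<^bsub>L\<^esub> emb h \<otimes>\<^bsub>L\<^esub> ?w) \<in> J"
      by (intro L.closed_ideal_mult(1)[OF J c[OF L.m_closed[OF v(1) e]] c[OF v(2)]]
          L.closed_ideal_mult(2)[OF J c[OF e] c[OF v(1)]])
    then have "env_class L (\<lambda>_. emb ?p) \<in> J" unfolding eq .
    moreover have "?p \<in> CY"
      using C_van_dm_pullback[OF C_van_cont[OF hC]] dm_subset by (rule C_van_mono)
    ultimately have p: "?p \<in> diag J" unfolding diag_def by (intro CollectI conjI)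
    have "\<forall>h\<in>diag J. h y = 0" using y(1) by (simp add: zeros_def)
    from bspec[OF this p] show ?thesis using y(2) by simp
  qed
  then show "th k y \<in> zeros J" using th_mem[OF y(2)] by (simp add: zeros_def)
qed

lemma coeff_in_diag:
  assumes J: "J \<in> closed_ideals (enveloping_cstar L)" and s: "s \<in> env_cauchy L" "env_class L s \<in> J"
    and h: "h \<in> C_van Y (dm k)"
    and lim: "\<And>e. e > 0 \<Longrightarrow> \<forall>\<^sub>F n in sequentially. \<forall>y. cmod (s n k y - h y) \<le> e"
  shows "h \<in> diag J"
proof -
  let ?w = "monomial (- k) (unit_on (dm (- k)))"
  have w: "?w \<in> carrier L" by (rule monomial_closed(1)[OF unit_on_dm])
  have hC: "h \<in> CY" using h dm_subset by (rule C_van_mono)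
  note c = L.cauchy_const[OF w]
  \<comment> \<open>Since \<open>th k\<close> maps \<open>dm k\<close> into \<open>dm (- k)\<close>,
    the indicator is 1 wherever \<open>s n k\<close> can be nonzero; the coefficient moves from
    degree \<open>k\<close> to degree 0 unchanged.\<close>
  have eq: "(s n \<otimes>\<^bsub>L\<^esub> ?w) 0 y = s n k y" for n y
  proof -
    have "(s n \<otimes>\<^bsub>L\<^esub> ?w) 0 y = s n k y * unit_on (dm (- k)) (th k y)"
      unfolding mult_monomial[OF unit_on_dm L.cauchyD[OF s(1)]] by simp
    then show ?thesis
      using th_inverse(1)[of y k] L_zero_off[OF L.cauchyD[OF s(1)], of y k n]
      by (cases "y \<in> dm k") (auto simp: unit_on_def)
  qed
  have "env_class L (\<lambda>_. emb h) \<in> J"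
    by (rule closed_ideal_diagonal[OF J L.cauchy_mult[OF s(1) c] L.closed_ideal_mult(1)[OF J s(1) c s(2)] hC])
      (unfold eq, rule lim)
  then show ?thesis using hC by (simp add: diag_def)
qed

text \<open>The term of degree \<open>k\<close> is \<open>emb (h k)\<close>, which lies in
  \<open>J\<close>, times the partial isometry of degree \<open>k\<close>.\<close>

lemma finite_support_in_ideal:
  assumes J: "J \<in> closed_ideals (enveloping_cstar L)" and "finite S"
    and hm: "\<And>n. h n \<in> C_van Y (dm n)" and hJ: "\<And>n. h n \<in> diag J"
  shows "(\<lambda>n y. if n \<in> S then h n y else 0) \<in> carrier L
    \<and> env_class L (\<lambda>_ n y. if n \<in> S then h n y else 0) \<in> J"
  using assms(2)
proof (induction S rule: finite_induct)
  case empty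
  then show ?case using L.closed_ideal_zero[OF J] L.zero_closed by (simp add: L_ops)
next
  case (insert k S)
  let ?x = "\<lambda>n y. if n \<in> S then h n y else 0"
  have hC: "h k \<in> CY" "env_class L (\<lambda>_. emb (h k)) \<in> J" using hJ[of k] by (simp_all add: diag_def)
  have u: "monomial k (unit_on (dm k)) \<in> carrier L" by (rule monomial_closed(1)[OF unit_on_dm])
  note c = L.cauchy_const
  have m: "monomial k (h k) = emb (h k) \<otimes>\<^bsub>L\<^esub> monomial k (unit_on (dm k))"
  proof (intro ext)
    fix n y
    show "monomial k (h k) n y = (emb (h k) \<otimes>\<^bsub>L\<^esub> monomial k (unit_on (dm k))) n y"
      unfolding emb_mult[OF hC(1) u] using C_van_zero[OF hm, of y k] by (auto simp: monomial_def unit_on_def)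
  qed
  have mL: "monomial k (h k) \<in> carrier L" by (rule monomial_closed(1)[OF hm])
  have mJ: "env_class L (\<lambda>_. monomial k (h k)) \<in> J"
    unfolding m by (rule L.closed_ideal_mult(1)[OF J c[OF emb_closed(1)[OF hC(1)]] c[OF u] hC(2)])
  have x: "?x \<in> carrier L" "env_class L (\<lambda>_. ?x) \<in> J" using insert.IH by simp_all
  have eq: "(\<lambda>n y. if n \<in> insert k S then h n y else 0) = monomial k (h k) \<oplus>\<^bsub>L\<^esub> ?x"
    using insert.hyps by (auto simp: monomial_def L_ops fun_eq_iff)
  show ?case
    unfolding eq using L.closed_ideal_add[OF J c[OF mL] c[OF x(1)] mJ x(2)] L.a_closed[OF mL x(1)] by simp
qed

lemma ideal_of_zeros:
  assumes J: "J \<in> closed_ideals (enveloping_cstar L)"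
  shows "J = ideal_of (zeros J)"
proof (intro Set.set_eqI iffI)
  fix x assume x: "x \<in> J"
  then obtain s where s: "s \<in> env_cauchy L" "x = env_class L s"
    using L.closed_ideal_subset[OF J] by (auto simp: L.carrier_env)
  have "null_on (zeros J) s"
    unfolding null_on_def
  proof (intro allI ballI tendsto_0_leI)
    fix k y and e :: real assume y: "y \<in> zeros J" and e: "e > 0"
    obtain h where h: "h \<in> C_van Y (dm k)"
      "\<And>e. e > 0 \<Longrightarrow> \<forall>\<^sub>F n in sequentially. \<forall>y. cmod (s n k y - h y) \<le> e"
      using coeff_limit[OF s(1), of k] by blast
    have "h \<in> diag J" using coeff_in_diag[OF J s(1) _ h] x s(2) by simp
    then have "h y = 0" using y by (simp add: zeros_def)
    then show "\<forall>\<^sub>F n in sequentially. cmod (s n k y) \<le> e"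
      using h(2)[OF e] by (elim eventually_mono) (metis diff_zero)
  qed
  then show "x \<in> ideal_of (zeros J)" using s by (auto simp: ideal_of_def)
next
  fix x assume "x \<in> ideal_of (zeros J)"
  then obtain s where s: "s \<in> env_cauchy L" "null_on (zeros J) s" "x = env_class L s"
    by (auto simp: ideal_of_def)
  note sL = L.cauchyD[OF s(1)]
  have "\<forall>k. \<exists>h. h \<in> C_van Y (dm k) \<and> (\<forall>e>0. \<forall>\<^sub>F n in sequentially. \<forall>y. cmod (s n k y - h y) \<le> e)"
  proof
    fix k
    show "\<exists>h. h \<in> C_van Y (dm k) \<and> (\<forall>e>0. \<forall>\<^sub>F n in sequentially. \<forall>y. cmod (s n k y - h y) \<le> e)"
      by (rule coeff_limit[OF s(1), of k]) blast
  qed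
  then obtain h where "\<forall>k. h k \<in> C_van Y (dm k) \<and>
      (\<forall>e>0. \<forall>\<^sub>F n in sequentially. \<forall>y. cmod (s n k y - h k y) \<le> e)"
    using choice[of "\<lambda>k h. h \<in> C_van Y (dm k) \<and> (\<forall>e>0. \<forall>\<^sub>F n in sequentially. \<forall>y. cmod (s n k y - h y) \<le> e)"]
    by blast
  then have h: "\<And>k. h k \<in> C_van Y (dm k)"
    "\<And>k e. e > 0 \<Longrightarrow> \<forall>\<^sub>F n in sequentially. \<forall>y. cmod (s n k y - h k y) \<le> e" by simp_all
  have h0: "h k y = 0" if "y \<in> zeros J" for k y
  proof -
    have "(\<lambda>n. s n k y - h k y) \<longlonglongrightarrow> 0"
      by (rule tendsto_0_leI, rule eventually_mono, rule h(2)) auto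
    then have "(\<lambda>n. s n k y) \<longlonglongrightarrow> h k y" by (simp add: LIM_zero_iff)
    moreover have "(\<lambda>n. s n k y) \<longlonglongrightarrow> 0" using s(2) that by (simp add: null_on_def)
    ultimately show ?thesis by (rule LIMSEQ_unique)
  qed
  have hJ: "h k \<in> diag J" for k
    unfolding diag_eq[OF J] using h(1)[of k] h0 dm_subset[of k] by (auto simp: C_van_def)
  have "env_class L s \<in> J"
  proof (rule L.closed_ideal_limit[OF J s(1)])
    fix e :: real assume "e > 0"
    \<comment> \<open>Four errors: from \<open>q\<close> to the Fejer mean of \<open>s n\<close>,
      then to that of \<open>s m\<close>, then to \<open>s m\<close>, and finally to
      \<open>s n\<close>.\<close>
    then have e: "e/4 > 0" by simp
    obtain m where m: "\<And>n. n \<ge> m \<Longrightarrow> env_norm L (s m \<ominus>\<^bsub>L\<^esub> s n) < e/4"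
      using L.cauchyD2[OF s(1) e] by blast
    have "\<forall>\<^sub>F N in sequentially. nrm L (s m \<ominus>\<^bsub>L\<^esub> wt (fejer N) (s m)) < e/4"
      using wt_tendsto[OF sL fejer_bound fejer_tendsto, of m] e by (rule order_tendstoD(2))
    then obtain N where N: "nrm L (s m \<ominus>\<^bsub>L\<^esub> wt (fejer N) (s m)) < e/4"
      by (auto simp: eventually_sequentially)
    let ?S = "{- int N..int N}"
    define k where "k n y = fejer N n * h n y" for n y
    have kC: "k n \<in> C_van Y (dm n)" for n
      using h(1)[of n] unfolding k_def C_van_def by (auto intro: continuous_map_complex_mult)
    have kJ: "k n \<in> diag J" for n
      using hJ[of n] unfolding diag_eq[OF J] k_def C_van_def by (auto intro: continuous_map_complex_mult)
    \<comment> \<open>The Fejer mean formed with the limit coefficients \<open>h\<close>: a finite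
      sum of terms in \<open>J\<close>, and independent of the sequence index.\<close>
    define q where "q n y = (if n \<in> ?S then k n y else 0)" for n y
    have q: "q \<in> carrier L" "env_class L (\<lambda>_. q) \<in> J"
      using finite_support_in_ideal[OF J _ kC kJ, of ?S] by (simp_all add: q_def[abs_def])
    have w: "wt (fejer N) (s n) \<in> carrier L" for n by (rule wt_closed[OF sL fejer_bound])
    \<comment> \<open>\<open>?S\<close> has \<open>2 * N + 1\<close> elements, so an error
      \<open>d\<close> in each degree adds up to \<open>e / 4\<close> in the l1 norm.\<close>
    define d where "d = e / 4 / (2 * real N + 1)"
    have d: "d > 0" using e by (simp add: d_def)
    have 0: "\<forall>\<^sub>F n in sequentially. \<forall>j\<in>?S. \<forall>y. cmod (s n j y - h j y) \<le> d"
      by (intro eventually_ball_finite ballI h(2) d) simp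
    have "\<forall>\<^sub>F n in sequentially. n \<ge> m" by (rule eventually_ge_at_top)
    with 0 have "\<forall>\<^sub>F n in sequentially. env_norm L (q \<ominus>\<^bsub>L\<^esub> s n) \<le> e"
    proof eventually_elim
      case (elim n)
      let ?f = "\<lambda>n. wt (fejer N) (s n)"
      have x: "?f n \<ominus>\<^bsub>L\<^esub> q \<in> carrier L" using w q by simp
      have 1: "env_norm L (q \<ominus>\<^bsub>L\<^esub> ?f n) \<le> e/4"
      proof -
        let ?M = "\<lambda>j. if j \<in> ?S then d else 0"
        have bd: "cmod ((?f n \<ominus>\<^bsub>L\<^esub> q) j y) \<le> ?M j" for j y
        proof (cases "j \<in> ?S")
          case True
          have "(?f n \<ominus>\<^bsub>L\<^esub> q) j y = fejer N j * (s n j y - h j y)"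
            unfolding L_minus_apply[OF q(1)] using True by (simp add: wt_def q_def k_def algebra_simps)
          moreover have "cmod (fejer N j) * cmod (s n j y - h j y) \<le> 1 * d"
            using elim(1) True fejer_bound d by (intro mult_mono) auto
          ultimately show ?thesis using True by (simp add: norm_mult)
        next
          case False
          then have "fejer N j = 0" by (intro fejer_eq_0) auto
          then show ?thesis unfolding L_minus_apply[OF q(1)] using False by (auto simp: wt_def q_def)
        qed
        have M: "?M summable_on UNIV" by (rule finite_nonzero_values_imp_summable_on) simp
        have "nrm L (?f n \<ominus>\<^bsub>L\<^esub> q) \<le> infsum ?M UNIV"
          by (rule L_carrierI(2)[OF L_cont[OF x] L_zero_off[OF x] bd M])
        also have "infsum ?M UNIV = sum ?M ?S"
          by (subst infsum_cong_neutral[of ?S UNIV ?M ?M]) auto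
        also have "\<dots> = (2 * real N + 1) * d" by simp
        also have "(2 * real N + 1) * d = e/4"
          unfolding d_def times_divide_eq_right[of _ "e/4"] by (rule nonzero_mult_div_cancel_left) linarith
        finally show ?thesis
          using L.env_norm_le_nrm[OF x] L.env_norm_minus_commute[OF q(1) w] by simp
      qed
      \<comment> \<open>\<open>N\<close> was chosen for \<open>s m\<close> alone. Contractivity of
        the Fejer means in the enveloping norm, with a constant free of \<open>N\<close>, carries
        the estimate over to the later terms.\<close>
      have 2: "env_norm L (?f n \<ominus>\<^bsub>L\<^esub> ?f m) \<le> e/4"
      proof -
        have eq: "?f n \<ominus>\<^bsub>L\<^esub> ?f m = wt (fejer N) (s n \<ominus>\<^bsub>L\<^esub> s m)"
          unfolding L_minus[OF w] L_minus[OF sL] by (simp add: wt_def algebra_simps)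
        have "env_norm L (?f n \<ominus>\<^bsub>L\<^esub> ?f m) \<le> env_norm L (s n \<ominus>\<^bsub>L\<^esub> s m)"
          unfolding eq using sL by (intro env_norm_fejer) simp
        then show ?thesis using m[OF elim(2)] L.env_norm_minus_commute[OF sL sL, of n m] by simp
      qed
      have 3: "env_norm L (?f m \<ominus>\<^bsub>L\<^esub> s m) \<le> e/4"
      proof -
        have "env_norm L (?f m \<ominus>\<^bsub>L\<^esub> s m) = env_norm L (s m \<ominus>\<^bsub>L\<^esub> ?f m)"
          by (rule L.env_norm_minus_commute[OF w sL])
        also have "\<dots> \<le> nrm L (s m \<ominus>\<^bsub>L\<^esub> ?f m)"
          using sL w by (intro L.env_norm_le_nrm) simp
        finally show ?thesis using N by simp
      qed
      have "env_norm L (q \<ominus>\<^bsub>L\<^esub> s n) \<le> env_norm L (q \<ominus>\<^bsub>L\<^esub> ?f n) + env_norm L (?f n \<ominus>\<^bsub>L\<^esub> s n)"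
        by (rule L.env_norm_minus_triangle[OF q(1) w sL])
      moreover have "env_norm L (?f n \<ominus>\<^bsub>L\<^esub> s n) \<le> env_norm L (?f n \<ominus>\<^bsub>L\<^esub> ?f m) + env_norm L (?f m \<ominus>\<^bsub>L\<^esub> s n)"
        by (rule L.env_norm_minus_triangle[OF w w sL])
      moreover have "env_norm L (?f m \<ominus>\<^bsub>L\<^esub> s n) \<le> env_norm L (?f m \<ominus>\<^bsub>L\<^esub> s m) + env_norm L (s m \<ominus>\<^bsub>L\<^esub> s n)"
        by (rule L.env_norm_minus_triangle[OF w sL sL])
      ultimately show ?case using 1 2 3 m[OF elim(2)] by linarith
    qed
    then show "\<exists>t\<in>env_cauchy L. env_class L t \<in> J \<and> (\<forall>\<^sub>F n in sequentially. env_norm L (t n \<ominus>\<^bsub>L\<^esub> s n) \<le> e)"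
      using q(2) L.cauchy_const[OF q(1)] by (intro bexI[of _ "\<lambda>_. q"]) auto
  qed
  then show "x \<in> J" using s(3) by simp
qed

theorem closed_ideals_eq: "closed_ideals (enveloping_cstar L) = ideal_of ` clos_inv Y F f"
proof
  show "closed_ideals (enveloping_cstar L) \<subseteq> ideal_of ` clos_inv Y F f"
    using ideal_of_zeros zeros_clos_inv by (intro subsetI image_eqI)
qed (use ideal_of_closed_ideal in auto)

end

section \<open>Inclusion-ordered lattices\<close>

lemma carrier_inclusion_order [simp]: "carrier (inclusion_order \<F>) = \<F>"
  and le_inclusion_order [simp]: "x \<sqsubseteq>\<^bsub>inclusion_order \<F>\<^esub> y \<longleftrightarrow> x \<subseteq> y"
  by (simp_all add: inclusion_order_def)

lemma Upper_inclusion_order: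
    "x \<in> \<F> \<Longrightarrow> y \<in> \<F> \<Longrightarrow> Upper (inclusion_order \<F>) {x, y} = {z \<in> \<F>. x \<subseteq> z \<and> y \<subseteq> z}"
  and Lower_inclusion_order:
    "x \<in> \<F> \<Longrightarrow> y \<in> \<F> \<Longrightarrow> Lower (inclusion_order \<F>) {x, y} = {z \<in> \<F>. z \<subseteq> x \<and> z \<subseteq> y}"
  unfolding Upper_def Lower_def carrier_inclusion_order le_inclusion_order by blast+

lemma least_Upper_inclusion_order:
  "x \<in> \<F> \<Longrightarrow> y \<in> \<F> \<Longrightarrow> least (inclusion_order \<F>) s (Upper (inclusion_order \<F>) {x, y})
    \<longleftrightarrow> s \<in> \<F> \<and> x \<subseteq> s \<and> y \<subseteq> s \<and> (\<forall>z\<in>\<F>. x \<subseteq> z \<longrightarrow> y \<subseteq> z \<longrightarrow> s \<subseteq> z)"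
  unfolding least_def carrier_inclusion_order le_inclusion_order
  by (subst (1 2 3) Upper_inclusion_order) blast+

lemma greatest_Lower_inclusion_order:
  "x \<in> \<F> \<Longrightarrow> y \<in> \<F> \<Longrightarrow> greatest (inclusion_order \<F>) s (Lower (inclusion_order \<F>) {x, y})
    \<longleftrightarrow> s \<in> \<F> \<and> s \<subseteq> x \<and> s \<subseteq> y \<and> (\<forall>z\<in>\<F>. z \<subseteq> x \<longrightarrow> z \<subseteq> y \<longrightarrow> z \<subseteq> s)"
  unfolding greatest_def carrier_inclusion_order le_inclusion_order
  by (subst (1 2 3) Lower_inclusion_order) blast+

lemma join_inclusion_order:
  assumes "x \<in> \<F>" "y \<in> \<F>" "s \<in> \<F>" "x \<subseteq> s" "y \<subseteq> s" "\<And>z. z \<in> \<F> \<Longrightarrow> x \<subseteq> z \<Longrightarrow> y \<subseteq> z \<Longrightarrow> s \<subseteq> z"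
  shows "x \<squnion>\<^bsub>inclusion_order \<F>\<^esub> y = s"
  unfolding join_def sup_def least_Upper_inclusion_order[OF assms(1,2)]
  using assms by (intro some_equality) auto

lemma meet_inclusion_order:
  assumes "x \<in> \<F>" "y \<in> \<F>" "s \<in> \<F>" "s \<subseteq> x" "s \<subseteq> y" "\<And>z. z \<in> \<F> \<Longrightarrow> z \<subseteq> x \<Longrightarrow> z \<subseteq> y \<Longrightarrow> z \<subseteq> s"
  shows "x \<sqinter>\<^bsub>inclusion_order \<F>\<^esub> y = s"
  unfolding meet_def inf_def greatest_Lower_inclusion_order[OF assms(1,2)]
  using assms by (intro some_equality) auto

lemma lattice_inclusion_order:
  assumes "\<And>x y. x \<in> \<F> \<Longrightarrow> y \<in> \<F> \<Longrightarrow> \<exists>s\<in>\<F>. x \<subseteq> s \<and> y \<subseteq> s \<and> (\<forall>z\<in>\<F>. x \<subseteq> z \<longrightarrow> y \<subseteq> z \<longrightarrow> s \<subseteq> z)"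
    and "\<And>x y. x \<in> \<F> \<Longrightarrow> y \<in> \<F> \<Longrightarrow> \<exists>s\<in>\<F>. s \<subseteq> x \<and> s \<subseteq> y \<and> (\<forall>z\<in>\<F>. z \<subseteq> x \<longrightarrow> z \<subseteq> y \<longrightarrow> z \<subseteq> s)"
  shows "Lattice.lattice (inclusion_order \<F>)"
proof -
  interpret partial_order "inclusion_order \<F>"
    by unfold_locales (auto simp: inclusion_order_def)
  show ?thesis
  proof unfold_locales
    fix x y assume xy: "x \<in> carrier (inclusion_order \<F>)" "y \<in> carrier (inclusion_order \<F>)"
    then have xy: "x \<in> \<F>" "y \<in> \<F>" by simp_all
    show "\<exists>s. least (inclusion_order \<F>) s (Upper (inclusion_order \<F>) {x, y})"
      unfolding least_Upper_inclusion_order[OF xy] using assms(1)[OF xy] by blast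
    show "\<exists>s. greatest (inclusion_order \<F>) s (Lower (inclusion_order \<F>) {x, y})"
      unfolding greatest_Lower_inclusion_order[OF xy] using assms(2)[OF xy] by blast
  qed
qed

text \<open>Joins and meets are transported from \<open>\<F>\<close> because the image families need
  not be closed under intersection: for non-injective \<open>\<alpha>\<close>, two invariant sets
  may meet in a set that is not invariant, as \<open>{u, y}\<close> and \<open>{w, z, y}\<close> do
  in the example at \<open>invariant_sets\<close>. In the application \<open>p\<close> projects from
  the extension to \<open>X\<close> and \<open>k\<close> sends an invariant set to its
  ideal.\<close>

lemma lattice_anti_isoI:
  assumes Un: "\<And>V W. V \<in> \<F> \<Longrightarrow> W \<in> \<F> \<Longrightarrow> V \<union> W \<in> \<F>"
    and Int: "\<And>V W. V \<in> \<F> \<Longrightarrow> W \<in> \<F> \<Longrightarrow> V \<inter> W \<in> \<F>"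
    and p: "\<And>V W. V \<in> \<F> \<Longrightarrow> W \<in> \<F> \<Longrightarrow> p V \<subseteq> p W \<longleftrightarrow> V \<subseteq> W"
    and k: "\<And>V W. V \<in> \<F> \<Longrightarrow> W \<in> \<F> \<Longrightarrow> k V \<subseteq> k W \<longleftrightarrow> W \<subseteq> V"
    and g: "\<And>V. V \<in> \<F> \<Longrightarrow> g (p V) = k V"
  shows "lattice_anti_iso (inclusion_order (p ` \<F>)) (inclusion_order (k ` \<F>)) g"
proof -
  let ?P = "inclusion_order (p ` \<F>)" and ?Q = "inclusion_order (k ` \<F>)"
  have p1: "p (V \<union> W) \<in> p ` \<F>" "p V \<subseteq> p (V \<union> W)" "p W \<subseteq> p (V \<union> W)"
      "\<And>z. z \<in> p ` \<F> \<Longrightarrow> p V \<subseteq> z \<Longrightarrow> p W \<subseteq> z \<Longrightarrow> p (V \<union> W) \<subseteq> z"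
    and p2: "p (V \<inter> W) \<in> p ` \<F>" "p (V \<inter> W) \<subseteq> p V" "p (V \<inter> W) \<subseteq> p W"
      "\<And>z. z \<in> p ` \<F> \<Longrightarrow> z \<subseteq> p V \<Longrightarrow> z \<subseteq> p W \<Longrightarrow> z \<subseteq> p (V \<inter> W)"
    and k1: "k (V \<inter> W) \<in> k ` \<F>" "k V \<subseteq> k (V \<inter> W)" "k W \<subseteq> k (V \<inter> W)"
      "\<And>z. z \<in> k ` \<F> \<Longrightarrow> k V \<subseteq> z \<Longrightarrow> k W \<subseteq> z \<Longrightarrow> k (V \<inter> W) \<subseteq> z"
    and k2: "k (V \<union> W) \<in> k ` \<F>" "k (V \<union> W) \<subseteq> k V" "k (V \<union> W) \<subseteq> k W"
      "\<And>z. z \<in> k ` \<F> \<Longrightarrow> z \<subseteq> k V \<Longrightarrow> z \<subseteq> k W \<Longrightarrow> z \<subseteq> k (V \<union> W)"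
    if VW: "V \<in> \<F>" "W \<in> \<F>" for V W
    by (simp_all add: VW Un Int p k) (elim imageE, simp add: VW Un Int p k)+
  have pj: "p V \<squnion>\<^bsub>?P\<^esub> p W = p (V \<union> W)" if VW: "V \<in> \<F>" "W \<in> \<F>" for V W
    using VW Un[OF VW] p1[OF VW] by (intro join_inclusion_order imageI)
  have pm: "p V \<sqinter>\<^bsub>?P\<^esub> p W = p (V \<inter> W)" if VW: "V \<in> \<F>" "W \<in> \<F>" for V W
    using VW Int[OF VW] p2[OF VW] by (intro meet_inclusion_order imageI)
  have kj: "k V \<squnion>\<^bsub>?Q\<^esub> k W = k (V \<inter> W)" if VW: "V \<in> \<F>" "W \<in> \<F>" for V W
    using VW Int[OF VW] k1[OF VW] by (intro join_inclusion_order imageI)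
  have km: "k V \<sqinter>\<^bsub>?Q\<^esub> k W = k (V \<union> W)" if VW: "V \<in> \<F>" "W \<in> \<F>" for V W
    using VW Un[OF VW] k2[OF VW] by (intro meet_inclusion_order imageI)
  have P: "Lattice.lattice ?P"
  proof (rule lattice_inclusion_order)
    fix x y assume "x \<in> p ` \<F>" "y \<in> p ` \<F>"
    then obtain V W where VW: "V \<in> \<F>" "W \<in> \<F>" and xy: "x = p V" "y = p W" by blast
    show "\<exists>s\<in>p ` \<F>. x \<subseteq> s \<and> y \<subseteq> s \<and> (\<forall>z\<in>p ` \<F>. x \<subseteq> z \<longrightarrow> y \<subseteq> z \<longrightarrow> s \<subseteq> z)"
      unfolding xy using p1[OF VW] by (intro bexI[of _ "p (V \<union> W)"] conjI ballI impI)
    show "\<exists>s\<in>p ` \<F>. s \<subseteq> x \<and> s \<subseteq> y \<and> (\<forall>z\<in>p ` \<F>. z \<subseteq> x \<longrightarrow> z \<subseteq> y \<longrightarrow> z \<subseteq> s)"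
      unfolding xy using p2[OF VW] by (intro bexI[of _ "p (V \<inter> W)"] conjI ballI impI)
  qed
  have Q: "Lattice.lattice ?Q"
  proof (rule lattice_inclusion_order)
    fix x y assume "x \<in> k ` \<F>" "y \<in> k ` \<F>"
    then obtain V W where VW: "V \<in> \<F>" "W \<in> \<F>" and xy: "x = k V" "y = k W" by blast
    show "\<exists>s\<in>k ` \<F>. x \<subseteq> s \<and> y \<subseteq> s \<and> (\<forall>z\<in>k ` \<F>. x \<subseteq> z \<longrightarrow> y \<subseteq> z \<longrightarrow> s \<subseteq> z)"
      unfolding xy using k1[OF VW] by (intro bexI[of _ "k (V \<inter> W)"] conjI ballI impI)
    show "\<exists>s\<in>k ` \<F>. s \<subseteq> x \<and> s \<subseteq> y \<and> (\<forall>z\<in>k ` \<F>. z \<subseteq> x \<longrightarrow> z \<subseteq> y \<longrightarrow> z \<subseteq> s)"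
      unfolding xy using k2[OF VW] by (intro bexI[of _ "k (V \<union> W)"] conjI ballI impI)
  qed
  have inj: "V = W" if "V \<in> \<F>" "W \<in> \<F>" "k V = k W" for V W
    using k[OF that(1,2)] k[OF that(2,1)] that(3) by blast
  have "bij_betw g (p ` \<F>) (k ` \<F>)"
    unfolding bij_betw_def
  proof
    show "inj_on g (p ` \<F>)"
    proof (rule inj_onI)
      fix x y assume "x \<in> p ` \<F>" "y \<in> p ` \<F>" and xy: "g x = g y"
      then obtain V W where VW: "V \<in> \<F>" "W \<in> \<F>" and eq: "x = p V" "y = p W" by blast
      then have "k V = k W" using xy g by simp
      then show "x = y" using inj[OF VW] eq by simp
    qed
    show "g ` p ` \<F> = k ` \<F>" using g by (auto simp: image_image)
  qed
  moreover have "\<forall>v\<in>p ` \<F>. \<forall>w\<in>p ` \<F>. g (v \<squnion>\<^bsub>?P\<^esub> w) = g v \<sqinter>\<^bsub>?Q\<^esub> g w \<and> g (v \<sqinter>\<^bsub>?P\<^esub> w) = g v \<squnion>\<^bsub>?Q\<^esub> g w"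
  proof (intro ballI)
    fix v w assume "v \<in> p ` \<F>" "w \<in> p ` \<F>"
    then obtain V W where VW: "V \<in> \<F>" "v = p V" "W \<in> \<F>" "w = p W" by blast
    then show "g (v \<squnion>\<^bsub>?P\<^esub> w) = g v \<sqinter>\<^bsub>?Q\<^esub> g w \<and> g (v \<sqinter>\<^bsub>?P\<^esub> w) = g v \<squnion>\<^bsub>?Q\<^esub> g w"
      by (simp add: pj pm kj km g Un Int)
  qed
  ultimately show ?thesis
    unfolding lattice_anti_iso_def using P Q by simp
qed

section \<open>The reversible extension\<close>

lemma closedin_adjoin_point:
  "C \<subseteq> insert None (Some ` topspace X) \<Longrightarrow> closedin (adjoin_point X) C \<longleftrightarrow> closedin X (Some -` C)"
proof -
  assume C: "C \<subseteq> insert None (Some ` topspace X)"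
  have "Some -` (insert None (Some ` topspace X) - C) = topspace X - Some -` C" by auto
  moreover have "Some -` C \<subseteq> topspace X" using C by auto
  ultimately show ?thesis
    using C by (simp add: closedin_def openin_adjoin_point topspace_adjoin_point)
qed

lemma continuous_map_Some: "continuous_map X (adjoin_point X) Some"
proof -
  have "{x \<in> topspace X. Some x \<in> U} = Some -` U" if "openin X (Some -` U)" for U
    using openin_subset[OF that] by auto
  then show ?thesis
    by (auto simp: continuous_map_def topspace_adjoin_point openin_adjoin_point)
qed

lemma compact_space_adjoin_point:
  assumes "compact_space X"
  shows "compact_space (adjoin_point X)"
proof -
  have "compactin (adjoin_point X) (Some ` topspace X)"
    using assms continuous_map_Some by (auto simp: compact_space_def intro: image_compactin)
  moreover have "compactin (adjoin_point X) {None}"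
    by (simp add: topspace_adjoin_point)
  ultimately have "compactin (adjoin_point X) ({None} \<union> Some ` topspace X)"
    by (intro compactin_Un)
  then show ?thesis by (simp add: compact_space_def topspace_adjoin_point)
qed

lemma Hausdorff_space_adjoin_point:
  assumes "Hausdorff_space X"
  shows "Hausdorff_space (adjoin_point X)"
  unfolding Hausdorff_space_def
proof (intro allI impI)
  let ?Z = "adjoin_point X"
  have oS: "openin ?Z (Some ` U)" if "openin X U" for U
    using that by (simp add: openin_adjoin_point inj_vimage_image_eq)
  have oN: "openin ?Z {None}" by (simp add: openin_adjoin_point vimage_def)
  fix x y assume xy: "x \<in> topspace ?Z \<and> y \<in> topspace ?Z \<and> x \<noteq> y"
  show "\<exists>U V. openin ?Z U \<and> openin ?Z V \<and> x \<in> U \<and> y \<in> V \<and> disjnt U V"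
  proof (cases x)
    case None
    then show ?thesis
      using xy oN oS[OF openin_topspace] by (intro exI[of _ "{None}"] exI[of _ "Some ` topspace X"])
        (auto simp: topspace_adjoin_point disjnt_def)
  next
    case x: (Some a)
    show ?thesis
    proof (cases y)
      case None
      then show ?thesis
        using xy oN oS[OF openin_topspace] by (intro exI[of _ "Some ` topspace X"] exI[of _ "{None}"])
          (auto simp: topspace_adjoin_point disjnt_def)
    next
      case y: (Some b)
      have "a \<in> topspace X" "b \<in> topspace X" "a \<noteq> b"
        using xy x y by (auto simp: topspace_adjoin_point)
      then obtain U V where UV: "openin X U" "openin X V" "a \<in> U" "b \<in> V" "disjnt U V"
        using assms unfolding Hausdorff_space_def by metis
      then show ?thesis
        using x y oS by (intro exI[of _ "Some ` U"] exI[of _ "Some ` V"]) (auto simp: disjnt_def)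
    qed
  qed
qed

lemma C_van_separates:
  assumes "compact_space T" "Hausdorff_space T" "closedin T V" "w \<in> topspace T" "w \<notin> V"
  obtains h where "h \<in> C_van T (topspace T - V)" "h w = 1"
proof -
  have "normal_space T"
    using assms compact_Hausdorff_or_regular_imp_normal_space by blast
  moreover have "closedin T {w}" using assms by (simp add: closedin_Hausdorff_singleton)
  ultimately obtain q where q: "continuous_map T euclideanreal q" "q ` V \<subseteq> {0}" "q ` {w} \<subseteq> {1}"
    using Urysohn_lemma_alt[of T V "{w}" 0 1] assms by (auto simp: disjnt_def)
  define h where "h y = (if y \<in> topspace T then complex_of_real (q y) else 0)" for y
  have "continuous_map T euclidean h"
    using continuous_map_of_real[OF q(1)] by (rule continuous_map_eq) (simp add: h_def)
  moreover have "h y = 0" if "y \<notin> topspace T - V" for y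
    using that q(2) by (auto simp: h_def)
  ultimately have "h \<in> C_van T (topspace T - V)" by (simp add: C_van_def)
  moreover have "h w = 1" using q(3) assms by (simp add: h_def)
  ultimately show thesis using that by blast
qed

locale reversible_extension =
  fixes X :: "'x topology" and D :: "'x set" and \<alpha> :: "'x \<Rightarrow> 'x"
  assumes compact_X: "compact_space X" and Hausdorff_X: "Hausdorff_space X"
    and D: "openin X D" "closedin X D"
    and \<alpha>: "continuous_map (subtopology X D) X \<alpha>"
    and R: "openin X (\<alpha> ` D)"
    and free_X: "no_periodic_points (topspace X) D \<alpha>"
begin

abbreviation "S \<equiv> topspace X"
abbreviation "P \<equiv> product_topology (\<lambda>_::nat. adjoin_point X) UNIV"
abbreviation "Y \<equiv> ext_space X D \<alpha>"
abbreviation "F \<equiv> ext_dom X D \<alpha>"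
abbreviation "G \<equiv> ext_ran X D \<alpha>"
abbreviation "\<beta> \<equiv> ext_map \<alpha>"

lemma D_subset: "D \<subseteq> S" and R_subset: "\<alpha> ` D \<subseteq> S"
  using openin_subset[OF D(1)] openin_subset[OF R] by auto

text \<open>The range is a continuous image of the compact set \<open>D\<close> in a Hausdorff
  space; being open by hypothesis, it is therefore clopen.\<close>

lemma closed_R: "closedin X (\<alpha> ` D)"
proof -
  have "compactin (subtopology X D) D"
    using closedin_compact_space[OF compact_X D(2)] by (simp add: compactin_subtopology)
  from image_compactin[OF this \<alpha>] show ?thesis
    by (rule compactin_imp_closedin[OF Hausdorff_X])
qed

lemma pow_ran_R: "pow_ran S D \<alpha> 1 = \<alpha> ` D"
proof -
  have "pow_dom S D \<alpha> 1 = D" using D_subset by (auto simp: pow_dom_def)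
  then show ?thesis by (simp add: pow_ran_def)
qed

text \<open>Membership in the extension is a condition on consecutive coordinates; the requirement
  \<open>x\<^sub>n \<in> \<Delta>\<^sub>n\<close> is then automatic.\<close>

definition link :: "'x option \<Rightarrow> 'x option \<Rightarrow> bool" where
  "link u v \<longleftrightarrow> (case v of
     None \<Rightarrow> (case u of None \<Rightarrow> True | Some a \<Rightarrow> a \<in> S \<and> a \<notin> \<alpha> ` D)
   | Some b \<Rightarrow> b \<in> D \<and> u = Some (\<alpha> b))"

definition Ext :: "(nat \<Rightarrow> 'x option) set" where
  "Ext = {x. x 0 \<in> Some ` S \<and> (\<forall>n. link (x n) (x (Suc n)))}"

lemma pow_dom_chain:
  assumes "y 0 \<in> S" "\<And>n. Suc n \<le> N \<Longrightarrow> y (Suc n) \<in> D \<and> \<alpha> (y (Suc n)) = y n" "n \<le> N"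
  shows "y n \<in> pow_dom S D \<alpha> n"
  using assms(3)
proof (induction n)
  case (Suc n)
  then show ?case using assms(2)[of n] pow_dom_Suc_left[OF D_subset R_subset] by simp
qed (use assms(1) in \<open>simp add: pow_dom_0\<close>)

lemma pow_dom_D: "y \<in> pow_dom S D \<alpha> (Suc n) \<Longrightarrow> y \<in> D"
  using pow_dom_Suc_left[OF D_subset R_subset] by blast

lemma ext_fin_subset: "ext_fin X D \<alpha> N \<subseteq> Ext"
proof
  fix x assume "x \<in> ext_fin X D \<alpha> N"
  then obtain y where y: "\<And>n. n \<le> N \<Longrightarrow> x n = Some (y n)" "\<And>n. n \<le> N \<Longrightarrow> y n \<in> pow_dom S D \<alpha> n"
    "\<And>n. n > N \<Longrightarrow> x n = None" "y N \<notin> \<alpha> ` D" "\<And>n. 1 \<le> n \<Longrightarrow> n \<le> N \<Longrightarrow> \<alpha> (y n) = y (n - 1)"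
    unfolding ext_fin_def pow_ran_R by auto
  have "link (x n) (x (Suc n))" for n
  proof -
    consider "Suc n \<le> N" | "n = N" | "n > N" by linarith
    then show ?thesis
    proof cases
      case 1
      then show ?thesis using y(1)[of n] y(1,2,5)[of "Suc n"] pow_dom_D by (auto simp: link_def)
    next
      case 2
      then show ?thesis using y(1,2)[of N] y(3)[of "Suc N"] y(4) by (auto simp: link_def pow_dom_def)
    next
      case 3
      then show ?thesis using y(3) by (simp add: link_def)
    qed
  qed
  then show "x \<in> Ext" using y(1,2)[of 0] by (simp add: Ext_def pow_dom_0)
qed

lemma ext_inf_subset: "ext_inf X D \<alpha> \<subseteq> Ext"
proof
  fix x assume "x \<in> ext_inf X D \<alpha>"
  then obtain y where y: "\<And>n. x n = Some (y n)" "\<And>n. y n \<in> pow_dom S D \<alpha> n" "\<And>n. 1 \<le> n \<Longrightarrow> \<alpha> (y n) = y (n - 1)"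
    unfolding ext_inf_def by auto
  have "link (x n) (x (Suc n))" for n
    using y(1)[of n] y(1,2,3)[of "Suc n"] pow_dom_D by (auto simp: link_def)
  then show "x \<in> Ext" using y(1,2)[of 0] by (simp add: Ext_def pow_dom_0)
qed

lemma Ext_D:
  assumes "x \<in> Ext"
  shows "x 0 = Some (ext_proj x)" "ext_proj x \<in> S" "link (x n) (x (Suc n))"
  using assms by (auto simp: Ext_def ext_proj_def)

lemma Ext_Some:
  assumes "x \<in> Ext" "x (Suc n) = Some b"
  shows "b \<in> D" "x n = Some (\<alpha> b)"
  using Ext_D(3)[OF assms(1), of n] assms(2) by (simp_all add: link_def)

lemma Ext_None:
  assumes "x \<in> Ext" "x n = None" "n \<le> m"
  shows "x m = None"
  using assms(3)
proof (induction m rule: dec_induct)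
  case (step m)
  then show ?case using Ext_Some(2)[OF assms(1), of m] by (cases "x (Suc m)") auto
qed (use assms in simp)

lemma Ext_eq: "(\<Union>N. ext_fin X D \<alpha> N) \<union> ext_inf X D \<alpha> = Ext"
proof
  show "(\<Union>N. ext_fin X D \<alpha> N) \<union> ext_inf X D \<alpha> \<subseteq> Ext"
    using ext_fin_subset ext_inf_subset by blast
  show "Ext \<subseteq> (\<Union>N. ext_fin X D \<alpha> N) \<union> ext_inf X D \<alpha>"
  proof
    fix x assume x: "x \<in> Ext"
    define y where "y n = the (x n)" for n
    have y0: "y 0 \<in> S" using Ext_D[OF x] by (simp add: y_def)
    have chain: "y (Suc n) \<in> D \<and> \<alpha> (y (Suc n)) = y n" if "x (Suc n) \<noteq> None" for n
      using Ext_Some[OF x, of n] that by (auto simp: y_def)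
    show "x \<in> (\<Union>N. ext_fin X D \<alpha> N) \<union> ext_inf X D \<alpha>"
    proof (cases "\<exists>n. x n = None")
      case False
      then have xS: "x n = Some (y n)" for n by (auto simp: y_def)
      have "y n \<in> pow_dom S D \<alpha> n" for n
        by (rule pow_dom_chain[of y n]) (use y0 chain False in auto)
      moreover have "\<alpha> (y n) = y (n - 1)" if "n \<ge> 1" for n
        using chain[of "n - 1"] False that by simp
      ultimately show ?thesis using xS unfolding ext_inf_def by blast
    next
      case True
      \<comment> \<open>\<open>M\<close> is positive because entry 0 is a point of \<open>X\<close>,
        so the last genuine entry has index \<open>N = M - 1\<close>. The link from it to
        \<open>None\<close> says that it lies outside the range.\<close>
      define M where "M = (LEAST n. x n = None)"
      have M: "x M = None" unfolding M_def using True by (rule LeastI_ex)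
      then have "M \<noteq> 0" using Ext_D(1)[OF x] by (cases M) simp_all
      then obtain N where N: "M = Suc N" using not0_implies_Suc by blast
      have nn: "x n \<noteq> None" if "n \<le> N" for n
        using not_less_Least[of n "\<lambda>n. x n = None"] that N by (simp add: M_def)
      then have xS: "x n = Some (y n)" if "n \<le> N" for n using that by (auto simp: y_def)
      have "y n \<in> pow_dom S D \<alpha> n" if "n \<le> N" for n
        by (rule pow_dom_chain[of y N]) (use y0 chain nn that in auto)
      moreover have "\<alpha> (y n) = y (n - 1)" if "1 \<le> n \<and> n \<le> N" for n
        using chain[of "n - 1"] nn[of n] that by simp
      moreover have "x n = None" if "n > N" for n
        using Ext_None[OF x M, of n] that N by simp
      moreover have "y N \<notin> \<alpha> ` D"
        using Ext_D(3)[OF x, of N] M N xS[of N] by (simp add: link_def)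
      ultimately have "x \<in> ext_fin X D \<alpha> N"
        using xS unfolding ext_fin_def pow_ran_R by blast
      then show ?thesis by blast
    qed
  qed
qed

section \<open>The extension is compact Hausdorff\<close>

lemma topspace_P: "x \<in> topspace P \<longleftrightarrow> (\<forall>n. x n \<in> insert None (Some ` S))"
  by (auto simp: PiE_iff topspace_adjoin_point)

lemma Ext_P: "Ext \<subseteq> topspace P"
proof
  fix x assume x: "x \<in> Ext"
  have "x n \<in> insert None (Some ` S)" for n
  proof (cases n)
    case (Suc m)
    show ?thesis
    proof (cases "x n")
      case (Some b)
      then show ?thesis using Ext_Some(1)[OF x, of m b] Suc D_subset by auto
    qed simp
  qed (use x in \<open>auto simp: Ext_def\<close>)
  then show "x \<in> topspace P" unfolding topspace_P by blast
qed

lemma Y_eq: "Y = subtopology P Ext"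
  by (simp add: ext_space_def Ext_eq)

lemma topspace_Y: "topspace Y = Ext"
  using Ext_P by (auto simp: Y_eq)

lemma cont_coord_P: "continuous_map P (adjoin_point X) (\<lambda>x. x n)"
  by (rule continuous_map_product_projection) simp

lemma cont_coord: "continuous_map Y (adjoin_point X) (\<lambda>x. x n)"
  unfolding Y_eq using cont_coord_P by (rule continuous_map_from_subtopology)

lemma closedin_coord: "closedin (adjoin_point X) C \<Longrightarrow> closedin P {x \<in> topspace P. x n \<in> C}"
  using cont_coord_P by (rule closedin_continuous_map_preimage)

text \<open>A link is a union of two closed conditions on neighbouring coordinates:
  \<open>x (Suc n)\<close> is \<open>None\<close> and \<open>x n\<close> avoids the range, closed
  because the range is open; or \<open>x (Suc n)\<close> lies in \<open>D\<close> and is mapped to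
  \<open>x n\<close>.\<close>

lemma closed_Ext: "closedin P Ext"
proof -
  let ?Z = "adjoin_point X"
  \<comment> \<open>\<open>\<alpha>\<close> extended by \<open>None\<close> off \<open>D\<close> is
    continuous since \<open>D\<close> is clopen; the second kind of link becomes an equality of two
    continuous maps into a Hausdorff space.\<close>
  define h where "h z = (case z of None \<Rightarrow> None | Some b \<Rightarrow> if b \<in> D then Some (\<alpha> b) else None)" for z
  have h: "continuous_map ?Z ?Z h"
    unfolding continuous_map_def
  proof (intro conjI allI impI)
    show "h \<in> topspace ?Z \<rightarrow> topspace ?Z"
      using R_subset by (auto simp: h_def topspace_adjoin_point image_subset_iff split: option.splits)
    fix U assume "openin ?Z U"
    then have U: "openin X (Some -` U)" by (simp add: openin_adjoin_point)
    have "openin (subtopology X D) {b \<in> topspace (subtopology X D). \<alpha> b \<in> Some -` U}"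
      using \<alpha> U by (rule openin_continuous_map_preimage)
    then have 1: "openin X {b \<in> topspace (subtopology X D). \<alpha> b \<in> Some -` U}"
      using D(1) by (simp add: openin_open_subtopology)
    have 2: "openin X (if None \<in> U then S - D else {})" using D by auto
    have "Some -` {z \<in> topspace ?Z. h z \<in> U}
        = {b \<in> topspace (subtopology X D). \<alpha> b \<in> Some -` U} \<union> (if None \<in> U then S - D else {})"
      using D_subset by (auto simp: h_def topspace_adjoin_point)
    then show "openin ?Z {z \<in> topspace ?Z. h z \<in> U}"
      unfolding openin_adjoin_point using openin_Un[OF 1 2] by simp
  qed
  have vim: "Some -` insert None (Some ` A) = A" "Some -` (Some ` A) = A" for A :: "'x set"
    by auto
  have cS: "closedin X (S - \<alpha> ` D)" using R by blast
  have cl: "closedin ?Z {None}" "closedin ?Z (insert None (Some ` (S - \<alpha> ` D)))"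
    "closedin ?Z (Some ` D)" "closedin ?Z (Some ` S)"
  proof -
    show "closedin ?Z {None}" by (subst closedin_adjoin_point) (auto simp: vimage_def)
    show "closedin ?Z (insert None (Some ` (S - \<alpha> ` D)))"
      by (subst closedin_adjoin_point) (auto simp only: vim cS)
    show "closedin ?Z (Some ` D)"
      using D_subset by (subst closedin_adjoin_point) (auto simp: vim D)
    show "closedin ?Z (Some ` S)"
      by (subst closedin_adjoin_point) (auto simp: vim)
  qed
  have "{x \<in> topspace P. link (x n) (x (Suc n))} =
      ({x \<in> topspace P. x (Suc n) \<in> {None}} \<inter> {x \<in> topspace P. x n \<in> insert None (Some ` (S - \<alpha> ` D))})
      \<union> ({x \<in> topspace P. x (Suc n) \<in> Some ` D} \<inter> {x \<in> topspace P. x n = h (x (Suc n))})" for n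
  proof (intro Set.set_eqI)
    fix x :: "nat \<Rightarrow> 'x option"
    have "link (x n) (x (Suc n)) \<longleftrightarrow>
      x (Suc n) = None \<and> x n \<in> insert None (Some ` (S - \<alpha> ` D)) \<or> x (Suc n) \<in> Some ` D \<and> x n = h (x (Suc n))"
      by (cases "x n"; cases "x (Suc n)") (auto simp: link_def h_def)
    then show "x \<in> {x \<in> topspace P. link (x n) (x (Suc n))} \<longleftrightarrow> x \<in>
      ({x \<in> topspace P. x (Suc n) \<in> {None}} \<inter> {x \<in> topspace P. x n \<in> insert None (Some ` (S - \<alpha> ` D))})
      \<union> ({x \<in> topspace P. x (Suc n) \<in> Some ` D} \<inter> {x \<in> topspace P. x n = h (x (Suc n))})"
      by blast
  qed
  moreover have "closedin P {x \<in> topspace P. x n = h (x (Suc n))}" for n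
    using closedin_continuous_maps_eq[OF Hausdorff_space_adjoin_point[OF Hausdorff_X] cont_coord_P
        continuous_map_compose[OF cont_coord_P h, of "Suc n"], of n] by (simp add: o_def)
  ultimately have "closedin P {x \<in> topspace P. link (x n) (x (Suc n))}" for n
    by (simp only:) (intro closedin_Un closedin_Int closedin_coord cl)
  then have "closedin P ({x \<in> topspace P. x 0 \<in> Some ` S} \<inter> (\<Inter>n. {x \<in> topspace P. link (x n) (x (Suc n))}))"
    by (intro closedin_Int closedin_coord cl closedin_INT) auto
  also have "{x \<in> topspace P. x 0 \<in> Some ` S} \<inter> (\<Inter>n. {x \<in> topspace P. link (x n) (x (Suc n))}) = Ext"
    using Ext_P by (auto simp: Ext_def)
  finally show ?thesis .
qed

lemma compact_P: "compact_space P"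
  using compact_space_adjoin_point[OF compact_X] by (simp add: compact_space_product_topology)

lemma Hausdorff_P: "Hausdorff_space P"
  using Hausdorff_space_adjoin_point[OF Hausdorff_X] by (simp add: Hausdorff_space_product_topology)

lemma compact_Y: "compact_space Y"
  unfolding Y_eq by (rule compact_space_subtopology[OF closedin_compact_space[OF compact_P closed_Ext]])

lemma Hausdorff_Y: "Hausdorff_space Y"
  unfolding Y_eq using Hausdorff_P by (rule Hausdorff_space_subtopology)

lemma cont_proj: "continuous_map Y X ext_proj"
  unfolding continuous_map_def
proof (intro conjI allI impI)
  show "ext_proj \<in> topspace Y \<rightarrow> topspace X" using Ext_D(2) by (auto simp: topspace_Y)
  fix U assume U: "openin X U"
  have "openin Y {x \<in> topspace Y. x 0 \<in> Some ` U}"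
    using cont_coord by (rule openin_continuous_map_preimage)
      (use U in \<open>simp add: openin_adjoin_point inj_vimage_image_eq\<close>)
  moreover have "{x \<in> topspace Y. x 0 \<in> Some ` U} = {x \<in> topspace Y. ext_proj x \<in> U}"
    unfolding topspace_Y by (rule Collect_cong, rule conj_cong[OF refl], subst Ext_D(1)) auto
  ultimately show "openin Y {x \<in> topspace Y. ext_proj x \<in> U}" by simp
qed

lemma F_eq: "F = {x \<in> Ext. ext_proj x \<in> D}" and G_eq: "G = {x \<in> Ext. ext_proj x \<in> \<alpha> ` D}"
  unfolding ext_dom_def ext_ran_def topspace_Y pow_ran_R by simp_all

section \<open>The extended map and its inverse\<close>

definition shift :: "(nat \<Rightarrow> 'x option) \<Rightarrow> nat \<Rightarrow> 'x option" where
  "shift x = (\<lambda>n. x (Suc n))"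

lemma map_0: "\<beta> x 0 = Some (\<alpha> (ext_proj x))" and map_Suc: "\<beta> x (Suc n) = x n"
  by (simp_all add: ext_map_def)

lemma proj_map: "ext_proj (\<beta> x) = \<alpha> (ext_proj x)"
  by (simp add: ext_proj_def map_0)

lemma shift_map: "shift (\<beta> x) = x"
  by (simp add: shift_def map_Suc)

lemma map_mem: "x \<in> F \<Longrightarrow> \<beta> x \<in> G"
proof -
  assume "x \<in> F"
  then have x: "x \<in> Ext" "ext_proj x \<in> D" by (auto simp: F_eq)
  have "link (\<beta> x n) (\<beta> x (Suc n))" for n
  proof (cases n)
    case 0
    then show ?thesis using x(2) Ext_D(1)[OF x(1)] by (simp add: map_0 map_Suc link_def)
  qed (simp add: map_Suc Ext_D(3)[OF x(1)])
  then have "\<beta> x \<in> Ext" using x R_subset by (auto simp: Ext_def map_0)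
  then show ?thesis using x by (simp add: G_eq proj_map)
qed

lemma G_Some:
  assumes "x \<in> G"
  obtains b where "b \<in> D" "x (Suc 0) = Some b" "x 0 = Some (\<alpha> b)"
proof -
  have x: "x \<in> Ext" "ext_proj x \<in> \<alpha> ` D" using assms by (auto simp: G_eq)
  have "x (Suc 0) \<noteq> None"
    using Ext_D(1)[OF x(1)] Ext_D(3)[OF x(1), of 0] x(2)
    by (auto simp: link_def split: option.splits)
  then obtain b where b: "x (Suc 0) = Some b" by blast
  then show thesis using that Ext_Some[OF x(1) b] by simp
qed

lemma shift_mem: "x \<in> G \<Longrightarrow> shift x \<in> F" and map_shift: "x \<in> G \<Longrightarrow> \<beta> (shift x) = x"
proof -
  assume G: "x \<in> G"
  then have x: "x \<in> Ext" by (simp add: G_eq)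
  obtain b where b: "b \<in> D" "x (Suc 0) = Some b" "x 0 = Some (\<alpha> b)" using G_Some[OF G] by blast
  have "shift x \<in> Ext" using b D_subset Ext_D(3)[OF x] by (auto simp: Ext_def shift_def)
  then show "shift x \<in> F" using b by (simp add: F_eq ext_proj_def shift_def)
  show "\<beta> (shift x) = x"
  proof
    fix n show "\<beta> (shift x) n = x n"
      using b by (cases n) (simp_all add: map_0 map_Suc shift_def ext_proj_def)
  qed
qed

text \<open>The first entry lies outside the range, so its link forces \<open>None\<close> next, and
  \<open>None\<close> persists.\<close>

lemma Ext_not_G:
  assumes "x \<in> Ext" "x \<notin> G"
  shows "x (Suc n) = None"
proof -
  have "x (Suc 0) = None"
  proof (cases "x (Suc 0)")
    case (Some b)
    then have "x \<in> G" using Ext_Some[OF assms(1) Some] Ext_D(1)[OF assms(1)] assms(1) by (auto simp: G_eq)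
    then show ?thesis using assms(2) by simp
  qed
  then show ?thesis using Ext_None[OF assms(1), of "Suc 0" "Suc n"] by simp
qed

text \<open>Continuity is checked coordinatewise. As \<open>ext_proj\<close> intertwines
  \<open>\<beta>\<close> with \<open>\<alpha>\<close>, a periodic point of the extension would
  project to one in \<open>X\<close>.\<close>

lemma free_partial_homeo: "free_partial_homeo Y F G \<beta> shift"
proof
  have pre: "openin Y {x \<in> topspace Y. ext_proj x \<in> U}" if "openin X U" for U
    using cont_proj that by (rule openin_continuous_map_preimage)
  have pre': "closedin Y {x \<in> topspace Y. ext_proj x \<in> U}" if "closedin X U" for U
    using cont_proj that by (rule closedin_continuous_map_preimage)
  show oF: "openin Y F" "closedin Y F" "openin Y G" "closedin Y G"
    using pre[OF D(1)] pre'[OF D(2)] pre[OF R] pre'[OF closed_R] by (simp_all add: F_eq G_eq topspace_Y)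
  have FG: "F \<subseteq> Ext" "G \<subseteq> Ext" by (auto simp: F_eq G_eq)
  have tsF: "topspace (subtopology Y F) = F" "topspace (subtopology Y G) = G"
    using FG by (auto simp: topspace_Y)
  have coord: "continuous_map (subtopology Y T) (adjoin_point X) (\<lambda>x. x n)" for T n
    using cont_coord by (rule continuous_map_from_subtopology)
  have "continuous_map (subtopology Y F) (subtopology X D) ext_proj"
    using continuous_map_from_subtopology[OF cont_proj] by (auto simp: continuous_map_in_subtopology F_eq)
  then have c0: "continuous_map (subtopology Y F) (adjoin_point X) (\<lambda>x. \<beta> x 0)"
    using continuous_map_compose[OF continuous_map_compose[OF _ \<alpha>] continuous_map_Some]
    by (simp add: map_0 o_def)
  have "continuous_map (subtopology Y F) P \<beta>"
    unfolding continuous_map_componentwise_UNIV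
  proof
    fix k show "continuous_map (subtopology Y F) (adjoin_point X) (\<lambda>x. \<beta> x k)"
      using c0 coord by (cases k) (simp_all add: map_Suc)
  qed
  then have "continuous_map (subtopology Y F) Y \<beta>"
    using map_mem FG tsF by (auto simp: Y_eq continuous_map_in_subtopology)
  then show "continuous_map (subtopology Y F) (subtopology Y G) \<beta>"
    using map_mem tsF by (auto simp: continuous_map_in_subtopology)
  have "continuous_map (subtopology Y G) P shift"
    unfolding continuous_map_componentwise_UNIV shift_def using coord by simp
  then have "continuous_map (subtopology Y G) Y shift"
    using shift_mem FG tsF by (auto simp: Y_eq continuous_map_in_subtopology)
  then show "continuous_map (subtopology Y G) (subtopology Y F) shift"
    using shift_mem tsF by (auto simp: continuous_map_in_subtopology)
  show "no_periodic_points (topspace Y) F \<beta>"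
    unfolding no_periodic_points_def
  proof clarify
    fix n x assume n: "n \<ge> (1::nat)" and x: "x \<in> pow_dom (topspace Y) F \<beta> n" "(\<beta> ^^ n) x = x"
    have pk: "ext_proj ((\<beta> ^^ k) x) = (\<alpha> ^^ k) (ext_proj x)" for k
      by (induction k) (simp_all add: proj_map)
    have "ext_proj x \<in> pow_dom S D \<alpha> n"
      using x(1) Ext_D(2)[of x] by (auto simp: pow_dom_def topspace_Y F_eq pk)
    moreover have "(\<alpha> ^^ n) (ext_proj x) = ext_proj x" using pk[of n] x(2) by simp
    ultimately show False using free_X n unfolding no_periodic_points_def by blast
  qed
qed (simp_all add: compact_Y Hausdorff_Y shift_map map_shift)

sublocale free_partial_homeo Y F G \<beta> shift
  by (rule free_partial_homeo)

section \<open>Invariant sets of the extension\<close>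

lemma clos_inv_X_iff: "V \<in> clos_inv X D \<alpha> \<longleftrightarrow> closedin X V \<and> \<alpha> ` (V \<inter> D) = V \<inter> \<alpha> ` D"
  using invariant_sets_iff[OF closedin_subset D_subset] by (auto simp: clos_inv_def)

lemma clos_inv_Y_iff: "V \<in> clos_inv Y F \<beta> \<longleftrightarrow> closedin Y V \<and> \<beta> ` (V \<inter> F) = V \<inter> G"
  using invariant_sets_iff[OF closedin_subset FG_subset(1), of V \<beta>] by (auto simp: clos_inv_def image_F)

definition lift :: "'x set \<Rightarrow> (nat \<Rightarrow> 'x option) set" where
  "lift V = {x \<in> Ext. \<forall>n. x n \<in> insert None (Some ` V)}"

lemma lift_mono: "V \<subseteq> W \<Longrightarrow> lift V \<subseteq> lift W"
  by (auto simp: lift_def)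

lemma lift_clos_inv:
  assumes V: "V \<in> clos_inv X D \<alpha>"
  shows "lift V \<in> clos_inv Y F \<beta>"
proof -
  have cl: "closedin X V" and inv: "\<alpha> ` (V \<inter> D) = V \<inter> \<alpha> ` D" using V by (auto simp: clos_inv_X_iff)
  have VS: "V \<subseteq> S" by (rule closedin_subset[OF cl])
  have "closedin (adjoin_point X) (insert None (Some ` V))"
    using cl VS by (subst closedin_adjoin_point) (auto simp: vimage_def image_iff)
  then have "closedin Y {x \<in> topspace Y. x n \<in> insert None (Some ` V)}" for n
    using cont_coord by (rule closedin_continuous_map_preimage[rotated])
  then have "closedin Y (\<Inter>n. {x \<in> topspace Y. x n \<in> insert None (Some ` V)})"
    by (intro closedin_INT) auto
  also have "(\<Inter>n. {x \<in> topspace Y. x n \<in> insert None (Some ` V)}) = lift V"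
    by (auto simp: lift_def topspace_Y)
  finally have "closedin Y (lift V)" .
  moreover have "\<beta> ` (lift V \<inter> F) = lift V \<inter> G"
  proof
    show "\<beta> ` (lift V \<inter> F) \<subseteq> lift V \<inter> G"
    proof clarify
      fix x assume x: "x \<in> lift V" "x \<in> F"
      then have e: "x \<in> Ext" "ext_proj x \<in> D" by (auto simp: F_eq)
      have "x 0 \<in> insert None (Some ` V)" using x(1) by (simp add: lift_def)
      then have "ext_proj x \<in> V" using Ext_D(1)[OF e(1)] by auto
      then have "\<alpha> (ext_proj x) \<in> V" using e inv by blast
      then have "\<beta> x n \<in> insert None (Some ` V)" for n
        using x(1) by (cases n) (auto simp: map_0 map_Suc lift_def)
      then show "\<beta> x \<in> lift V \<inter> G" using map_mem[OF x(2)] by (simp add: lift_def G_eq)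
    qed
    show "lift V \<inter> G \<subseteq> \<beta> ` (lift V \<inter> F)"
    proof clarify
      fix x assume x: "x \<in> lift V" "x \<in> G"
      have "shift x \<in> lift V"
        using x shift_mem[OF x(2)] by (auto simp: lift_def shift_def F_eq)
      then show "x \<in> \<beta> ` (lift V \<inter> F)"
        using shift_mem[OF x(2)] map_shift[OF x(2)] by (intro image_eqI[of _ _ "shift x"]) auto
    qed
  qed
  ultimately show ?thesis by (simp add: clos_inv_Y_iff)
qed

text \<open>The projection of a closed set is closed by compactness of the extension; invariance
  passes down through \<open>proj_map\<close>.\<close>

lemma proj_clos_inv:
  assumes W: "W \<in> clos_inv Y F \<beta>"
  shows "ext_proj ` W \<in> clos_inv X D \<alpha>"
proof -
  have cl: "closedin Y W" and inv: "\<beta> ` (W \<inter> F) = W \<inter> G" using W by (auto simp: clos_inv_Y_iff)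
  have WE: "W \<subseteq> Ext" using closedin_subset[OF cl] by (simp add: topspace_Y)
  have "compactin X (ext_proj ` W)"
    using closedin_compact_space[OF compact_Y cl] cont_proj by (rule image_compactin)
  then have "closedin X (ext_proj ` W)" by (rule compactin_imp_closedin[OF Hausdorff_X])
  moreover have "\<alpha> ` (ext_proj ` W \<inter> D) = ext_proj ` W \<inter> \<alpha> ` D"
  proof
    show "\<alpha> ` (ext_proj ` W \<inter> D) \<subseteq> ext_proj ` W \<inter> \<alpha> ` D"
    proof clarify
      fix x assume x: "x \<in> W" "ext_proj x \<in> D"
      then have "x \<in> F" using WE by (auto simp: F_eq)
      then have "\<beta> x \<in> W" using inv x by blast
      then have "\<alpha> (ext_proj x) \<in> ext_proj ` W" by (metis imageI proj_map)
      then show "\<alpha> (ext_proj x) \<in> ext_proj ` W \<inter> \<alpha> ` D" using x by simp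
    qed
    show "ext_proj ` W \<inter> \<alpha> ` D \<subseteq> \<alpha> ` (ext_proj ` W \<inter> D)"
    proof
      fix a assume "a \<in> ext_proj ` W \<inter> \<alpha> ` D"
      then obtain x where x: "x \<in> W" "a = ext_proj x" "ext_proj x \<in> \<alpha> ` D" by blast
      then have "x \<in> W \<inter> G" using WE by (auto simp: G_eq)
      then obtain z where z: "z \<in> W" "z \<in> F" "x = \<beta> z" using inv by blast
      then show "a \<in> \<alpha> ` (ext_proj ` W \<inter> D)" using x by (auto simp: proj_map F_eq)
    qed
  qed
  ultimately show ?thesis by (simp add: clos_inv_X_iff)
qed

text \<open>A point of \<open>V\<close> in the range of \<open>\<alpha>\<close> has a preimage
  inside \<open>V\<close>, so every point of \<open>V\<close> can be prolonged backwards within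
  \<open>V\<close>.\<close>

lemma proj_lift:
  assumes V: "V \<in> clos_inv X D \<alpha>"
  shows "ext_proj ` lift V = V"
proof
  have cl: "closedin X V" and inv: "\<alpha> ` (V \<inter> D) = V \<inter> \<alpha> ` D" using V by (auto simp: clos_inv_X_iff)
  have VS: "V \<subseteq> S" by (rule closedin_subset[OF cl])
  show "ext_proj ` lift V \<subseteq> V"
  proof clarify
    fix x assume x: "x \<in> lift V"
    then have "x 0 \<in> insert None (Some ` V)" "x \<in> Ext" by (auto simp: lift_def)
    then show "ext_proj x \<in> V" using Ext_D(1)[of x] by auto
  qed
  show "V \<subseteq> ext_proj ` lift V"
  proof
    fix v assume v: "v \<in> V"
    \<comment> \<open>Off the range the orbit must stop with \<open>None\<close>, as
      \<open>link\<close> demands; on the range a preimage has to be chosen inside \<open>V\<close>,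
      not merely in \<open>D\<close>.\<close>
    define nxt where "nxt u = (case u of None \<Rightarrow> None | Some a \<Rightarrow>
      if a \<in> \<alpha> ` D then Some (SOME b. b \<in> V \<inter> D \<and> \<alpha> b = a) else None)" for u
    define x where "x = rec_nat (Some v) (\<lambda>_. nxt)"
    have x: "x 0 = Some v" "x (Suc n) = nxt (x n)" for n by (simp_all add: x_def)
    have sel: "(SOME b. b \<in> V \<inter> D \<and> \<alpha> b = a) \<in> V \<inter> D \<and> \<alpha> (SOME b. b \<in> V \<inter> D \<and> \<alpha> b = a) = a"
      if "a \<in> V" "a \<in> \<alpha> ` D" for a
    proof (rule someI_ex)
      have "a \<in> \<alpha> ` (V \<inter> D)" using that inv by simp
      then show "\<exists>b. b \<in> V \<inter> D \<and> \<alpha> b = a" by auto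
    qed
    have xV: "x n \<in> insert None (Some ` V)" for n
    proof (induction n)
      case (Suc n)
      then show ?case using sel by (auto simp: x nxt_def)
    qed (use v in \<open>simp add: x\<close>)
    have "link (x n) (x (Suc n))" for n
    proof (cases "x n")
      case (Some a)
      then have "a \<in> V" using xV[of n] by auto
      then show ?thesis using sel[of a] VS Some by (auto simp: x nxt_def link_def)
    qed (simp add: x nxt_def link_def)
    then have "x \<in> lift V" using xV v VS by (auto simp: lift_def Ext_def x)
    moreover have "ext_proj x = v" by (simp add: ext_proj_def x)
    ultimately show "v \<in> ext_proj ` lift V" by blast
  qed
qed

text \<open>Entry \<open>Suc n\<close> of \<open>\<beta> z\<close> is entry \<open>n\<close> of
  \<open>z\<close>, and invariance keeps \<open>z\<close> in \<open>W\<close>; after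
  \<open>n\<close> such steps the entry is a first entry.\<close>

lemma entry_in_proj:
  assumes W: "W \<in> clos_inv Y F \<beta>" and "x \<in> W" "x n = Some a"
  shows "a \<in> ext_proj ` W"
  using assms(2,3)
proof (induction n arbitrary: x)
  case 0
  then have "ext_proj x = a" by (simp add: ext_proj_def)
  then show ?case using 0 by blast
next
  case (Suc n)
  have inv: "\<beta> ` (W \<inter> F) = W \<inter> G" using W by (simp add: clos_inv_Y_iff)
  have "x \<in> Ext" using Suc.prems(1) clos_invD(2)[OF W] by (auto simp: topspace_Y)
  then have "x \<in> G" using Ext_not_G[of x n] Suc.prems by auto
  then obtain z where z: "z \<in> W" "x = \<beta> z" using inv Suc.prems by blast
  then show ?case using Suc.IH[of z] Suc.prems by (simp add: map_Suc)
qed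

text \<open>For \<open>x\<close> in \<open>G\<close> the shifted sequence is approximated in
  \<open>W\<close> and moved forward by \<open>\<beta>\<close>, which gains one coordinate. Outside
  \<open>G\<close> all later entries are \<open>None\<close>, so a member of \<open>W\<close> with
  the same first entry is already equal to \<open>x\<close>.\<close>

lemma approx_in_invariant:
  assumes W: "W \<in> clos_inv Y F \<beta>" and "x \<in> lift (ext_proj ` W)"
  shows "\<exists>z\<in>W. \<forall>i\<le>n. z i = x i"
  using assms(2)
proof (induction n arbitrary: x)
  have WE: "W \<subseteq> Ext" using clos_invD(2)[OF W] by (simp add: topspace_Y)
  have start: "\<exists>z\<in>W. z 0 = x 0" if x: "x \<in> lift (ext_proj ` W)" for x
  proof -
    have "x 0 \<in> insert None (Some ` ext_proj ` W)" "x \<in> Ext" using x by (auto simp: lift_def)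
    then obtain z where z: "z \<in> W" "x 0 = Some (ext_proj z)" using Ext_D(1)[of x] by auto
    then show ?thesis using Ext_D(1)[of z] WE by auto
  qed
  { case 0 then show ?case using start by simp }
  case (Suc n)
  have x: "x \<in> Ext" using Suc.prems by (simp add: lift_def)
  show ?case
  proof (cases "x \<in> G")
    case True
    have "shift x \<in> lift (ext_proj ` W)"
      using Suc.prems shift_mem[OF True] by (auto simp: lift_def shift_def F_eq)
    then obtain z where z: "z \<in> W" "\<forall>i\<le>n. z i = shift x i" using Suc.IH by blast
    obtain b where b: "b \<in> D" "x (Suc 0) = Some b" "x 0 = Some (\<alpha> b)" using G_Some[OF True] by blast
    have z0: "z 0 = Some b" using z(2) b by (simp add: shift_def)
    then have "z \<in> F" using z(1) WE b by (auto simp: F_eq ext_proj_def)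
    then have "\<beta> z \<in> W" using W z(1) by (auto simp: clos_inv_Y_iff)
    moreover have "\<beta> z i = x i" if "i \<le> Suc n" for i
      using that z(2) z0 b by (cases i) (simp_all add: map_0 map_Suc shift_def ext_proj_def)
    ultimately show ?thesis by blast
  next
    case False
    obtain z where z: "z \<in> W" "z 0 = x 0" using start[OF Suc.prems] by blast
    then have "ext_proj z = ext_proj x" by (simp add: ext_proj_def)
    then have "z \<notin> G" using False x by (auto simp: G_eq)
    then have "z i = x i" for i
      using Ext_not_G[OF x False] Ext_not_G[of z] z WE by (cases i) auto
    then show ?thesis using z(1) by blast
  qed
qed

text \<open>A basic open set of the product restricts finitely many coordinates, so approximation in
  initial coordinates together with closedness of \<open>W\<close> gives the inclusion into
  \<open>W\<close>. Thus a closed invariant set is determined by its projection.\<close>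

lemma lift_proj:
  assumes W: "W \<in> clos_inv Y F \<beta>"
  shows "lift (ext_proj ` W) = W"
proof
  have cl: "closedin Y W" using W by (simp add: clos_inv_Y_iff)
  have WE: "W \<subseteq> Ext" using closedin_subset[OF cl] by (simp add: topspace_Y)
  show "W \<subseteq> lift (ext_proj ` W)"
  proof
    fix x assume x: "x \<in> W"
    have "x n \<in> insert None (Some ` ext_proj ` W)" for n
      using entry_in_proj[OF W x, of n] by (cases "x n") auto
    then show "x \<in> lift (ext_proj ` W)" using x WE by (auto simp: lift_def)
  qed
  show "lift (ext_proj ` W) \<subseteq> W"
  proof
    fix x assume x: "x \<in> lift (ext_proj ` W)"
    then have xE: "x \<in> Ext" by (simp add: lift_def)
    show "x \<in> W"
    proof (rule ccontr)
      assume "x \<notin> W"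
      moreover have "openin Y (Ext - W)" using cl by (simp add: closedin_def topspace_Y)
      then obtain U where U: "openin P U" "Ext - W = U \<inter> Ext"
        unfolding Y_eq openin_subtopology by blast
      ultimately have "x \<in> U" using xE by blast
      with U(1) obtain B where B: "finite {i. B i \<noteq> topspace (adjoin_point X)}" "x \<in> Pi\<^sub>E UNIV B" "Pi\<^sub>E UNIV B \<subseteq> U"
        unfolding openin_product_topology_alt by auto
      obtain N where N: "\<And>i. B i \<noteq> topspace (adjoin_point X) \<Longrightarrow> i \<le> N"
        using B(1) by (metis (mono_tags) finite_nat_set_iff_bounded_le mem_Collect_eq)
      obtain z where z: "z \<in> W" "\<forall>i\<le>N. z i = x i" using approx_in_invariant[OF W x] by blast
      have zP: "z i \<in> topspace (adjoin_point X)" for i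
        using z(1) WE Ext_P topspace_P[of z] by (auto simp: topspace_adjoin_point)
      have "z i \<in> B i" for i
      proof (cases "i \<le> N")
        case True
        then show ?thesis using z(2) B(2) by (auto simp: PiE_iff)
      next
        case False
        then have "B i = topspace (adjoin_point X)" using N by blast
        then show ?thesis using zP by simp
      qed
      then have "z \<in> U" using B(3) by (auto simp: PiE_iff)
      then show False using U(2) z(1) WE by blast
    qed
  qed
qed

lemma clos_inv_X_eq: "clos_inv X D \<alpha> = (`) ext_proj ` clos_inv Y F \<beta>"
proof
  show "clos_inv X D \<alpha> \<subseteq> (`) ext_proj ` clos_inv Y F \<beta>"
    using proj_lift lift_clos_inv by (intro subsetI image_eqI[where f = "(`) ext_proj"]) auto
qed (use proj_clos_inv in auto)

section \<open>Ideals generated by functions on the extension and on \<open>X\<close>\<close>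

lemma cov_alg_eq: "cov_alg X D \<alpha> = enveloping_cstar L"
  by (simp add: cov_alg_def cov_l1_def)

lemma emb_B_eq: "emb_B X D \<alpha> h = env_class L (\<lambda>_. emb h)"
  by (simp add: emb_B_def env_incl_def cov_l1_def monomial_def)

definition pull :: "('x \<Rightarrow> complex) \<Rightarrow> (nat \<Rightarrow> 'x option) \<Rightarrow> complex" where
  "pull a = (\<lambda>x. if x \<in> topspace Y then a (ext_proj x) else 0)"

lemma emb_A_eq: "emb_A X D \<alpha> a = env_class L (\<lambda>_. emb (pull a))"
  by (simp add: emb_A_def emb_B_eq pull_def)

lemma pull_CY: "a \<in> C_van X K \<Longrightarrow> pull a \<in> CY"
proof (rule C_vanI)
  assume "a \<in> C_van X K"
  then have "continuous_map Y euclidean (\<lambda>x. a (ext_proj x))"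
    using continuous_map_compose[OF cont_proj, of euclidean a] by (simp add: C_van_def o_def)
  then show "continuous_map Y euclidean (pull a)"
    by (rule continuous_map_eq) (simp add: pull_def)
qed (simp add: pull_def)

lemma emb_B_in_ideal_of:
  "W \<in> clos_inv Y F \<beta> \<Longrightarrow> h \<in> CY \<Longrightarrow> emb_B X D \<alpha> h \<in> ideal_of W \<longleftrightarrow> (\<forall>x\<in>W. h x = 0)"
  unfolding emb_B_eq emb_in_ideal_of by (auto simp: C_van_def dest: clos_invD(2))

lemma emb_A_in_ideal_of:
  assumes "W \<in> clos_inv Y F \<beta>" "a \<in> C_van X K"
  shows "emb_A X D \<alpha> a \<in> ideal_of W \<longleftrightarrow> (\<forall>v\<in>ext_proj ` W. a v = 0)"
proof -
  have "emb_A X D \<alpha> a \<in> ideal_of W \<longleftrightarrow> (\<forall>x\<in>W. pull a x = 0)"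
    using emb_B_in_ideal_of[OF assms(1) pull_CY[OF assms(2)]] by (simp add: emb_A_eq emb_B_eq)
  also have "\<dots> \<longleftrightarrow> (\<forall>v\<in>ext_proj ` W. a v = 0)"
    using clos_invD(2)[OF assms(1)] by (auto simp: pull_def)
  finally show ?thesis .
qed

text \<open>Every closed ideal has the form \<open>ideal_of W'\<close>, and \<open>ideal_of\<close>
  reverses inclusion; so among those containing \<open>K\<close> the ideal of the largest set
  \<open>W\<close> is the least.\<close>

lemma closed_ideal_gen_eq:
  assumes W: "W \<in> clos_inv Y F \<beta>"
    and K: "\<And>W'. W' \<in> clos_inv Y F \<beta> \<Longrightarrow> K \<subseteq> ideal_of W' \<longleftrightarrow> W' \<subseteq> W"
  shows "closed_ideal_gen (cov_alg X D \<alpha>) K = ideal_of W"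
proof -
  have "{J \<in> closed_ideals (cov_alg X D \<alpha>). K \<subseteq> J} = ideal_of ` {W' \<in> clos_inv Y F \<beta>. W' \<subseteq> W}"
    using K unfolding cov_alg_eq closed_ideals_eq by auto
  then have "closed_ideal_gen (cov_alg X D \<alpha>) K = \<Inter>(ideal_of ` {W' \<in> clos_inv Y F \<beta>. W' \<subseteq> W})"
    by (simp add: closed_ideal_gen_def)
  also have "\<dots> = ideal_of W"
    using W ideal_of_mono by blast
  finally show ?thesis .
qed

lemma emb_B_subset_iff:
  assumes W: "W \<in> clos_inv Y F \<beta>" and W': "W' \<in> clos_inv Y F \<beta>"
  shows "emb_B X D \<alpha> ` C_van Y (topspace Y - W) \<subseteq> ideal_of W' \<longleftrightarrow> W' \<subseteq> W"
proof
  assume sub: "emb_B X D \<alpha> ` C_van Y (topspace Y - W) \<subseteq> ideal_of W'"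
  show "W' \<subseteq> W"
  proof (rule ccontr)
    assume "\<not> W' \<subseteq> W"
    then obtain w where w: "w \<in> W'" "w \<notin> W" by blast
    then have "w \<in> topspace Y" using clos_invD(2)[OF W'] by blast
    then obtain h where h: "h \<in> C_van Y (topspace Y - W)" "h w = 1"
      using C_van_separates[OF compact_Y Hausdorff_Y clos_invD(1)[OF W] _ w(2)] by blast
    have "h \<in> CY" using h(1) by (rule C_van_mono) simp
    then show False using emb_B_in_ideal_of[OF W'] sub h w by auto
  qed
next
  assume sub: "W' \<subseteq> W"
  show "emb_B X D \<alpha> ` C_van Y (topspace Y - W) \<subseteq> ideal_of W'"
  proof clarify
    fix h assume h: "h \<in> C_van Y (topspace Y - W)"
    then have "h \<in> CY" by (rule C_van_mono) simp
    moreover have "\<forall>x\<in>W'. h x = 0" using h sub by (auto simp: C_van_def)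
    ultimately show "emb_B X D \<alpha> h \<in> ideal_of W'" using emb_B_in_ideal_of[OF W'] by simp
  qed
qed

text \<open>Functions on \<open>X\<close> detect only the projections of \<open>W\<close> and
  \<open>W'\<close>. Inclusion of the projections gives inclusion of the sets because
  \<open>lift\<close> recovers both.\<close>

lemma emb_A_subset_iff:
  assumes W: "W \<in> clos_inv Y F \<beta>" and W': "W' \<in> clos_inv Y F \<beta>"
  shows "emb_A X D \<alpha> ` C_van X (S - ext_proj ` W) \<subseteq> ideal_of W' \<longleftrightarrow> W' \<subseteq> W"
proof
  assume sub: "emb_A X D \<alpha> ` C_van X (S - ext_proj ` W) \<subseteq> ideal_of W'"
  have "ext_proj ` W' \<subseteq> ext_proj ` W"
  proof (rule ccontr)
    assume "\<not> ext_proj ` W' \<subseteq> ext_proj ` W"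
    then obtain v where v: "v \<in> ext_proj ` W'" "v \<notin> ext_proj ` W" by blast
    have cl: "closedin X (ext_proj ` W)" "closedin X (ext_proj ` W')"
      using proj_clos_inv[OF W] proj_clos_inv[OF W'] by (auto simp: clos_inv_X_iff)
    then have "v \<in> S" using v(1) closedin_subset by blast
    then obtain a where a: "a \<in> C_van X (S - ext_proj ` W)" "a v = 1"
      using C_van_separates[OF compact_X Hausdorff_X cl(1) _ v(2)] by blast
    then have "emb_A X D \<alpha> a \<in> ideal_of W'" using sub by blast
    then show False using emb_A_in_ideal_of[OF W' a(1)] a(2) v(1) by auto
  qed
  then show "W' \<subseteq> W" using lift_mono lift_proj[OF W] lift_proj[OF W'] by metis
next
  assume sub: "W' \<subseteq> W"
  show "emb_A X D \<alpha> ` C_van X (S - ext_proj ` W) \<subseteq> ideal_of W'"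
  proof clarify
    fix a assume a: "a \<in> C_van X (S - ext_proj ` W)"
    then have "\<forall>v\<in>ext_proj ` W'. a v = 0" using sub by (auto simp: C_van_def)
    then show "emb_A X D \<alpha> a \<in> ideal_of W'" using emb_A_in_ideal_of[OF W' a] by simp
  qed
qed

lemma gen_A: "W \<in> clos_inv Y F \<beta> \<Longrightarrow>
    closed_ideal_gen (cov_alg X D \<alpha>) (emb_A X D \<alpha> ` C_van X (S - ext_proj ` W)) = ideal_of W"
  by (rule closed_ideal_gen_eq) (simp_all add: emb_A_subset_iff)

lemma gen_B: "W \<in> clos_inv Y F \<beta> \<Longrightarrow>
    closed_ideal_gen (cov_alg X D \<alpha>) (emb_B X D \<alpha> ` C_van Y (topspace Y - W)) = ideal_of W"
  by (rule closed_ideal_gen_eq) (simp_all add: emb_B_subset_iff)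

lemma ideal_of_subset_iff:
  assumes "W \<in> clos_inv Y F \<beta>" "W' \<in> clos_inv Y F \<beta>"
  shows "ideal_of W \<subseteq> ideal_of W' \<longleftrightarrow> W' \<subseteq> W"
proof
  assume sub: "ideal_of W \<subseteq> ideal_of W'"
  have "emb_B X D \<alpha> ` C_van Y (topspace Y - W) \<subseteq> ideal_of W"
    using emb_B_subset_iff[OF assms(1) assms(1)] by simp
  then show "W' \<subseteq> W" using emb_B_subset_iff[OF assms] sub by blast
qed (rule ideal_of_mono)

text \<open>Both lattices are written as images of the closed invariant sets of the extension. These
  are stable under union and intersection, since there invariance means stability under all integer
  powers.\<close>

lemma anti_iso:
  "lattice_anti_iso (inclusion_order (clos_inv X D \<alpha>)) (inclusion_order (closed_ideals (cov_alg X D \<alpha>)))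
     (\<lambda>V. closed_ideal_gen (cov_alg X D \<alpha>) (emb_A X D \<alpha> ` C_van X (S - V)))"
  unfolding clos_inv_X_eq cov_alg_eq closed_ideals_eq
proof (rule lattice_anti_isoI)
  fix V W assume V: "V \<in> clos_inv Y F \<beta>" and W: "W \<in> clos_inv Y F \<beta>"
  show "V \<union> W \<in> clos_inv Y F \<beta>"
    using clos_invD[OF V] clos_invD[OF W] by (intro clos_invI) auto
  show "V \<inter> W \<in> clos_inv Y F \<beta>"
    using clos_invD[OF V] clos_invD[OF W] by (intro clos_invI) auto
  show "ext_proj ` V \<subseteq> ext_proj ` W \<longleftrightarrow> V \<subseteq> W"
    using lift_mono lift_proj[OF V] lift_proj[OF W] by (metis image_mono)
  show "ideal_of V \<subseteq> ideal_of W \<longleftrightarrow> W \<subseteq> V"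
    by (rule ideal_of_subset_iff[OF V W])
qed (use gen_A in \<open>simp add: cov_alg_eq\<close>)

lemma ideal_Int_B:
  assumes W: "W \<in> clos_inv Y F \<beta>"
  shows "ideal_of W \<inter> emb_B X D \<alpha> ` CY = emb_B X D \<alpha> ` C_van Y (topspace Y - W)"
proof
  show "ideal_of W \<inter> emb_B X D \<alpha> ` CY \<subseteq> emb_B X D \<alpha> ` C_van Y (topspace Y - W)"
    using emb_B_in_ideal_of[OF W] by (auto simp: C_van_def)
  show "emb_B X D \<alpha> ` C_van Y (topspace Y - W) \<subseteq> ideal_of W \<inter> emb_B X D \<alpha> ` CY"
    using emb_B_subset_iff[OF W W] C_van_mono[of _ "topspace Y - W" "topspace Y"] by blast
qed

lemma ideal_Int_A:
  assumes W: "W \<in> clos_inv Y F \<beta>"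
  shows "ideal_of W \<inter> emb_A X D \<alpha> ` C_van X S = emb_A X D \<alpha> ` C_van X (S - ext_proj ` W)"
proof
  show "ideal_of W \<inter> emb_A X D \<alpha> ` C_van X S \<subseteq> emb_A X D \<alpha> ` C_van X (S - ext_proj ` W)"
  proof clarify
    fix a assume a: "a \<in> C_van X S" and "emb_A X D \<alpha> a \<in> ideal_of W"
    then have "\<forall>v\<in>ext_proj ` W. a v = 0" using emb_A_in_ideal_of[OF W a] by simp
    then have "a \<in> C_van X (S - ext_proj ` W)" using a by (auto simp: C_van_def)
    then show "emb_A X D \<alpha> a \<in> emb_A X D \<alpha> ` C_van X (S - ext_proj ` W)" by (rule imageI)
  qed
  have "C_van X (S - ext_proj ` W) \<subseteq> C_van X S" by (auto simp: C_van_def)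
  then show "emb_A X D \<alpha> ` C_van X (S - ext_proj ` W) \<subseteq> ideal_of W \<inter> emb_A X D \<alpha> ` C_van X S"
    using emb_A_subset_iff[OF W W] by blast
qed

end

theorem theorem6p4:
  fixes X :: "'x topology" and D :: "'x set" and \<alpha> :: "'x \<Rightarrow> 'x"
  assumes "compact_space X" and "Hausdorff_space X"
    and "openin X D" and "closedin X D"
    and "continuous_map (subtopology X D) X \<alpha>"
    and "openin X (\<alpha> ` D)"
    and "no_periodic_points (topspace X) D \<alpha>"
  shows "lattice_anti_iso
           (inclusion_order (clos_inv X D \<alpha>))
           (inclusion_order (closed_ideals (cov_alg X D \<alpha>)))
           (\<lambda>V. closed_ideal_gen (cov_alg X D \<alpha>) (emb_A X D \<alpha> ` C_van X (topspace X - V)))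
       \<and> (\<forall>V \<in> clos_inv X D \<alpha>.
           \<forall>V' \<in> clos_inv (ext_space X D \<alpha>) (ext_dom X D \<alpha>) (ext_map \<alpha>).
             ext_proj ` V' = V \<longrightarrow>
             closed_ideal_gen (cov_alg X D \<alpha>) (emb_A X D \<alpha> ` C_van X (topspace X - V))
               = closed_ideal_gen (cov_alg X D \<alpha>)
                   (emb_B X D \<alpha> ` C_van (ext_space X D \<alpha>) (topspace (ext_space X D \<alpha>) - V')) \<and>
             closed_ideal_gen (cov_alg X D \<alpha>) (emb_A X D \<alpha> ` C_van X (topspace X - V))
                 \<inter> emb_B X D \<alpha> ` C_van (ext_space X D \<alpha>) (topspace (ext_space X D \<alpha>))
               = emb_B X D \<alpha> ` C_van (ext_space X D \<alpha>) (topspace (ext_space X D \<alpha>) - V') \<and>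
             closed_ideal_gen (cov_alg X D \<alpha>) (emb_A X D \<alpha> ` C_van X (topspace X - V))
                 \<inter> emb_A X D \<alpha> ` C_van X (topspace X)
               = emb_A X D \<alpha> ` C_van X (topspace X - V))"
proof -
  interpret reversible_extension X D \<alpha>
    using assms by unfold_locales
  show ?thesis
  proof (intro conjI ballI impI)
    fix V V' assume W: "V' \<in> clos_inv Y F \<beta>" and V: "ext_proj ` V' = V"
    note gen = gen_A[OF W, unfolded V]
    show "closed_ideal_gen (cov_alg X D \<alpha>) (emb_A X D \<alpha> ` C_van X (S - V))
         = closed_ideal_gen (cov_alg X D \<alpha>) (emb_B X D \<alpha> ` C_van Y (topspace Y - V'))"
      unfolding gen gen_B[OF W] ..
    show "closed_ideal_gen (cov_alg X D \<alpha>) (emb_A X D \<alpha> ` C_van X (S - V)) \<inter> emb_B X D \<alpha> ` CY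
         = emb_B X D \<alpha> ` C_van Y (topspace Y - V')"
      unfolding gen by (rule ideal_Int_B[OF W])
    show "closed_ideal_gen (cov_alg X D \<alpha>) (emb_A X D \<alpha> ` C_van X (S - V)) \<inter> emb_A X D \<alpha> ` C_van X S
         = emb_A X D \<alpha> ` C_van X (S - V)"
      unfolding gen using ideal_Int_A[OF W] unfolding V .
  qed (rule anti_iso)
qed

end
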